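(* Let $d\ge 2$ and $\gamma>-1$. Let $(x,t)=(\sqrt t\,\xi,t)\in\mathbb V_0^{d+1}$ and $(y,s)=(\sqrt s\,\eta,s)\in\mathbb V_0^{d+1}$ with $\xi,\eta\in\mathbb S^{d-1}$. Then for $\beta>-\frac12$ and every integer $n\ge 0$, $$ \mathsf P_n\big(\varpi_{\beta,\gamma};(x,t),(y,s)\big)= A_{\beta}\int_{-1}^1\int_{-1}^1 \mathbf P_n\Big(U_{\gamma,\beta+\frac{d-1}{2}};\big(\sqrt t,t\big),\big(\sqrt s\,(\tfrac{1-z_1}{2}\langle\xi,\eta\rangle+\tfrac{1+z_1}{2}z_2),\,s\big)\Big)(1-z_1)^{\frac{d-2}{2}}(1+z_1)^{\beta-\frac12}(1-z_2^2)^{\beta}\,dz_1\,dz_2, $$ where $A_\beta>0$ is the normalization constant with $A_\beta\int_{-1}^1\int_{-1}^1(1-z_1)^{\frac{d-2}{2}}(1+z_1)^{\beta-\frac12}(1-z_2^2)^{\beta}\,dz_1dz_2=1$; and for $\beta=-\frac12$, $$ \mathsf P_n\big(\varpi_{-\frac12,\gamma};(x,t),(y,s)\big)=\mathbf P_n\Big(U_{\gamma,\frac{d-2}{2}};\big(\sqrt t,t\big),\big(\langle\xi,y\rangle,s\big)\Big). $$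
   Context: The surface of the paraboloid is $\mathbb V_0^{d+1}=\{(x,t):x\in\mathbb R^d,\ \|x\|^2=t,\ 0\le t\le1\}$; its measure is defined, for $x=\sqrt t\,\xi$ with $\xi\in\mathbb S^{d-1}$, by $d\sigma(x,t)=t^{\frac{d-1}{2}}\,d\sigma_{\mathbb S}(\xi)\,dt$, where $d\sigma_{\mathbb S}$ is the surface measure of the unit sphere $\mathbb S^{d-1}\subset\mathbb R^d$. With $\varpi_{\beta,\gamma}(t)=t^\beta(1-t)^\gamma$, the inner product is $\langle f,g\rangle_{\beta,\gamma}=\mathsf b_{\beta,\gamma}\int_{\mathbb V_0^{d+1}}f g\,\varpi_{\beta,\gamma}(t)\,d\sigma(x,t)$, with $\mathsf b_{\beta,\gamma}$ chosen so that $\langle1,1\rangle_{\beta,\gamma}=1$. $\mathcal V_n(\mathbb V_0^{d+1},\varpi_{\beta,\gamma})$ is the space of restrictions to $\mathbb V_0^{d+1}$ of polynomials in $(x,t)$ of total degree at most $n$ that are orthogonal, with respect to $\langle\cdot,\cdot\rangle_{\beta,\gamma}$, to all polynomials of degree less than $n$. $\mathsf P_n(\varpi_{\beta,\gamma};\cdot,\cdot)$ is its reproducing kernel, $\mathsf P_n(\varpi_{\beta,\gamma};p,q)=\sum_j Q_j(p)Q_j(q)$ for any orthonormal basis $\{Q_j\}$ of $\mathcal V_n(\mathbb V_0^{d+1},\varpi_{\beta,\gamma})$. The parabolic domain is $\mathbb U=\{(x_1,x_2)\in\mathbb R^2:x_1^2\le x_2\le1\}$. For $a>-1$, $b>-\frac12$,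 $U_{a,b}(x)=(1-x_2)^a(x_2-x_1^2)^{b-\frac12}$, with inner product $\langle f,g\rangle_{\mathbb U}=\mathbf d_{a,b}\int_{\mathbb U}f g\,U_{a,b}\,dx$, $\mathbf d_{a,b}$ chosen so that $\langle1,1\rangle_{\mathbb U}=1$. $\mathcal V_n(\mathbb U,U_{a,b})$ is the space of polynomials in two variables of degree at most $n$ that are orthogonal to all polynomials of degree less than $n$, and $\mathbf P_n(U_{a,b};\cdot,\cdot)$ is its reproducing kernel, $\mathbf P_n(U_{a,b};x,y)=\sum_j P_j(x)P_j(y)$ for any orthonormal basis $\{P_j\}$ of $\mathcal V_n(\mathbb U,U_{a,b})$. *)

theory Defs
  imports "HOL-Analysis.Analysis"
begin

section \<open>Polynomial functions and reproducing kernels\<close>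

text \<open>
  Real polynomial functions of total degree at most \<open>n\<close> in the coordinates of a Euclidean space.
  On a product type the coordinates are those of both factors; \<open>\<alpha>\<close> ranges over multi-indices.
\<close>

definition polys_upto :: "nat \<Rightarrow> ('a::euclidean_space \<Rightarrow> real) set" where
  "polys_upto n =
     {f. \<exists>c. \<forall>x. f x = (\<Sum>\<alpha> | \<alpha> \<in> (Basis \<rightarrow>\<^sub>E {..n}) \<and> (\<Sum>i\<in>Basis. \<alpha> i) \<le> n.
                        c \<alpha> * (\<Prod>i\<in>Basis. (x \<bullet> i) ^ \<alpha> i))}"

text \<open>
  Having degree less than \<open>n\<close> means lying in \<open>polys_upto m\<close> for some \<open>m < n\<close>
  (for \<open>n = 0\<close> the orthogonality condition is empty).
\<close>

definition ortho_polys ::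
    "(('a::euclidean_space \<Rightarrow> real) \<Rightarrow> ('a \<Rightarrow> real) \<Rightarrow> real) \<Rightarrow> nat \<Rightarrow> ('a \<Rightarrow> real) set" where
  "ortho_polys ip n = {f \<in> polys_upto n. \<forall>m<n. \<forall>g \<in> polys_upto m. ip f g = 0}"

definition orthonormal_basis ::
    "(('a \<Rightarrow> real) \<Rightarrow> ('a \<Rightarrow> real) \<Rightarrow> real) \<Rightarrow> ('a \<Rightarrow> real) set \<Rightarrow> ('a \<Rightarrow> real) set \<Rightarrow> bool" where
  "orthonormal_basis ip V B \<longleftrightarrow>
     finite B \<and> B \<subseteq> V \<and>
     (\<forall>P\<in>B. \<forall>Q\<in>B. ip P Q = (if P = Q then 1 else 0)) \<and>
     (\<forall>f\<in>V. \<exists>c. \<forall>p. f p = (\<Sum>Q\<in>B. c Q * Q p))"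

text \<open>The sum does not depend on the orthonormal basis, so an arbitrary one is chosen.\<close>

definition reproducing_kernel ::
    "(('a \<Rightarrow> real) \<Rightarrow> ('a \<Rightarrow> real) \<Rightarrow> real) \<Rightarrow> ('a \<Rightarrow> real) set \<Rightarrow> 'a \<Rightarrow> 'a \<Rightarrow> real" where
  "reproducing_kernel ip V p q =
     (\<Sum>Q \<in> (SOME B. orthonormal_basis ip V B). Q p * Q q)"


section \<open>The surface of the paraboloid\<close>

definition V0 :: "('a::euclidean_space \<times> real) set" where
  "V0 = {(x, t). (norm x)\<^sup>2 = t \<and> 0 \<le> t \<and> t \<le> 1}"

text \<open>
  Surface measure of the unit sphere, as a Borel measure on the whole space: the measure of \<open>E\<close> is
  \<open>d\<close> times the Lebesgue measure of the cone \<open>{r \<xi> | \<xi> \<in> E, 0 < r \<le> 1}\<close>, which is polar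
  coordinates \<open>dx = r\<^sup>d\<^sup>-\<^sup>1 dr d\<sigma>(\<xi>)\<close> on the unit ball. Here \<open>sgn x = x / norm x\<close>;
  the origin, where \<open>sgn\<close> is \<open>0\<close>, is a null set.
\<close>

definition sphere_measure :: "'a::euclidean_space measure" where
  "sphere_measure =
     scale_measure (of_nat DIM('a)) (distr (restrict_space lborel (cball 0 1)) borel sgn)"

text \<open>The image of \<open>t\<^sup>(\<^sup>d\<^sup>-\<^sup>1\<^sup>)\<^sup>/\<^sup>2 d\<sigma>(\<xi>) dt\<close>, \<open>0 \<le> t \<le> 1\<close>, under \<open>(\<xi>, t) \<mapsto> (\<surd>t \<xi>, t)\<close>.\<close>

definition V0_measure :: "('a::euclidean_space \<times> real) measure" where
  "V0_measure =
     distr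
       (density (sphere_measure \<Otimes>\<^sub>M lborel)
          (\<lambda>(\<xi>, t). ennreal (indicat_real {0..1} t * t powr ((real DIM('a) - 1) / 2))))
       borel (\<lambda>(\<xi>, t). (sqrt t *\<^sub>R \<xi>, t))"

definition varpi :: "real \<Rightarrow> real \<Rightarrow> real \<Rightarrow> real" where
  "varpi \<beta> \<gamma> t = t powr \<beta> * (1 - t) powr \<gamma>"

definition V0_const :: "'a::euclidean_space itself \<Rightarrow> real \<Rightarrow> real \<Rightarrow> real" where
  "V0_const _ \<beta> \<gamma> =
     1 / (LINT p:(V0 :: ('a \<times> real) set)|V0_measure. varpi \<beta> \<gamma> (snd p))"

definition V0_inner ::
    "real \<Rightarrow> real \<Rightarrow> ('a::euclidean_space \<times> real \<Rightarrow> real) \<Rightarrow> ('a \<times> real \<Rightarrow> real) \<Rightarrow> real" where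
  "V0_inner \<beta> \<gamma> f g =
     V0_const TYPE('a) \<beta> \<gamma> * (LINT p:V0|V0_measure. f p * g p * varpi \<beta> \<gamma> (snd p))"

text \<open>
  The restriction of a function to \<open>V0\<close> is represented by its extension by zero, so that
  polynomials agreeing on \<open>V0\<close> are identified and linear combinations are pointwise.
\<close>

definition V0_ortho ::
    "real \<Rightarrow> real \<Rightarrow> nat \<Rightarrow> ('a::euclidean_space \<times> real \<Rightarrow> real) set" where
  "V0_ortho \<beta> \<gamma> n = (\<lambda>f p. if p \<in> V0 then f p else 0) ` ortho_polys (V0_inner \<beta> \<gamma>) n"

definition V0_kernel ::
    "nat \<Rightarrow> real \<Rightarrow> real \<Rightarrow> 'a::euclidean_space \<times> real \<Rightarrow> 'a \<times> real \<Rightarrow> real" where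
  "V0_kernel n \<beta> \<gamma> = reproducing_kernel (V0_inner \<beta> \<gamma>) (V0_ortho \<beta> \<gamma> n)"


section \<open>The parabolic domain\<close>

definition U :: "(real \<times> real) set" where
  "U = {(x1, x2). x1\<^sup>2 \<le> x2 \<and> x2 \<le> 1}"

definition U_weight :: "real \<Rightarrow> real \<Rightarrow> real \<times> real \<Rightarrow> real" where
  "U_weight a b = (\<lambda>(x1, x2). (1 - x2) powr a * (x2 - x1\<^sup>2) powr (b - 1/2))"

definition U_const :: "real \<Rightarrow> real \<Rightarrow> real" where
  "U_const a b = 1 / (LINT x:U|lborel. U_weight a b x)"

definition U_inner ::
    "real \<Rightarrow> real \<Rightarrow> (real \<times> real \<Rightarrow> real) \<Rightarrow> (real \<times> real \<Rightarrow> real) \<Rightarrow> real" where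
  "U_inner a b f g = U_const a b * (LINT x:U|lborel. f x * g x * U_weight a b x)"

definition U_kernel :: "nat \<Rightarrow> real \<Rightarrow> real \<Rightarrow> real \<times> real \<Rightarrow> real \<times> real \<Rightarrow> real" where
  "U_kernel n a b = reproducing_kernel (U_inner a b) (ortho_polys (U_inner a b) n)"


section \<open>The weight of the double integral\<close>

definition z_weight :: "nat \<Rightarrow> real \<Rightarrow> real \<Rightarrow> real \<Rightarrow> real" where
  "z_weight d \<beta> z1 z2 =
     (1 - z1) powr ((real d - 2) / 2) * (1 + z1) powr (\<beta> - 1/2) * (1 - z2\<^sup>2) powr \<beta>"

end

theory Submission
  imports Defs
begin

text \<open>
  Write \<open>T\<close> for the operator taking a polynomial \<open>f\<close> on the parabolic domain to the weighted average
  of \<open>f (\<surd>s ((1 - z1) / 2 \<langle>\<xi>, \<eta>\<rangle> + (1 + z1) / 2 z2), s)\<close> over \<open>z1\<close>, \<open>z2\<close> (simply \<open>f (\<langle>\<xi>, y\<rangle>, s)\<close>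
  if \<open>\<beta> = -1/2\<close>). It preserves the degree, and for every polynomial \<open>g\<close> on the paraboloid there is a
  polynomial \<open>r\<close> of no larger degree with \<open>\<langle>g, T f\<rangle> = \<langle>r, f\<rangle>\<close> for all \<open>f\<close> and \<open>r(\<surd>t, t) = g(\<surd>t \<xi>, t)\<close>.
  Hence \<open>T\<close> applied to the reproducing kernel of the parabolic domain at \<open>(\<surd>t, t)\<close> has the reproducing
  property at \<open>(\<surd>t \<xi>, t)\<close>.

  Both inner products separate into the same radial part and an angular part. For \<open>g\<close> homogeneous
  in \<open>y\<close>, the recursion for spherical moments given by the divergence theorem reduces \<open>g\<close> to a function of
  \<open>\<langle>\<xi>, \<eta>\<rangle>\<close>, and \<open>r\<close> arises by replacing Gegenbauer polynomials with parameter \<open>\<mu> = (d - 2) / 2\<close> by those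
  with parameter \<open>\<mu> + \<sigma>\<close>, \<open>\<sigma> = \<beta> + 1/2\<close>, both normalised to \<open>1\<close> at \<open>1\<close>. That this is adjoint to the averaging
  over \<open>z1\<close>, \<open>z2\<close> is a statement about moments, which amounts to the Rothe--Hagen identity.
\<close>


section \<open>Polynomials of bounded degree\<close>

text \<open>The kernels come from an arbitrarily chosen orthonormal basis, so the only handle on
  them is the reproducing property; this is why everything is phrased by duality. The point
  \<open>(sqrt t, t)\<close> lies on the boundary of the parabolic domain, where the angular
  variable \<open>v\<close> in \<open>u = sqrt t * v\<close> is 1. Gegenbauer polynomials normalised
  to 1 there keep their value when the parameter changes, and this carries evaluation at
  \<open>(sqrt t \<xi>, t)\<close> over to evaluation at \<open>(sqrt t, t)\<close>. The parameter
  \<open>b = \<mu> + \<sigma> = \<beta> + (d - 1) / 2\<close> is forced: it gives both sides the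
  radial weight \<open>t powr b * (1 - t) powr \<gamma>\<close>. The obstacle is the degree:
  \<open>t\<close> has degree one although it equals \<open>(norm x)\<^sup>2\<close> on the
  paraboloid, so square roots of \<open>t\<close> must combine to integer powers without raising the
  degree. Parity provides this: the averaged power of order \<open>k\<close> contains only powers of
  \<open>v\<close> congruent to \<open>k\<close> modulo 2, as does a Gegenbauer polynomial of degree
  \<open>k\<close>. Keeping \<sigma> \<ge> 0 in the algebra covers both formulas of the theorem at
  once.\<close>

definition monom_fun :: "('a::euclidean_space \<Rightarrow> nat) \<Rightarrow> 'a \<Rightarrow> real" where
  "monom_fun \<alpha> x = (\<Prod>i\<in>Basis. (x \<bullet> i) ^ \<alpha> i)"

definition multi_indices :: "nat \<Rightarrow> ('a::euclidean_space \<Rightarrow> nat) set" where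
  "multi_indices n = {\<alpha>. \<alpha> \<in> (Basis \<rightarrow>\<^sub>E {..n}) \<and> (\<Sum>i\<in>Basis. \<alpha> i) \<le> n}"

lemma finite_multi_indices: "finite (multi_indices n)"
  by (rule finite_subset[of _ "Basis \<rightarrow>\<^sub>E {..n}"]) (auto simp: multi_indices_def intro: finite_PiE)

lemma polys_upto_alt:
  "f \<in> polys_upto n \<longleftrightarrow> (\<exists>c. \<forall>x. f x = (\<Sum>\<alpha>\<in>multi_indices n. c \<alpha> * monom_fun \<alpha> x))"
  by (simp add: polys_upto_def multi_indices_def monom_fun_def)

lemma polys_upto_lincomb:
  assumes "f \<in> polys_upto n" "g \<in> polys_upto n"
  shows "(\<lambda>x. a * f x + b * g x) \<in> polys_upto n"
proof -
  obtain c d where "\<And>x. f x = (\<Sum>\<alpha>\<in>multi_indices n. c \<alpha> * monom_fun \<alpha> x)"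
    "\<And>x. g x = (\<Sum>\<alpha>\<in>multi_indices n. d \<alpha> * monom_fun \<alpha> x)"
    using assms by (auto simp: polys_upto_alt)
  then have "a * f x + b * g x = (\<Sum>\<alpha>\<in>multi_indices n. (a * c \<alpha> + b * d \<alpha>) * monom_fun \<alpha> x)" for x
    by (simp add: sum_distrib_left sum.distrib algebra_simps)
  then show ?thesis
    unfolding polys_upto_alt by (intro exI[of _ "\<lambda>\<alpha>. a * c \<alpha> + b * d \<alpha>"]) simp
qed

lemma polys_upto_add:
  "f \<in> polys_upto n \<Longrightarrow> g \<in> polys_upto n \<Longrightarrow> (\<lambda>x. f x + g x) \<in> polys_upto n"
  using polys_upto_lincomb[of f n g 1 1] by simp

lemma polys_upto_cmul: "f \<in> polys_upto n \<Longrightarrow> (\<lambda>x. c * f x) \<in> polys_upto n"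
  using polys_upto_lincomb[of f n f c 0] by simp

lemma polys_upto_zero: "(\<lambda>x. 0) \<in> polys_upto n"
  unfolding polys_upto_alt by (intro exI[of _ "\<lambda>\<alpha>. 0"]) simp

lemma polys_upto_sum:
  "(\<And>i. i \<in> I \<Longrightarrow> f i \<in> polys_upto n) \<Longrightarrow> (\<lambda>x. \<Sum>i\<in>I. c i * f i x) \<in> polys_upto n"
  by (induction I rule: infinite_finite_induct)
     (simp_all add: polys_upto_zero polys_upto_add polys_upto_cmul)

lemma monom_fun_polys_upto:
  assumes "(\<Sum>i\<in>Basis. \<alpha> i) \<le> n"
  shows "monom_fun \<alpha> \<in> polys_upto n"
proof -
  \<comment> \<open>The index set consists of extensional functions, so \<alpha> must be cut down to
    \<open>Basis\<close> before it can serve as an index.\<close>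
  let ?\<beta> = "restrict \<alpha> Basis"
  have "\<alpha> i \<le> n" if "i \<in> Basis" for i
    using member_le_sum[OF that, of \<alpha>] assms by simp
  then have mem: "?\<beta> \<in> multi_indices n"
    using assms by (auto simp: multi_indices_def)
  have *: "monom_fun \<alpha> x = (\<Sum>\<gamma>\<in>multi_indices n. (if \<gamma> = ?\<beta> then 1 else 0) * monom_fun \<gamma> x)" for x
  proof -
    have "(\<Sum>\<gamma>\<in>multi_indices n. (if \<gamma> = ?\<beta> then 1 else 0) * monom_fun \<gamma> x)
        = (\<Sum>\<gamma>\<in>multi_indices n. if \<gamma> = ?\<beta> then monom_fun \<gamma> x else 0)"
      by (intro sum.cong) auto
    also have "\<dots> = monom_fun ?\<beta> x"
      using mem by (simp add: sum.delta[OF finite_multi_indices])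
    finally show ?thesis by (simp add: monom_fun_def)
  qed
  show ?thesis unfolding polys_upto_alt by (rule exI, rule allI) (rule *)
qed

text \<open>Linear statements are reduced to monomials. The membership premises of
  \<open>lincomb\<close> stay available because linearity of the inner products is only known for
  polynomials.\<close>

lemma polys_upto_induct [consumes 1, case_names monom lincomb]:
  assumes f: "f \<in> polys_upto n"
    and mono: "\<And>\<alpha>. (\<Sum>i\<in>Basis. \<alpha> i) \<le> n \<Longrightarrow> P (monom_fun \<alpha>)"
    and lincomb: "\<And>f g a b. f \<in> polys_upto n \<Longrightarrow> g \<in> polys_upto n \<Longrightarrow> P f \<Longrightarrow> P g \<Longrightarrow>
      P (\<lambda>x. a * f x + b * g x)"
  shows "P f"
proof -
  obtain c where c: "\<And>x. f x = (\<Sum>\<alpha>\<in>multi_indices n. c \<alpha> * monom_fun \<alpha> x)"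
    using f by (auto simp: polys_upto_alt)
  \<comment> \<open>The zero function arises as a combination of constant monomials with
    coefficients 0, which spares a separate premise for it.\<close>
  have "P (\<lambda>x. 0 * monom_fun (\<lambda>_. 0) x + 0 * monom_fun (\<lambda>_. 0) x)"
    by (intro lincomb mono monom_fun_polys_upto) auto
  then have zero: "P (\<lambda>x. 0)" by simp
  have "finite A \<Longrightarrow> A \<subseteq> multi_indices n \<Longrightarrow> P (\<lambda>x. \<Sum>\<alpha>\<in>A. c \<alpha> * monom_fun \<alpha> x)" for A
  proof (induction A rule: finite_induct)
    case (insert \<alpha> A)
    then have "P (\<lambda>x. c \<alpha> * monom_fun \<alpha> x + 1 * (\<Sum>\<alpha>\<in>A. c \<alpha> * monom_fun \<alpha> x))"
      by (intro lincomb mono polys_upto_sum monom_fun_polys_upto)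
         (auto simp: multi_indices_def)
    then show ?case using insert by simp
  qed (simp add: zero)
  from this[OF finite_multi_indices order_refl] show ?thesis
    by (simp add: c[abs_def])
qed

lemma polys_upto_mono:
  assumes "f \<in> polys_upto m" "m \<le> n" shows "f \<in> polys_upto n"
  using assms(1)
  by (induction rule: polys_upto_induct)
     (use assms(2) in \<open>auto intro: monom_fun_polys_upto polys_upto_lincomb\<close>)

lemma polys_upto_mult:
  assumes "f \<in> polys_upto m" "g \<in> polys_upto n"
  shows "(\<lambda>x. f x * g x) \<in> polys_upto (m + n)"
  using assms(1)
proof (induction rule: polys_upto_induct)
  case (monom \<alpha>)
  show ?case using assms(2)
  proof (induction rule: polys_upto_induct)
    case (monom \<beta>)
    have "(\<lambda>x. monom_fun \<alpha> x * monom_fun \<beta> x) = monom_fun (\<lambda>i. \<alpha> i + \<beta> i)"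
      by (simp add: fun_eq_iff monom_fun_def power_add prod.distrib)
    then show ?case
      using monom \<open>sum \<alpha> Basis \<le> m\<close> by (simp add: monom_fun_polys_upto sum.distrib)
  next
    case (lincomb f g a b)
    then show ?case using polys_upto_lincomb[OF lincomb(3,4), of a b] by (simp add: algebra_simps)
  qed
next
  case (lincomb f g a b)
  then show ?case using polys_upto_lincomb[OF lincomb(3,4), of a b] by (simp add: algebra_simps)
qed

lemma polys_upto_const: "(\<lambda>x. c) \<in> polys_upto n"
  using polys_upto_cmul[OF monom_fun_polys_upto[of "\<lambda>_. 0" n], of c] by (simp add: monom_fun_def)

lemma polys_upto_inner: "(\<lambda>x. x \<bullet> v) \<in> polys_upto (Suc 0)"
proof -
  have "monom_fun (\<lambda>i. if i = b then 1 else 0) = (\<lambda>x. x \<bullet> b)" if "b \<in> Basis" for b :: 'a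
    using that by (simp add: fun_eq_iff monom_fun_def if_distrib[of "power _"] prod.If_cases
        cong: if_cong)
  moreover have "monom_fun (\<lambda>i. if i = b then 1 else 0) \<in> polys_upto (Suc 0)" for b :: 'a
    by (intro monom_fun_polys_upto) (simp add: sum.If_cases)
  ultimately have "(\<lambda>x. x \<bullet> b) \<in> polys_upto (Suc 0)" if "b \<in> Basis" for b :: 'a
    using that by metis
  then have "(\<lambda>x. \<Sum>b\<in>Basis. (v \<bullet> b) * (x \<bullet> b)) \<in> polys_upto (Suc 0)"
    by (intro polys_upto_sum) auto
  then show ?thesis by (simp add: euclidean_inner[of _ v] mult.commute)
qed

lemma polys_upto_power: "f \<in> polys_upto m \<Longrightarrow> (\<lambda>x. f x ^ k) \<in> polys_upto (k * m)"
  by (induction k) (simp_all add: polys_upto_const polys_upto_mult)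

lemma polys_upto_snd: "(snd :: 'a::euclidean_space \<times> real \<Rightarrow> real) \<in> polys_upto (Suc 0)"
  using polys_upto_inner[of "(0::'a, 1::real)"] by (simp add: inner_prod_def)

lemma polys_upto_fst_inner:
  "(\<lambda>p::'a::euclidean_space \<times> real. v \<bullet> fst p) \<in> polys_upto (Suc 0)"
  using polys_upto_inner[of "(v, 0::real)"] by (simp add: inner_prod_def inner_commute)

lemma polys_upto_fst: "(fst :: real \<times> real \<Rightarrow> real) \<in> polys_upto (Suc 0)"
  using polys_upto_fst_inner[of "1::real"] by simp

lemma monom_fun_prod:
  fixes \<alpha> :: "'a::euclidean_space \<times> real \<Rightarrow> nat"
  shows "monom_fun \<alpha> (y, s) = monom_fun (\<lambda>i. \<alpha> (i, 0)) y * s ^ \<alpha> (0, 1)"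
    and "(\<Sum>i\<in>Basis. \<alpha> i) = (\<Sum>i\<in>Basis. \<alpha> (i, 0)) + \<alpha> (0, 1)"
proof -
  have B: "(Basis :: ('a \<times> real) set) = (\<lambda>i. (i, 0)) ` Basis \<union> {(0, 1)}"
    by (auto simp: Basis_prod_def)
  have dis: "(\<lambda>i::'a. (i, 0::real)) ` Basis \<inter> {(0, 1)} = {}" by auto
  have inj: "inj_on (\<lambda>i::'a. (i, 0::real)) Basis" by (auto intro: inj_onI)
  show "monom_fun \<alpha> (y, s) = monom_fun (\<lambda>i. \<alpha> (i, 0)) y * s ^ \<alpha> (0, 1)"
    unfolding monom_fun_def B by (subst prod.union_disjoint) (use dis inj in \<open>auto simp: prod.reindex\<close>)
  show "(\<Sum>i\<in>Basis. \<alpha> i) = (\<Sum>i\<in>Basis. \<alpha> (i, 0)) + \<alpha> (0, 1)"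
    unfolding B by (subst sum.union_disjoint) (use dis inj in \<open>auto simp: sum.reindex\<close>)
qed

lemma cont_polys_upto: "f \<in> polys_upto n \<Longrightarrow> continuous_on S f"
  by (induction rule: polys_upto_induct) (auto simp: monom_fun_def[abs_def] intro!: continuous_intros)

lemma measurable_polys_upto: "f \<in> polys_upto n \<Longrightarrow> f \<in> borel_measurable borel"
  by (intro borel_measurable_continuous_onI cont_polys_upto)

lemma polys_upto_line:
  assumes "f \<in> polys_upto n"
  shows "\<exists>P. \<forall>t::real. f (a + t *\<^sub>R b) = poly P t"
  using assms
proof (induction rule: polys_upto_induct)
  case (monom \<alpha>)
  show ?case
    by (intro exI[of _ "\<Prod>i\<in>Basis. [:a \<bullet> i, b \<bullet> i:] ^ \<alpha> i"])
       (simp add: monom_fun_def poly_prod algebra_simps)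
next
  case (lincomb f g a b)
  then show ?case by (metis poly_add poly_smult)
qed

text \<open>On the line from an interior point of S towards x the polynomial becomes one in a single
  variable that vanishes on an interval, hence identically; x is the point with parameter 1.\<close>

lemma polys_upto_eq_zero:
  assumes f: "f \<in> polys_upto n" and S: "open S" "S \<noteq> {}" "\<And>x. x \<in> S \<Longrightarrow> f x = 0"
  shows "f x = 0"
proof -
  obtain a e where a: "0 < e" "ball a e \<subseteq> S"
    using S(1,2) by (metis ex_in_conv open_contains_ball)
  obtain P where P: "\<And>t. f (a + t *\<^sub>R (x - a)) = poly P t"
    using polys_upto_line[OF f] by blast
  define \<delta> where "\<delta> = e / (norm (x - a) + 1)"
  have \<delta>: "\<delta> > 0" "\<delta> * norm (x - a) < e"
    using a add_nonneg_pos[of "norm (x - a)" 1] by (auto simp: \<delta>_def pos_divide_less_eq)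
  have "poly P t = 0" if "t \<in> {0<..<\<delta>}" for t
  proof -
    have "norm (t *\<^sub>R (x - a)) \<le> \<delta> * norm (x - a)"
      using that by (auto intro!: mult_right_mono)
    with \<delta> have "a + t *\<^sub>R (x - a) \<in> ball a e" by (simp add: dist_norm)
    then show ?thesis using a S(3) P by (metis subsetD)
  qed
  then have "{0<..<\<delta>} \<subseteq> {t. poly P t = 0}" by auto
  then have "infinite {t. poly P t = 0}"
    using \<delta>(1) infinite_Ioo finite_subset by blast
  then have "P = 0" using poly_roots_finite by blast
  then show ?thesis using P[of 1] by simp
qed


section \<open>Orthonormal bases and reproducing kernels\<close>

text \<open>For \<open>X = UNIV\<close> this is the identity, so one locale handles both the
  restrictions to the paraboloid and the genuine polynomials on the plane.\<close>

definition restr :: "'a set \<Rightarrow> ('a \<Rightarrow> real) \<Rightarrow> 'a \<Rightarrow> real" where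
  "restr X f p = (if p \<in> X then f p else 0)"

definition orthonormal_in :: "(('a \<Rightarrow> real) \<Rightarrow> ('a \<Rightarrow> real) \<Rightarrow> real) \<Rightarrow> ('a \<Rightarrow> real) set \<Rightarrow> bool" where
  "orthonormal_in ip B \<longleftrightarrow> (\<forall>P\<in>B. \<forall>Q\<in>B. ip P Q = (if P = Q then 1 else 0))"

definition spanned :: "'a set \<Rightarrow> ('a \<Rightarrow> real) set \<Rightarrow> ('a \<Rightarrow> real) \<Rightarrow> bool" where
  "spanned X C f \<longleftrightarrow> (\<exists>c. \<forall>x\<in>X. f x = (\<Sum>Q\<in>C. c Q * Q x))"

lemma spannedI: "(\<And>x. x \<in> X \<Longrightarrow> f x = (\<Sum>Q\<in>C. c Q * Q x)) \<Longrightarrow> spanned X C f"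
  unfolding spanned_def by (rule exI, rule ballI)

lemma spannedE:
  assumes "spanned X C f"
  obtains c where "\<And>x. x \<in> X \<Longrightarrow> f x = (\<Sum>Q\<in>C. c Q * Q x)"
  using assms unfolding spanned_def by (elim exE) (auto intro: that)

text \<open>On the paraboloid the inner product is degenerate: \<open>(norm x)\<^sup>2 - t\<close>
  has norm 0. Definiteness therefore means vanishing on X, and \<open>ip_cong\<close> lets
  \<open>ip\<close> depend on values on X only. Linearity is confined to polynomials, for which the
  integrals exist.\<close>

locale poly_inner =
  fixes X :: "'a::euclidean_space set" and ip :: "('a \<Rightarrow> real) \<Rightarrow> ('a \<Rightarrow> real) \<Rightarrow> real"
  assumes ip_commute: "ip f g = ip g f"
    and ip_lincomb: "\<lbrakk>f \<in> polys_upto n; g \<in> polys_upto n; h \<in> polys_upto n\<rbrakk>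
        \<Longrightarrow> ip (\<lambda>x. a * f x + b * g x) h = a * ip f h + b * ip g h"
    and ip_nonneg: "f \<in> polys_upto n \<Longrightarrow> ip f f \<ge> 0"
    and ip_definite: "\<lbrakk>f \<in> polys_upto n; ip f f = 0; x \<in> X\<rbrakk> \<Longrightarrow> f x = 0"
    and ip_cong: "(\<And>x. x \<in> X \<Longrightarrow> f x = f' x) \<Longrightarrow> ip f g = ip f' g"
begin

lemma ip_cong2: "(\<And>x. x \<in> X \<Longrightarrow> g x = g' x) \<Longrightarrow> ip f g = ip f g'"
  using ip_cong ip_commute by metis

lemma ip_restr [simp]: "ip (restr X f) g = ip f g" "ip f (restr X g) = ip f g"
  by (auto intro: ip_cong ip_cong2 simp: restr_def)

lemma ip_cmul:
  assumes "f \<in> polys_upto n" "h \<in> polys_upto n" shows "ip (\<lambda>x. a * f x) h = a * ip f h"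
  using ip_lincomb[OF assms(1,1,2), of a 0] by simp

lemma ip_sum:
  assumes "finite I" "\<And>i. i \<in> I \<Longrightarrow> f i \<in> polys_upto n" "h \<in> polys_upto n"
  shows "ip (\<lambda>x. \<Sum>i\<in>I. c i * f i x) h = (\<Sum>i\<in>I. c i * ip (f i) h)"
  using assms(1,2)
proof (induction I rule: finite_induct)
  case empty
  show ?case using ip_cmul[OF polys_upto_zero assms(3), of 0] by simp
next
  case (insert i I)
  then have "ip (\<lambda>x. c i * f i x + 1 * (\<Sum>i\<in>I. c i * f i x)) h
      = c i * ip (f i) h + 1 * ip (\<lambda>x. \<Sum>i\<in>I. c i * f i x) h"
    by (intro ip_lincomb[where n = n] polys_upto_sum assms(3)) auto
  then show ?case using insert by simp
qed

lemma ip_expand: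
  assumes "finite C" "C \<subseteq> polys_upto n" "h \<in> polys_upto n"
    and "\<And>x. x \<in> X \<Longrightarrow> f x = (\<Sum>Q\<in>C. c Q * Q x)"
  shows "ip f h = (\<Sum>Q\<in>C. c Q * ip Q h)"
  using ip_sum[of C "\<lambda>Q. Q" n h c] assms ip_cong[of f "\<lambda>x. \<Sum>Q\<in>C. c Q * Q x" h] by auto

lemma coeff_orthonormal:
  assumes "finite C" "C \<subseteq> polys_upto n" "orthonormal_in ip C" "Q \<in> C"
    and "\<And>x. x \<in> X \<Longrightarrow> f x = (\<Sum>Q\<in>C. c Q * Q x)"
  shows "ip f Q = c Q"
proof -
  have "ip f Q = (\<Sum>P\<in>C. c P * ip P Q)"
    using assms by (intro ip_expand) auto
  also have "\<dots> = (\<Sum>P\<in>C. if P = Q then c P else 0)"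
    using assms(3,4) by (intro sum.cong) (auto simp: orthonormal_in_def)
  finally show ?thesis using assms(1,4) by simp
qed

text \<open>The given orthonormal set B is kept, so that a basis for lower degree can be extended to
  the next degree.\<close>

lemma gram_schmidt:
  assumes F: "finite F" "F \<subseteq> polys_upto n"
    and B: "finite B" "B \<subseteq> polys_upto n" "orthonormal_in ip B"
  shows "\<exists>C. finite C \<and> B \<subseteq> C \<and> C \<subseteq> polys_upto n \<and> orthonormal_in ip C \<and>
           (\<forall>f\<in>F. spanned X C f)"
  using F
proof (induction F rule: finite_induct)
  case empty
  then show ?case using B by blast
next
  case (insert f F)
  then obtain C where C: "finite C" "B \<subseteq> C" "C \<subseteq> polys_upto n" "orthonormal_in ip C"
    and span: "\<And>f. f \<in> F \<Longrightarrow> spanned X C f"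
    by auto
  have f: "f \<in> polys_upto n" using insert by auto
  define h where "h = (\<lambda>x. 1 * f x + (-1) * (\<Sum>Q\<in>C. ip f Q * Q x))"
  have h: "h \<in> polys_upto n"
    unfolding h_def using C f by (intro polys_upto_lincomb polys_upto_sum) auto
  have orth: "ip h Q = 0" if "Q \<in> C" for Q
  proof -
    have "ip h Q = 1 * ip f Q + (-1) * ip (\<lambda>x. \<Sum>Q\<in>C. ip f Q * Q x) Q"
      unfolding h_def using C f that by (intro ip_lincomb polys_upto_sum) auto
    also have "ip (\<lambda>x. \<Sum>Q\<in>C. ip f Q * Q x) Q = ip f Q"
      using C that by (intro coeff_orthonormal[where n = n and C = C]) auto
    finally show ?thesis by simp
  qed
  show ?case
  \<comment> \<open>A residual of norm 0 vanishes on X by definiteness, so f is already spanned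
    there; in this way linear independence never has to be arranged.\<close>
  proof (cases "ip h h = 0")
    case True
    then have "spanned X C f"
      using ip_definite[OF h] by (intro spannedI[where c = "ip f"]) (auto simp: h_def)
    then show ?thesis using C span by (intro exI[of _ C]) auto
  next
    case False
    define r where "r = sqrt (ip h h)"
    define Q0 where "Q0 = (\<lambda>x. (1 / r) * h x)"
    have r: "r > 0" "r * r = ip h h" using False ip_nonneg[OF h] by (auto simp: r_def)
    have Q0: "Q0 \<in> polys_upto n" unfolding Q0_def by (intro polys_upto_cmul h)
    have ip0: "ip Q0 g = ip h g / r" if "g \<in> polys_upto n" for g
      unfolding Q0_def using ip_cmul[OF h that, of "1 / r"] by simp
    have norm1: "ip Q0 Q0 = 1"
    proof -
      have "ip Q0 Q0 = (ip h h / r) / r"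
        using ip0[OF Q0] ip0[OF h] ip_commute[of h Q0] by simp
      also have "\<dots> = 1" using r by (metis divide_divide_eq_left div_self less_numeral_extra(3) mult_eq_0_iff)
      finally show ?thesis .
    qed
    have orth0: "ip Q0 Q = 0" "ip Q Q0 = 0" if "Q \<in> C" for Q
      using ip0[of Q] orth[OF that] C(3) that ip_commute[of Q Q0] by auto
    have "Q0 \<notin> C" using norm1 orth0 by force
    have on: "orthonormal_in ip (insert Q0 C)"
      using C(4) orth0 norm1 \<open>Q0 \<notin> C\<close> by (auto simp: orthonormal_in_def)
    have "spanned X (insert Q0 C) g" if "g \<in> insert f F" for g
    proof (cases "g = f")
      case True
      have *: "f x = (\<Sum>Q\<in>insert Q0 C. (if Q = Q0 then r else ip f Q) * Q x)" for x
      proof -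
        have "(\<Sum>Q\<in>C. (if Q = Q0 then r else ip f Q) * Q x) = (\<Sum>Q\<in>C. ip f Q * Q x)"
          using \<open>Q0 \<notin> C\<close> by (intro sum.cong) auto
        then show ?thesis using C(1) \<open>Q0 \<notin> C\<close> r(1) by (simp add: Q0_def h_def)
      qed
      show ?thesis unfolding True by (rule spannedI) (rule *)
    next
      case False
      then have "spanned X C g" using span that by blast
      then obtain c where c: "\<And>x. x \<in> X \<Longrightarrow> g x = (\<Sum>Q\<in>C. c Q * Q x)"
        by (rule spannedE) blast
      have "(\<Sum>Q\<in>C. (if Q = Q0 then 0 else c Q) * Q x) = (\<Sum>Q\<in>C. c Q * Q x)" for x
        using \<open>Q0 \<notin> C\<close> by (intro sum.cong) auto
      then show ?thesis using C(1) \<open>Q0 \<notin> C\<close> c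
        by (intro spannedI[where c = "\<lambda>Q. if Q = Q0 then 0 else c Q"]) simp
    qed
    then show ?thesis using C on Q0 by (intro exI[of _ "insert Q0 C"]) auto
  qed
qed

lemma orthonormal_spanning_extend:
  assumes B: "finite B" "B \<subseteq> polys_upto n" "orthonormal_in ip B"
  shows "\<exists>C. finite C \<and> B \<subseteq> C \<and> C \<subseteq> polys_upto n \<and> orthonormal_in ip C \<and>
           (\<forall>f\<in>polys_upto n. spanned X C f)"
proof -
  have "monom_fun ` multi_indices n \<subseteq> polys_upto n"
    by (auto simp: multi_indices_def intro: monom_fun_polys_upto)
  from gram_schmidt[OF finite_imageI[OF finite_multi_indices] this B]
  obtain C where C: "finite C" "B \<subseteq> C" "C \<subseteq> polys_upto n" "orthonormal_in ip C"
    and span: "\<forall>f\<in>monom_fun ` multi_indices n. spanned X C f"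
    by blast
  from span obtain d where d: "\<And>\<alpha> x. \<alpha> \<in> multi_indices n \<Longrightarrow> x \<in> X \<Longrightarrow>
      monom_fun \<alpha> x = (\<Sum>Q\<in>C. d \<alpha> Q * Q x)"
    unfolding ball_simps spanned_def by metis
  have "spanned X C f" if f: "f \<in> polys_upto n" for f
  proof -
    obtain c where "\<And>x. f x = (\<Sum>\<alpha>\<in>multi_indices n. c \<alpha> * monom_fun \<alpha> x)"
      using f by (auto simp: polys_upto_alt)
    then have *: "f x = (\<Sum>Q\<in>C. (\<Sum>\<alpha>\<in>multi_indices n. c \<alpha> * d \<alpha> Q) * Q x)" if "x \<in> X" for x
      using d[OF _ that] by (simp add: sum_distrib_left sum_distrib_right mult.assoc)
        (rule sum.swap)
    show ?thesis by (rule spannedI) (rule *)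
  qed
  then show ?thesis using C by blast
qed

text \<open>Gives meaning to the \<open>SOME\<close> in \<open>reproducing_kernel\<close>. An
  orthonormal basis B of the polynomials of degree below n is extended to a basis C in degree n, and
  \<open>C - B\<close> restricts to the required basis.\<close>

lemma ex_orthonormal_basis:
  "\<exists>B. orthonormal_basis ip (restr X ` ortho_polys ip n) B"
proof -
  \<comment> \<open>For n = 0 there is no lower degree, so B has to be empty.\<close>
  have "\<exists>B. finite B \<and> (\<forall>m. n = Suc m \<longrightarrow> B \<subseteq> polys_upto m) \<and> (n = 0 \<longrightarrow> B = {}) \<and> orthonormal_in ip B \<and>
      (\<forall>m<n. \<forall>f\<in>polys_upto m. spanned X B f)"
  proof (cases n)
    case 0
    then show ?thesis by (intro exI[of _ "{}"]) (auto simp: orthonormal_in_def)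
  next
    case (Suc m)
    from orthonormal_spanning_extend[of "{}" m]
    obtain B where B: "finite B" "B \<subseteq> polys_upto m" "orthonormal_in ip B"
      "\<forall>f\<in>polys_upto m. spanned X B f"
      by (auto simp: orthonormal_in_def)
    have "spanned X B f" if "k < n" "f \<in> polys_upto k" for k f
      using B(4) polys_upto_mono[OF that(2), of m] that(1) Suc by simp
    then show ?thesis using Suc B by (intro exI[of _ B]) simp
  qed
  then obtain B where B: "finite B" "\<And>m. n = Suc m \<Longrightarrow> B \<subseteq> polys_upto m" "n = 0 \<Longrightarrow> B = {}"
    "orthonormal_in ip B"
    and spanB: "\<And>m f. m < n \<Longrightarrow> f \<in> polys_upto m \<Longrightarrow> spanned X B f"
    by blast
  have Bn: "B \<subseteq> polys_upto n" using B(2,3) polys_upto_mono[of _ "n - 1" n] by (cases n) auto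
  obtain C where C: "finite C" "B \<subseteq> C" "C \<subseteq> polys_upto n" "orthonormal_in ip C"
    and span: "\<And>f. f \<in> polys_upto n \<Longrightarrow> spanned X C f"
    using orthonormal_spanning_extend[OF B(1) Bn B(4)] by blast
  define D where "D = C - B"
  have D: "Q \<in> ortho_polys ip n" if "Q \<in> D" for Q
  proof -
    have "ip Q g = 0" if m: "m < n" "g \<in> polys_upto m" for m g
    proof -
      obtain c where c: "\<And>x. x \<in> X \<Longrightarrow> g x = (\<Sum>Q\<in>B. c Q * Q x)"
        using spanB[OF m] by (rule spannedE) blast
      have "ip g Q = (\<Sum>P\<in>B. c P * ip P Q)"
        using c C \<open>Q \<in> D\<close> by (intro ip_expand[where n = n] B(1) Bn) (auto simp: D_def)
      also have "\<dots> = 0"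
      proof (intro sum.neutral ballI)
        fix P assume "P \<in> B"
        then have "P \<in> C" "Q \<in> C" "P \<noteq> Q" using C(2) \<open>Q \<in> D\<close> by (auto simp: D_def)
        then have "ip P Q = 0" using C(4) by (simp add: orthonormal_in_def)
        then show "c P * ip P Q = 0" by simp
      qed
      finally show ?thesis by (simp add: ip_commute)
    qed
    then show ?thesis using that C by (auto simp: ortho_polys_def D_def)
  qed
  have ipC: "ip P Q = (if P = Q then 1 else 0)" if "P \<in> D" "Q \<in> D" for P Q
    using C(4) that by (simp add: D_def orthonormal_in_def)
  \<comment> \<open>Orthonormality must survive restriction: two different members of D with equal
    restrictions would have inner product 1 instead of 0.\<close>
  have onD: "ip P Q = (if restr X P = restr X Q then 1 else 0)" if "P \<in> D" "Q \<in> D" for P Q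
  proof (cases "P = Q")
    case False
    have "restr X P \<noteq> restr X Q"
    proof
      assume "restr X P = restr X Q"
      then have "ip P Q = ip Q Q" using ip_restr(1) by metis
      then show False using ipC[OF that] ipC[OF that(2,2)] False by simp
    qed
    then show ?thesis using ipC[OF that] False by simp
  qed (use ipC[OF that] in simp)
  then have inj: "inj_on (restr X) D"
    using C(4) by (intro inj_onI) (metis D_def DiffD1 orthonormal_in_def zero_neq_one)
  have "\<exists>c. \<forall>p. restr X f p = (\<Sum>Q\<in>restr X ` D. c Q * Q p)" if f: "f \<in> ortho_polys ip n" for f
  proof -
    obtain c where c: "\<And>x. x \<in> X \<Longrightarrow> f x = (\<Sum>Q\<in>C. c Q * Q x)"
      using span[of f] f by (auto simp: ortho_polys_def elim: spannedE)
    \<comment> \<open>Orthogonality to lower degrees kills the coefficients along B.\<close>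
    have "c Q = 0" if "Q \<in> B" for Q
    proof -
      obtain m where m: "n = Suc m" using B(3) \<open>Q \<in> B\<close> by (cases n) auto
      then have "ip f Q = 0" using f B(2) \<open>Q \<in> B\<close> by (auto simp: ortho_polys_def)
      then show ?thesis using coeff_orthonormal[OF C(1,3,4) _ c, of Q] C(2) that by auto
    qed
    then have "(\<Sum>Q\<in>C. c Q * Q x) = (\<Sum>Q\<in>D. c Q * Q x)" for x
      using C(1) by (intro sum.mono_neutral_right) (auto simp: D_def)
    then have "restr X f p = (\<Sum>Q\<in>D. c (the_inv_into D (restr X) (restr X Q)) * restr X Q p)" for p
      using c inj by (auto simp: restr_def the_inv_into_f_f)
    then show ?thesis
      by (intro exI[of _ "\<lambda>Q. c (the_inv_into D (restr X) Q)"]) (simp add: sum.reindex[OF inj])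
  qed
  then have "orthonormal_basis ip (restr X ` ortho_polys ip n) (restr X ` D)"
    unfolding orthonormal_basis_def using C(1) D onD by (auto simp: D_def)
  then show ?thesis by blast
qed

end

text \<open>
  If \<open>T\<close> and \<open>r\<close> are adjoint and both preserve the degree, then \<open>r\<close> carries the reproducing
  property of the second kernel at \<open>q0\<close> over to the image of that kernel under \<open>T\<close> at \<open>p0\<close>.
\<close>

theorem reproducing_kernel_adjoint:
  fixes T :: "('b::euclidean_space \<Rightarrow> real) \<Rightarrow> 'a::euclidean_space \<Rightarrow> real"
  assumes 1: "poly_inner X ip1" and 2: "poly_inner UNIV ip2"
    and T: "\<And>n f. f \<in> polys_upto n \<Longrightarrow> \<exists>F\<in>polys_upto n. \<forall>p\<in>X. F p = T f p"
    and adj: "\<And>m g. g \<in> polys_upto m \<Longrightarrow>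
        \<exists>r\<in>polys_upto m. (\<forall>n f. f \<in> polys_upto n \<longrightarrow> ip1 g (T f) = ip2 r f) \<and> r q0 = g p0"
    and p0: "p0 \<in> X" and p: "p \<in> X"
  shows "reproducing_kernel ip1 (restr X ` ortho_polys ip1 n) p0 p
       = T (reproducing_kernel ip2 (ortho_polys ip2 n) q0) p"
proof -
  interpret P1: poly_inner X ip1 by fact
  interpret P2: poly_inner UNIV ip2 by fact
  let ?V = "restr X ` ortho_polys ip1 n" and ?W = "ortho_polys ip2 n"
  define B where "B = (SOME B. orthonormal_basis ip1 ?V B)"
  define C where "C = (SOME B. orthonormal_basis ip2 ?W B)"
  have B: "orthonormal_basis ip1 ?V B"
    unfolding B_def by (rule someI_ex[OF P1.ex_orthonormal_basis])
  have restrU: "restr UNIV = (\<lambda>f::'b \<Rightarrow> real. f)" by (simp add: fun_eq_iff restr_def)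
  have C: "orthonormal_basis ip2 ?W C"
    unfolding C_def using someI_ex[OF P2.ex_orthonormal_basis[of n]] by (simp add: restrU)
  \<comment> \<open>The second kernel frozen at \<open>q0\<close>: a polynomial orthogonal to lower
    degrees that reproduces the value at \<open>q0\<close> of every member of
    \<open>?W\<close>.\<close>
  define K where "K = (\<lambda>q. \<Sum>Q\<in>C. Q q0 * Q q)"
  have CW: "finite C" "C \<subseteq> polys_upto n"
    using C by (auto simp: orthonormal_basis_def ortho_polys_def)
  have K: "K \<in> polys_upto n" unfolding K_def using CW by (intro polys_upto_sum) auto
  have K_orth: "ip2 f K = 0" if "m < n" "f \<in> polys_upto m" for m f
  proof -
    have f: "f \<in> polys_upto n" using that polys_upto_mono by (metis less_imp_le)
    have "ip2 K f = (\<Sum>Q\<in>C. Q q0 * ip2 Q f)"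
      unfolding K_def using CW f by (intro P2.ip_sum) auto
    also have "\<dots> = 0"
      using C that by (intro sum.neutral) (auto simp: orthonormal_basis_def ortho_polys_def)
    finally show ?thesis using P2.ip_commute by metis
  qed
  have K_repr: "ip2 r K = r q0" if r: "r \<in> ?W" for r
  proof -
    obtain c where c: "\<And>q. r q = (\<Sum>Q\<in>C. c Q * Q q)" using r C unfolding orthonormal_basis_def by blast
    have rn: "r \<in> polys_upto n" using r by (simp add: ortho_polys_def)
    have on: "orthonormal_in ip2 C" using C by (simp add: orthonormal_basis_def orthonormal_in_def)
    have "ip2 K r = (\<Sum>Q\<in>C. Q q0 * ip2 Q r)"
      unfolding K_def using CW rn by (intro P2.ip_sum) auto
    also have "\<dots> = (\<Sum>Q\<in>C. Q q0 * c Q)"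
      using P2.coeff_orthonormal[OF CW on _ c] P2.ip_commute by (intro sum.cong) metis+
    finally show ?thesis using c by (simp add: P2.ip_commute[of r] mult.commute)
  qed
  obtain F where F: "F \<in> polys_upto n" "\<And>p. p \<in> X \<Longrightarrow> F p = T K p" using T[OF K] by blast
  have ipF: "ip1 g F = ip1 g (T K)" for g :: "'a \<Rightarrow> real" using F by (intro P1.ip_cong2) auto
  have "F \<in> ortho_polys ip1 n"
    unfolding ortho_polys_def
  proof (intro CollectI conjI F(1) allI impI ballI)
    fix m and g :: "'a \<Rightarrow> real" assume m: "m < n" "g \<in> polys_upto m"
    with adj obtain r where "r \<in> polys_upto m" "ip1 g (T K) = ip2 r K" using K by metis
    then show "ip1 F g = 0" using K_orth m ipF P1.ip_commute by metis
  qed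
  then obtain c where c: "\<And>p. restr X F p = (\<Sum>Q\<in>B. c Q * Q p)"
    using B unfolding orthonormal_basis_def by blast
  \<comment> \<open>The coefficient of \<open>T K\<close> along Q is
    \<open>ip1 Q (T K) = ip2 r K = r q0 = Q p0\<close>, which is the coefficient in the first
    kernel.\<close>
  have coeff: "c Q = Q p0" if Q: "Q \<in> B" for Q
  proof -
    \<comment> \<open>Members of B are restrictions; \<open>G\<close> picks polynomial
      representatives, since adjoints are supplied for polynomials only.\<close>
    obtain G where G: "\<And>Q. Q \<in> B \<Longrightarrow> Q = restr X (G Q) \<and> G Q \<in> ortho_polys ip1 n"
      using B unfolding orthonormal_basis_def by (metis (no_types, opaque_lifting) image_iff subsetD)
    have Gn: "G Q \<in> polys_upto n" if "Q \<in> B" for Q using G[OF that] by (simp add: ortho_polys_def)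
    have ipG: "ip1 (G P) (G Q) = ip1 P Q" if "P \<in> B" "Q \<in> B" for P Q
      using G that P1.ip_restr by metis
    have "ip1 F (G Q) = (\<Sum>P\<in>B. c P * ip1 (G P) (G Q))"
    proof -
      have "F x = (\<Sum>P\<in>B. c P * G P x)" if "x \<in> X" for x
      proof -
        have "F x = restr X F x" using that by (simp add: restr_def)
        also have "\<dots> = (\<Sum>P\<in>B. c P * P x)" by (rule c)
        also have "\<dots> = (\<Sum>P\<in>B. c P * G P x)"
        proof (rule sum.cong)
          fix P assume "P \<in> B"
          then have "P x = restr X (G P) x" using G by metis
          then show "c P * P x = c P * G P x" using that by (simp add: restr_def)
        qed simp
        finally show ?thesis .
      qed
      then have "ip1 F (G Q) = ip1 (\<lambda>x. \<Sum>P\<in>B. c P * G P x) (G Q)" by (intro P1.ip_cong)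
      also have "\<dots> = (\<Sum>P\<in>B. c P * ip1 (G P) (G Q))"
        using B Gn Q by (intro P1.ip_sum) (auto simp: orthonormal_basis_def)
      finally show ?thesis .
    qed
    also have "\<dots> = (\<Sum>P\<in>B. if P = Q then c P else 0)"
      using B Q ipG by (intro sum.cong) (auto simp: orthonormal_basis_def)
    finally have 1: "ip1 F (G Q) = c Q" using B Q by (simp add: orthonormal_basis_def)
    obtain r where r: "r \<in> polys_upto n" "\<And>n f. f \<in> polys_upto n \<Longrightarrow> ip1 (G Q) (T f) = ip2 r f"
      "r q0 = G Q p0"
      using adj[OF Gn[OF Q]] by blast
    \<comment> \<open>T does not raise the degree and Q is orthogonal to lower degrees, so r is too;
      only then does K reproduce r.\<close>
    have "r \<in> ?W"
      unfolding ortho_polys_def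
    proof (intro CollectI conjI r(1) allI impI ballI)
      fix m and f :: "'b \<Rightarrow> real" assume m: "m < n" "f \<in> polys_upto m"
      obtain H where H: "H \<in> polys_upto m" "\<And>p. p \<in> X \<Longrightarrow> H p = T f p" using T[OF m(2)] by blast
      have "ip2 r f = ip1 (G Q) (T f)" using r(2) m by simp
      also have "\<dots> = ip1 (G Q) H" using H by (intro P1.ip_cong2) auto
      also have "\<dots> = 0" using G[OF Q] H m by (auto simp: ortho_polys_def)
      finally show "ip2 r f = 0" .
    qed
    then have "r q0 = ip2 r K" by (rule K_repr[symmetric])
    also have "\<dots> = ip1 (G Q) (T K)" using r(2) K by simp
    also have "\<dots> = c Q" using 1 ipF P1.ip_commute by metis
    finally have "c Q = G Q p0" using r(3) by simp
    also have "\<dots> = Q p0" using G[OF Q] p0 by (metis restr_def)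
    finally show ?thesis .
  qed
  have "reproducing_kernel ip1 ?V p0 p = (\<Sum>Q\<in>B. c Q * Q p)"
    unfolding reproducing_kernel_def B_def[symmetric] using coeff by (intro sum.cong) auto
  also have "\<dots> = T K p" using c[of p] F p by (simp add: restr_def)
  also have "K = reproducing_kernel ip2 ?W q0"
    unfolding reproducing_kernel_def[abs_def] C_def[symmetric] K_def ..
  finally show ?thesis .
qed


section \<open>Gegenbauer polynomials and their moments\<close>

text \<open>
  \<open>hgeg l m u s\<close> is \<open>s\<^sup>m\<^sup>/\<^sup>2 C\<^sub>m(u / \<surd>s) / C\<^sub>m(1)\<close> with \<open>C\<^sub>m\<close> the Gegenbauer polynomial of parameter \<open>l\<close>; with this
  normalisation the recursion also covers the Chebyshev case \<open>l = 0\<close>. \<open>gmoment l m k\<close> is the mean of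
  \<open>hgeg l m v 1 * v\<^sup>k\<close> for the weight \<open>(1 - v\<^sup>2)\<^sup>l\<^sup>-\<^sup>1\<^sup>/\<^sup>2\<close>, and \<open>geg_trans \<mu> \<sigma> k v\<close> is the mean of
  \<open>((1 - z1) / 2 * v + (1 + z1) / 2 * z2)\<^sup>k\<close> over \<open>z1\<close>, \<open>z2\<close>, which degenerates to \<open>v\<^sup>k\<close> for \<open>\<sigma> = 0\<close>.
\<close>

definition gmoment :: "real \<Rightarrow> nat \<Rightarrow> nat \<Rightarrow> real" where
  "gmoment l m k = (if m \<le> k \<and> even (k - m)
     then fact k / (2 ^ k * fact ((k - m) div 2) * pochhammer (l + 1) (m + (k - m) div 2)) else 0)"

fun hgeg :: "real \<Rightarrow> nat \<Rightarrow> real \<Rightarrow> real \<Rightarrow> real" where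
  "hgeg l 0 u s = 1"
| "hgeg l (Suc 0) u s = u"
| "hgeg l (Suc (Suc m)) u s =
     (2 * (real m + 1 + l) * u * hgeg l (Suc m) u s - (real m + 1) * s * hgeg l m u s)
       / (real m + 1 + 2 * l)"

definition geg_trans :: "real \<Rightarrow> real \<Rightarrow> nat \<Rightarrow> real \<Rightarrow> real" where
  "geg_trans \<mu> \<sigma> k v = (\<Sum>l\<le>k. real (k choose l) * pochhammer (\<mu> + 1) l * pochhammer \<sigma> (k - l)
       / pochhammer (\<mu> + \<sigma> + 1) k * gmoment \<sigma> 0 (k - l) * v ^ l)"

text \<open>An abstract functional, so that the moment computations serve the spherical mean of
  functions of \<open>\<xi> \<bullet> x\<close> as well as the mean for a Gegenbauer weight.
  Continuity stands in for integrability, the measures being finite and carried by compact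
  sets.\<close>

definition linear_cont :: "((real \<Rightarrow> real) \<Rightarrow> real) \<Rightarrow> bool" where
  "linear_cont L \<longleftrightarrow> (\<forall>f g a b. continuous_on UNIV f \<longrightarrow> continuous_on UNIV g \<longrightarrow>
     L (\<lambda>v. a * f v + b * g v) = a * L f + b * L g)"

lemma linear_contD:
  "linear_cont L \<Longrightarrow> continuous_on UNIV f \<Longrightarrow> continuous_on UNIV g \<Longrightarrow>
    L (\<lambda>v. a * f v + b * g v) = a * L f + b * L g"
  unfolding linear_cont_def by blast

lemma gmoment_add: "gmoment l m (m + 2 * p) =
    fact (m + 2 * p) / (2 ^ (m + 2 * p) * fact p * pochhammer (l + 1) (m + p))"
  by (simp add: gmoment_def)

lemma gmoment_cases:
  fixes k m :: nat
  obtains p where "k = m + 2 * p" | "k < m" | p where "k = m + 2 * p + 1"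
proof (cases "k < m")
  case False
  then obtain j where j: "k = m + j" by (metis le_add_diff_inverse linorder_not_less)
  show ?thesis
  proof (cases "even j")
    case True
    then obtain p where "j = 2 * p" unfolding dvd_def by blast
    with j show ?thesis by (intro that(1)[of p]) simp
  next
    case False
    then obtain p where "j = 2 * p + 1" by (elim oddE)
    with j show ?thesis by (intro that(3)[of p]) simp
  qed
qed (use that(2) in blast)

lemma gmoment_eq_0: "k < m \<Longrightarrow> gmoment l m k = 0" "odd (k - m) \<Longrightarrow> gmoment l m k = 0"
  by (auto simp: gmoment_def)

text \<open>This is the recursion of \<open>hgeg\<close> integrated against \<open>v ^ k\<close>.
  When k and m have equal parity and m does not exceed k, clearing factorials and Pochhammer symbols
  leaves a polynomial identity.\<close>

lemma gmoment_rec: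
  assumes "l \<ge> 0"
  shows "(real m + 1 + 2 * l) * gmoment l (m + 2) k
       = 2 * (real m + 1 + l) * gmoment l (m + 1) (k + 1) - (real m + 1) * gmoment l m k"
proof (cases rule: gmoment_cases[of k m])
  case (1 p)
  have pos: "pochhammer (l + 1) j > 0" for j using assms by (intro pochhammer_pos) auto
  show ?thesis
  proof (cases p)
    \<comment> \<open>Here k = m: the left side vanishes since m + 2 > k, and the two terms on the
      right cancel.\<close>
    case 0
    define P c where "P = pochhammer (l + 1) m" and "c = real m + 1 + l"
    have "pochhammer (l + 1) (m + 1) = c * P"
      using pochhammer_rec'[of "l + 1" m] by (simp add: P_def c_def algebra_simps)
    then have "gmoment l (m + 1) (k + 1) = (real m + 1) * fact m / (2 * 2 ^ m * (c * P))"
      using gmoment_add[of l "m + 1" 0] 1 0 by simp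
    moreover have "gmoment l m k = fact m / (2 ^ m * P)"
      using gmoment_add[of l m 0] 1 0 by (simp add: P_def)
    moreover have "gmoment l (m + 2) k = 0" using 1 0 by (simp add: gmoment_eq_0)
    moreover have "c > 0" using assms by (simp add: c_def)
    moreover from this have "2 * c * (X / (2 * K * (c * P))) = X / (K * P)" for X K :: real by simp
    ultimately show ?thesis by (simp add: c_def[symmetric])
  next
    case (Suc q)
    define P where "P = pochhammer (l + 1) (m + q + 1)"
    define c where "c = l + 1 + (m + q + 1)"
    have P: "P > 0" "c > 0" using assms by (simp_all add: P_def c_def pos)
    have "gmoment l (m + 2) k = fact k / (2 ^ k * fact q * (c * P))"
      using gmoment_add[of l "m + 2" q] 1 Suc pochhammer_rec'[of "l + 1" "m + q + 1"]
      by (simp add: P_def c_def algebra_simps del: of_nat_Suc)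
    moreover have "gmoment l (m + 1) (k + 1) = (real k + 1) * fact k / (2 * 2 ^ k * ((real q + 1) * fact q) * (c * P))"
      using gmoment_add[of l "m + 1" "Suc q"] 1 Suc pochhammer_rec'[of "l + 1" "m + q + 1"]
      by (simp add: P_def c_def algebra_simps)
    moreover have "gmoment l m k = fact k / (2 ^ k * ((real q + 1) * fact q) * P)"
      using gmoment_add[of l m "Suc q"] 1 Suc by (simp add: P_def algebra_simps)
    \<comment> \<open>What remains after removing common factors, with
      \<open>k = m + 2 * q + 2\<close> and \<open>c = l + m + q + 2\<close>.\<close>
    moreover have "(real m + 1 + 2 * l) * (real q + 1)
        = (real m + 1 + l) * (real k + 1) - (real m + 1) * c"
      using 1 Suc by (simp add: c_def algebra_simps)
    moreover have "a0 * (F / (K * G * (c * P))) = 2 * a1 * (k1 * F / (2 * K * (q1 * G) * (c * P)))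
          - m1 * (F / (K * (q1 * G) * P))"
      if "q1 > 0" "a0 * q1 = a1 * k1 - m1 * c" for F K G a0 a1 k1 q1 m1 :: real
    proof -
      have "a0 * (F / (K * G * (c * P))) = (a0 * q1) * (F / (K * G * (c * P) * q1))"
        using that(1) by simp
      also have "\<dots> = a1 * k1 * (F / (K * G * (c * P) * q1)) - m1 * c * (F / (K * G * (c * P) * q1))"
        by (simp only: that(2) left_diff_distrib)
      also have "m1 * c * (F / (K * G * (c * P) * q1)) = m1 * (F / (K * (q1 * G) * P))"
        using P by simp
      also have "a1 * k1 * (F / (K * G * (c * P) * q1)) = 2 * a1 * (k1 * F / (2 * K * (q1 * G) * (c * P)))"
        by (simp add: mult_ac)
      finally show ?thesis .
    qed
    from this[of "real q + 1" "real m + 1 + 2 * l" "real m + 1 + l" "real k + 1" "real m + 1"]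
    have "(real m + 1 + 2 * l) * (real q + 1)
        = (real m + 1 + l) * (real k + 1) - (real m + 1) * c \<Longrightarrow>
      (real m + 1 + 2 * l) * (F / (K * G * (c * P)))
        = 2 * (real m + 1 + l) * ((real k + 1) * F / (2 * K * ((real q + 1) * G) * (c * P)))
          - (real m + 1) * (F / (K * ((real q + 1) * G) * P))" for F K G
      by simp
    ultimately show ?thesis by simp
  qed
next
  case 2
  then show ?thesis by (simp add: gmoment_eq_0)
next
  case (3 p)
  have "m + 2 \<le> k \<longrightarrow> odd (k - (m + 2))" using 3 by auto
  then have "gmoment l (m + 2) k = 0" by (cases "m + 2 \<le> k") (auto simp: gmoment_eq_0)
  moreover have "gmoment l (m + 1) (k + 1) = 0" "gmoment l m k = 0"
    by (rule gmoment_eq_0(2), use 3 in simp)+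
  ultimately show ?thesis by simp
qed

text \<open>The recursion determines all moments from the first two. Integration by parts yields it
  for Gegenbauer weights and the divergence theorem for the sphere, so one closed form serves
  both.\<close>

lemma moments_unique:
  fixes M :: "nat \<Rightarrow> real"
  assumes "l \<ge> 0" "M 0 = 1" "M 1 = 0" and rec: "\<And>k. (real k + 2 * l + 2) * M (k + 2) = (real k + 1) * M k"
  shows "M k = gmoment l 0 k"
proof -
  have pos: "pochhammer (l + 1) j > 0" for j using assms by (intro pochhammer_pos) auto
  have odd: "M (2 * p + 1) = 0" for p
  proof (induction p)
    case (Suc p)
    show ?case using rec[of "2 * p + 1"] Suc \<open>l \<ge> 0\<close> by simp
  qed (use assms in simp)
  have even: "M (2 * p) = fact (2 * p) / (2 ^ (2 * p) * fact p * pochhammer (l + 1) p)" for p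
  proof (induction p)
    case (Suc p)
    have c: "l + 1 + p > 0" using \<open>l \<ge> 0\<close> by simp
    have "2 * (l + 1 + p) * M (2 * p + 2) = (2 * real p + 1) * M (2 * p)"
      using rec[of "2 * p"] by (simp add: algebra_simps)
    then have "M (2 * p + 2) = (2 * real p + 1) * M (2 * p) / (2 * (l + 1 + p))"
      using c by (simp add: field_simps)
    also have "\<dots> = fact (2 * p + 2) / (2 ^ (2 * p + 2) * fact (p + 1) * pochhammer (l + 1) (p + 1))"
    proof -
      have "(2 * real p + 1) * (F / (T * G * P)) / (2 * c)
          = (2 * real p + 2) * ((2 * real p + 1) * F) / (4 * T * ((real p + 1) * G) * (c * P))"
        if "T > 0" "G > 0" "P > 0" "c > 0" for T G P c F :: real
        using that by (simp add: divide_simps)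
      note * = this[of "2 ^ (2 * p)" "fact p" "pochhammer (l + 1) p" "l + 1 + p" "fact (2 * p)"]
      have e: "(fact (2 * p + 2) :: real) = (2 * real p + 2) * ((2 * real p + 1) * fact (2 * p))"
        "(2::real) ^ (2 * p + 2) = 4 * 2 ^ (2 * p)" "(fact (p + 1) :: real) = (real p + 1) * fact p"
        "pochhammer (l + 1) (p + 1) = (l + 1 + p) * pochhammer (l + 1) p"
        using pochhammer_rec'[of "l + 1" p] by (simp_all add: algebra_simps)
      show ?thesis unfolding Suc e by (rule *) (use c pos[of p] in simp_all)
    qed
    finally show ?case by simp
  qed (use assms in simp)
  show ?thesis
  proof (cases "even k")
    case True
    then obtain p where "k = 2 * p" unfolding dvd_def by blast
    then show ?thesis using even gmoment_add[of l 0 p] by simp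
  next
    case False
    then show ?thesis using odd by (auto simp: gmoment_eq_0 elim: oddE)
  qed
qed

lemma continuous_on_hgeg [continuous_intros]:
  assumes "continuous_on A f" "continuous_on A g"
  shows "continuous_on A (\<lambda>x. hgeg l m (f x) (g x))"
  using assms by (induction l m "0::real" "0::real" rule: hgeg.induct)
    (auto intro!: continuous_intros simp: divide_inverse)

text \<open>Induction along the three-term recursion, whose counterpart on moments is
  \<open>gmoment_rec\<close>; the moments of pure powers are the only input.\<close>

lemma hgeg_moments:
  assumes L: "linear_cont L" and mom: "\<And>k. L (\<lambda>v. v ^ k) = gmoment l 0 k" and l: "l \<ge> 0"
  shows "L (\<lambda>v. hgeg l m v 1 * v ^ k) = gmoment l m k"
proof (induction m arbitrary: k rule: less_induct)
  case (less m)
  consider "m = 0" | "m = 1" | j where "m = Suc (Suc j)" by (metis One_nat_def not0_implies_Suc)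
  then show ?case
  proof cases
    case 2
    have "gmoment l 0 (k + 1) = gmoment l 1 k"
    proof (cases "odd k")
      case True
      then obtain p where k: "k = 2 * p + 1" by (elim oddE)
      have "gmoment l 0 (k + 1) = gmoment l 0 (0 + 2 * (p + 1))" "gmoment l 1 k = gmoment l 1 (1 + 2 * p)"
        using k by simp_all
      moreover have "(2 + 2 * real p) * X / (4 * T * ((1 + real p) * F) * P) = X / (2 * T * F * P)"
        for X T F P :: real
      proof -
        have "(2 + 2 * real p) * X / (4 * T * ((1 + real p) * F) * P)
            = (2 * (1 + real p)) * X / ((2 * (1 + real p)) * (2 * T * F * P))"
          by (simp add: mult_ac)
        also have "\<dots> = X / (2 * T * F * P)" by (rule mult_divide_mult_cancel_left) simp
        finally show ?thesis .
      qed
      ultimately show ?thesis unfolding gmoment_add by (simp add: add.commute)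
    qed (cases k; simp add: gmoment_def)
    then show ?thesis using 2 mom[of "k + 1"] by simp
  next
    case (3 j)
    let ?a = "2 * (real j + 1 + l) / (real j + 1 + 2 * l)" and ?b = "- ((real j + 1) / (real j + 1 + 2 * l))"
    have nz: "real j + 1 + 2 * l > 0" using l by simp
    have "(\<lambda>v. hgeg l m v 1 * v ^ k) =
        (\<lambda>v. ?a * (hgeg l (Suc j) v 1 * v ^ (k + 1)) + ?b * (hgeg l j v 1 * v ^ k))"
    proof -
      have "((c * v * X - b * 1 * Y) / D) * w = c / D * (X * (v * w)) + - (b / D) * (Y * w)"
        for c v X b Y D w :: real
        by (simp add: diff_divide_distrib algebra_simps)
      then show ?thesis unfolding 3 hgeg.simps by (simp add: fun_eq_iff)
    qed
    then have "L (\<lambda>v. hgeg l m v 1 * v ^ k) = ?a * L (\<lambda>v. hgeg l (Suc j) v 1 * v ^ (k + 1))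
        + ?b * L (\<lambda>v. hgeg l j v 1 * v ^ k)"
      by (simp only:) (intro linear_contD[OF L] continuous_intros)
    then have "L (\<lambda>v. hgeg l m v 1 * v ^ k) = ?a * gmoment l (j + 1) (k + 1) + ?b * gmoment l j k"
      using less.IH[of "Suc j" "k + 1"] less.IH[of j k] 3
      by simp
    also have "\<dots> = (2 * (real j + 1 + l) * gmoment l (j + 1) (k + 1) - (real j + 1) * gmoment l j k)
        / (real j + 1 + 2 * l)"
      by (simp add: diff_divide_distrib)
    also have "\<dots> = gmoment l (j + 2) k" using gmoment_rec[OF l, of j k] nz by (simp add: field_simps)
    finally show ?thesis using 3 by simp
  qed (simp add: mom)
qed

section \<open>Difference identities and the Rothe--Hagen convolution\<close>

lemma poly_pochhammer_linear: "poly (pochhammer [:a, 1:] n) x = pochhammer (x + a :: real) n"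
  by (induction n) (simp_all add: pochhammer_rec' algebra_simps)

text \<open>This is \<open>q!\<close> times the Rothe number
  \<open>x / (x + 2q) * binom(x + 2q, q)\<close>, with the factor \<open>x + 2q\<close> cancelled so
  that it is a polynomial in x. The case q = 0 is separate because \<open>q - 1\<close>
  truncates.\<close>

definition gould :: "nat \<Rightarrow> real \<Rightarrow> real" where
  "gould q x = (if q = 0 then 1 else x * pochhammer (x + real q + 1) (q - 1))"

text \<open>Backward differences act on this family like differentiation on powers, up to a shift of
  x. \<open>pochhammer_shift_diff\<close> is the same rule for the closed form, which makes the
  induction in \<open>rothe_hagen\<close> close.\<close>

lemma gould_diff: "gould (Suc q) x - gould (Suc q) (x - 1) = real (Suc q) * gould q (x + 1)"
proof (cases q)
  case (Suc r)
  define P where "P = pochhammer (x + r + 3) r"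
  have 1: "pochhammer (x + real r + 3) (Suc r) = P * (x + 2 * r + 3)"
    unfolding P_def by (subst pochhammer_Suc) (simp add: algebra_simps)
  have 2: "pochhammer (x + real r + 2) (Suc r) = (x + r + 2) * P"
    unfolding P_def by (subst pochhammer_rec) (simp add: algebra_simps)
  have "gould (Suc q) x = x * (P * (x + 2 * r + 3))"
    using 1 Suc by (simp add: gould_def algebra_simps)
  moreover have "gould (Suc q) (x - 1) = (x - 1) * ((x + r + 2) * P)"
    using 2 Suc by (simp add: gould_def algebra_simps)
  moreover have "gould q (x + 1) = (x + 1) * P"
    using Suc by (simp add: gould_def P_def algebra_simps)
  ultimately show ?thesis using Suc by (simp add: algebra_simps)
qed (simp add: gould_def)

lemma pochhammer_shift_diff:
  "pochhammer (w + real (Suc p)) (Suc p) - pochhammer (w - 1 + real (Suc p)) (Suc p)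
     = real (Suc p) * pochhammer (w + 1 + real p) p"
proof -
  define P where "P = pochhammer (w + 1 + p) p"
  have 1: "pochhammer (w + real (Suc p)) (Suc p) = P * (w + 2 * p + 1)"
    unfolding P_def by (subst pochhammer_Suc) (simp add: algebra_simps)
  have 2: "pochhammer (w - 1 + real (Suc p)) (Suc p) = (w + p) * P"
    unfolding P_def by (subst pochhammer_rec) (simp add: algebra_simps)
  show ?thesis unfolding 1 2 P_def[symmetric] by (simp add: algebra_simps)
qed

text \<open>
  Both sides have the same differences in \<open>x\<close> by induction on \<open>p\<close>,
  and they agree at \<open>x = 0\<close>; since they are polynomials in \<open>x\<close>, agreement at all naturals suffices.
\<close>

lemma rothe_hagen:
  "(\<Sum>q\<le>p. real (p choose q) * pochhammer (w + real (p - q)) (p - q) * gould q x)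
     = pochhammer (w + x + real p) p"
proof (induction p arbitrary: x)
  case 0
  show ?case by (simp add: gould_def)
next
  case (Suc p)
  define S where "S x = (\<Sum>q\<le>Suc p. real (Suc p choose q) * pochhammer (w + real (Suc p - q)) (Suc p - q) * gould q x)" for x
  define R where "R x = pochhammer (w + x + real (Suc p)) (Suc p)" for x
  have split: "S x = pochhammer (w + real (Suc p)) (Suc p)
      + (\<Sum>q\<le>p. real (Suc p choose Suc q) * pochhammer (w + real (p - q)) (p - q) * gould (Suc q) x)" for x
    unfolding S_def by (subst sum.atMost_Suc_shift) (simp add: gould_def)
  have dS: "S x - S (x - 1) = real (Suc p) * pochhammer (w + (x + 1) + real p) p" for x
  proof -
    have "S x - S (x - 1) = (\<Sum>q\<le>p. real (Suc p choose Suc q) * pochhammer (w + real (p - q)) (p - q)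
        * (real (Suc q) * gould q (x + 1)))"
      unfolding split by (simp add: sum_subtractf[symmetric] right_diff_distrib[symmetric] gould_diff
          del: of_nat_Suc binomial_Suc_Suc)
    also have "\<dots> = (\<Sum>q\<le>p. real (Suc p) * (real (p choose q) * pochhammer (w + real (p - q)) (p - q)
        * gould q (x + 1)))"
    proof (rule sum.cong)
      fix q
      have "real (Suc p choose Suc q) * real (Suc q) = real (Suc p) * real (p choose q)"
        using Suc_times_binomial[of q p] by (metis of_nat_mult mult.commute)
      then show "real (Suc p choose Suc q) * pochhammer (w + real (p - q)) (p - q) * (real (Suc q) * gould q (x + 1))
          = real (Suc p) * (real (p choose q) * pochhammer (w + real (p - q)) (p - q) * gould q (x + 1))"
        by (metis mult.assoc mult.commute)
    qed simp
    finally show ?thesis by (simp only: sum_distrib_left[symmetric] Suc.IH)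
  qed
  have dR: "R x - R (x - 1) = real (Suc p) * pochhammer (w + (x + 1) + real p) p" for x
    using pochhammer_shift_diff[of "w + x" p] by (simp add: R_def algebra_simps)
  have step: "S x - R x = S (x - 1) - R (x - 1)" for x using dS[of x] dR[of x] by linarith
  \<comment> \<open>At 0 only the term q = 0 survives, since \<open>gould\<close> of positive index
    has the factor x.\<close>
  have "S 0 = R 0" unfolding split R_def by (simp add: gould_def)
  then have nat: "S (real k) = R (real k)" for k
  proof (induction k)
    case (Suc k)
    then show ?case using step[of "real (Suc k)"] by simp
  qed (use \<open>S 0 = R 0\<close> in simp)
  define G where "G q = (if q = 0 then 1 else [:0, 1:] * pochhammer [:real q + 1, 1:] (q - 1))" for q
  have G: "poly (G q) x = gould q x" for q x
    by (simp add: G_def gould_def poly_pochhammer_linear algebra_simps)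
  define D where "D = (\<Sum>q\<le>Suc p. smult (real (Suc p choose q) * pochhammer (w + real (Suc p - q)) (Suc p - q)) (G q))
      - pochhammer [:w + real (Suc p), 1:] (Suc p)"
  have D: "poly D x = S x - R x" for x
    unfolding D_def S_def R_def poly_diff poly_sum poly_smult G poly_pochhammer_linear
    by (simp only: algebra_simps)
  have "range real \<subseteq> {x. poly D x = 0}" using nat by (auto simp: D)
  moreover have "infinite (range real)" by (intro range_inj_infinite inj_of_nat)
  ultimately have "D = 0" using poly_roots_finite[of D] finite_subset by blast
  then have "S x = R x" using D[of x] by simp
  then show ?case unfolding S_def R_def .
qed

text \<open>The entry point of \<open>gould\<close>: the numerator is a coefficient of
  \<open>geg_trans\<close>, the denominator comes from
  \<open>gmoment \<sigma> 0 (2 * q)\<close>.\<close>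

lemma gould_pochhammer:
  assumes "\<sigma> \<ge> 0"
  shows "pochhammer \<sigma> (2 * q) / pochhammer (\<sigma> + 1) q = gould q \<sigma>"
proof (cases q)
  case (Suc r)
  have "pochhammer \<sigma> (2 * q) = \<sigma> * pochhammer (\<sigma> + 1) (q + r)"
    using pochhammer_rec[of \<sigma> "q + r"] Suc by (simp add: mult_2)
  also have "\<dots> = \<sigma> * (pochhammer (\<sigma> + 1) q * pochhammer (\<sigma> + 1 + real q) r)"
    by (simp add: pochhammer_product'[of "\<sigma> + 1" q r])
  finally show ?thesis
    using Suc pochhammer_pos[of "\<sigma> + 1" q] assms by (simp add: gould_def algebra_simps)
qed (simp add: gould_def)

lemma continuous_on_geg_trans [continuous_intros]:
  "continuous_on A f \<Longrightarrow> continuous_on A (\<lambda>x. geg_trans \<mu> \<sigma> k (f x))"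
  unfolding geg_trans_def by (intro continuous_intros)

lemma linear_cont_sum:
  assumes "linear_cont L" "finite I" "\<And>i. i \<in> I \<Longrightarrow> continuous_on UNIV (f i)"
  shows "L (\<lambda>v. \<Sum>i\<in>I. c i * f i v) = (\<Sum>i\<in>I. c i * L (f i))"
  using assms(2,3)
proof (induction I rule: finite_induct)
  case empty
  show ?case using linear_contD[OF assms(1), of "\<lambda>_. 0" "\<lambda>_. 0" 0 0] by simp
next
  case (insert i I)
  have "L (\<lambda>v. c i * f i v + 1 * (\<Sum>i\<in>I. c i * f i v)) = c i * L (f i) + 1 * L (\<lambda>v. \<Sum>i\<in>I. c i * f i v)"
    using insert by (intro linear_contD[OF assms(1)] continuous_intros) auto
  then show ?case using insert by simp
qed

text \<open>The adjointness of averaging and parameter change, tested on powers. For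
  \<open>k = m + 2 * p\<close> only the exponents \<open>l = m + 2 * (p - q)\<close> contribute, and
  each summand is a constant times a Rothe--Hagen term with \<open>w = \<mu> + 1 + m\<close> and
  \<open>x = \<sigma>\<close>.\<close>

lemma geg_trans_moments:
  assumes L: "linear_cont L" and mom: "\<And>k. L (\<lambda>v. v ^ k) = gmoment \<mu> 0 k"
    and \<mu>: "\<mu> \<ge> 0" and \<sigma>: "\<sigma> \<ge> 0"
  shows "L (\<lambda>v. hgeg \<mu> m v 1 * geg_trans \<mu> \<sigma> k v) = gmoment (\<mu> + \<sigma>) m k"
proof -
  define c where "c l = real (k choose l) * pochhammer (\<mu> + 1) l * pochhammer \<sigma> (k - l)
       / pochhammer (\<mu> + \<sigma> + 1) k * gmoment \<sigma> 0 (k - l)" for l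
  have pos: "pochhammer (x + 1) j > 0" if "x \<ge> 0" for x :: real and j
    using that by (intro pochhammer_pos) auto
  have "(\<lambda>v. hgeg \<mu> m v 1 * geg_trans \<mu> \<sigma> k v) = (\<lambda>v. \<Sum>l\<le>k. c l * (hgeg \<mu> m v 1 * v ^ l))"
    by (simp add: geg_trans_def c_def sum_distrib_left fun_eq_iff mult_ac)
  then have "L (\<lambda>v. hgeg \<mu> m v 1 * geg_trans \<mu> \<sigma> k v) = L (\<lambda>v. \<Sum>l\<le>k. c l * (hgeg \<mu> m v 1 * v ^ l))"
    by (rule arg_cong)
  also have "\<dots> = (\<Sum>l\<le>k. c l * L (\<lambda>v. hgeg \<mu> m v 1 * v ^ l))"
    by (intro linear_cont_sum L continuous_intros) auto
  also have "\<dots> = (\<Sum>l\<le>k. c l * gmoment \<mu> m l)" by (simp add: hgeg_moments[OF L mom \<mu>])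
  also have "\<dots> = gmoment (\<mu> + \<sigma>) m k"
  proof (cases rule: gmoment_cases[of k m])
    case 2
    then show ?thesis by (simp add: gmoment_eq_0)
  next
    case (3 p)
    have "c l * gmoment \<mu> m l = 0" if "l \<le> k" for l
    proof (cases rule: gmoment_cases[of l m])
      case (1 r)
      have "odd (k - l)" using 1 3 that by presburger
      then have "gmoment \<sigma> 0 (k - l) = 0" by (intro gmoment_eq_0(2)) simp
      then show ?thesis by (simp add: c_def)
    next
      case 2 then show ?thesis by (simp add: gmoment_eq_0)
    next
      case (3 r) then show ?thesis by (simp add: gmoment_eq_0(2))
    qed
    then have "(\<Sum>l\<le>k. c l * gmoment \<mu> m l) = 0" by (intro sum.neutral) auto
    then show ?thesis using 3 by (simp add: gmoment_eq_0(2))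
  next
    case (1 p)
    define g where "g q = m + 2 * (p - q)" for q
    have summand: "c (g q) * gmoment \<mu> m (g q) =
        fact k / (2 ^ k * fact p * pochhammer (\<mu> + \<sigma> + 1) k)
          * (real (p choose q) * pochhammer (\<mu> + 1 + m + real (p - q)) (p - q) * gould q \<sigma>)"
      if q: "q \<le> p" for q
    proof -
      obtain r where r: "p = q + r" using q by (metis le_add_diff_inverse)
      have gq: "g q = m + 2 * r" and kg: "k - g q = 0 + 2 * q" and kk: "k = (m + 2 * r) + 2 * q"
        using 1 r by (auto simp: g_def)
      have b1: "real (k choose g q) = fact k / (fact (m + 2 * r) * fact (2 * q))"
        using binomial_fact[of "m + 2 * r" k, where ?'a = real] kk gq by simp
      have b2: "real (p choose q) = fact p / (fact q * fact r)"
        using binomial_fact[of q p, where ?'a = real] r by simp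
      \<comment> \<open>Split so that the first factor cancels the denominator of
        \<open>gmoment \<mu> m\<close>; the second is the factor in the Rothe--Hagen sum.\<close>
      have p1: "pochhammer (\<mu> + 1) (m + 2 * r) = pochhammer (\<mu> + 1) (m + r) * pochhammer (\<mu> + 1 + m + real r) r"
        using pochhammer_product'[of "\<mu> + 1" "m + r" r] by (simp add: mult_2 add.assoc)
      have p2: "pochhammer \<sigma> (2 * q) = gould q \<sigma> * pochhammer (\<sigma> + 1) q"
        using gould_pochhammer[OF \<sigma>, of q] pos[OF \<sigma>, of q] by (simp add: field_simps)
      have "c (g q) * gmoment \<mu> m (g q) = fact k / (fact (m + 2 * r) * fact (2 * q))
          * (pochhammer (\<mu> + 1) (m + r) * pochhammer (\<mu> + 1 + m + real r) r)
          * (gould q \<sigma> * pochhammer (\<sigma> + 1) q) / pochhammer (\<mu> + \<sigma> + 1) k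
          * (fact (2 * q) / (2 ^ (2 * q) * fact q * pochhammer (\<sigma> + 1) q))
          * (fact (m + 2 * r) / (2 ^ (m + 2 * r) * fact r * pochhammer (\<mu> + 1) (m + r)))"
        unfolding c_def kg b1 unfolding gq gmoment_add p1 by (simp add: p2)
      also have "\<dots> = fact k / (2 ^ (m + 2 * r) * 2 ^ (2 * q) * pochhammer (\<mu> + \<sigma> + 1) k)
          * (1 / (fact q * fact r) * pochhammer (\<mu> + 1 + m + real r) r * gould q \<sigma>)"
        using pos[OF \<mu>, of "m + r"] pos[OF \<sigma>, of q] by (simp add: divide_simps)
      also have "\<dots> = fact k / (2 ^ k * fact p * pochhammer (\<mu> + \<sigma> + 1) k)
          * (real (p choose q) * pochhammer (\<mu> + 1 + m + real r) r * gould q \<sigma>)"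
        unfolding b2 kk power_add by simp
      finally show ?thesis using r by simp
    qed
    have inj: "inj_on g {..p}" by (auto intro!: inj_onI simp: g_def)
    have "(\<Sum>l\<le>k. c l * gmoment \<mu> m l) = (\<Sum>l\<in>g ` {..p}. c l * gmoment \<mu> m l)"
    proof (rule sum.mono_neutral_right)
      show "g ` {..p} \<subseteq> {..k}" using 1 by (auto simp: g_def)
      show "\<forall>l\<in>{..k} - g ` {..p}. c l * gmoment \<mu> m l = 0"
      proof
        fix l assume l: "l \<in> {..k} - g ` {..p}"
        show "c l * gmoment \<mu> m l = 0"
        proof (cases rule: gmoment_cases[of l m])
          case (1 r)
          then have "r \<le> p" using l \<open>k = m + 2 * p\<close> by auto
          then have "l = g (p - r)" using 1 by (simp add: g_def)
          then show ?thesis using l by auto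
        next
          case 2 then show ?thesis by (simp add: gmoment_eq_0)
        next
          case (3 r) then show ?thesis by (simp add: gmoment_eq_0(2))
        qed
      qed
    qed simp
    also have "\<dots> = (\<Sum>q\<le>p. c (g q) * gmoment \<mu> m (g q))" by (simp add: sum.reindex[OF inj])
    also have "\<dots> = fact k / (2 ^ k * fact p * pochhammer (\<mu> + \<sigma> + 1) k) *
        (\<Sum>q\<le>p. real (p choose q) * pochhammer (\<mu> + 1 + m + real (p - q)) (p - q) * gould q \<sigma>)"
      unfolding sum_distrib_left by (intro sum.cong refl summand) auto
    also have "\<dots> = fact k / (2 ^ k * fact p * pochhammer (\<mu> + \<sigma> + 1) k) *
        pochhammer (\<mu> + 1 + m + \<sigma> + real p) p"
      by (simp only: rothe_hagen)
    \<comment> \<open>The second factor is the value of the sum and cancels; the first is the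
      denominator of \<open>gmoment (\<mu> + \<sigma>) m k\<close>.\<close>
    also have "pochhammer (\<mu> + \<sigma> + 1) k
        = pochhammer (\<mu> + \<sigma> + 1) (m + p) * pochhammer (\<mu> + 1 + m + \<sigma> + real p) p"
    proof -
      have k: "k = (m + p) + p" using 1 by simp
      show ?thesis unfolding k pochhammer_product' by (simp add: algebra_simps)
    qed
    also have "fact k / (2 ^ k * fact p * (pochhammer (\<mu> + \<sigma> + 1) (m + p) * pochhammer (\<mu> + 1 + m + \<sigma> + real p) p))
        * pochhammer (\<mu> + 1 + m + \<sigma> + real p) p = fact k / (2 ^ k * fact p * pochhammer (\<mu> + \<sigma> + 1) (m + p))"
      using pochhammer_pos[of "\<mu> + 1 + m + \<sigma> + real p" p] \<mu> \<sigma> by simp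
    finally show ?thesis using 1 by (simp add: gmoment_add)
  qed
  finally show ?thesis .
qed


section \<open>Measures on cones over a compact set\<close>

definition cone_map :: "'a::euclidean_space \<times> real \<Rightarrow> 'a \<times> real" where
  "cone_map = (\<lambda>(\<xi>, t). (sqrt t *\<^sub>R \<xi>, t))"

lemma continuous_on_cone_map: "continuous_on A cone_map"
  unfolding cone_map_def case_prod_beta by (intro continuous_intros)

lemma integrable_AE_compact:
  fixes f :: "'a::euclidean_space \<Rightarrow> real"
  assumes M: "finite_measure M" "sets M = sets borel" and K: "compact K" "AE x in M. x \<in> K"
    and f: "continuous_on UNIV f"
  shows "integrable M f"
proof -
  have "compact (f ` K)"
    by (intro compact_continuous_image continuous_on_subset[OF f] K) simp
  then obtain B where "\<forall>x\<in>f ` K. norm x \<le> B"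
    using compact_imp_bounded[of "f ` K"] unfolding bounded_iff by blast
  then have "AE x in M. norm (f x) \<le> B" using K(2) by (auto elim!: eventually_mono)
  moreover have "f \<in> borel_measurable M"
    using borel_measurable_continuous_onI[OF f] unfolding measurable_cong_sets[OF M(2) refl] .
  ultimately show ?thesis by (intro finite_measure.integrable_const_bound[OF M(1), of _ B])
qed

text \<open>Both domains have this form: K is the unit sphere for the paraboloid and [-1, 1] for the
  parabolic domain, and T is the radial measure. The support conditions make the inner product
  definite; compactness makes continuous functions integrable.\<close>

locale cone_measure =
  fixes N :: "'a::euclidean_space measure" and T :: "real measure" and K :: "'a set"
  assumes finite_N: "finite_measure N" and finite_T: "finite_measure T"
    and sets_N [measurable_cong]: "sets N = sets borel"
    and sets_T [measurable_cong]: "sets T = sets borel"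
    and compact_K: "compact K" and K_nonempty: "K \<noteq> {}"
    and AE_N: "AE \<xi> in N. \<xi> \<in> K" and AE_T: "AE t in T. t \<in> {0..1}"
    and supp_N: "open A \<Longrightarrow> A \<inter> K \<noteq> {} \<Longrightarrow> emeasure N A > 0"
    and supp_T: "open B \<Longrightarrow> B \<inter> {0..1} \<noteq> {} \<Longrightarrow> emeasure T B > 0"
begin

sublocale N: finite_measure N by (rule finite_N)
sublocale T: finite_measure T by (rule finite_T)
sublocale pair_sigma_finite N T ..

definition P :: "('a \<times> real) measure" where "P = distr (N \<Otimes>\<^sub>M T) borel cone_map"

definition X :: "('a \<times> real) set" where "X = cone_map ` (K \<times> {0..1})"

definition ip :: "('a \<times> real \<Rightarrow> real) \<Rightarrow> ('a \<times> real \<Rightarrow> real) \<Rightarrow> real" where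
  "ip f g = (\<integral>p. f p * g p \<partial>P) / measure P UNIV"

lemma cone_map_measurable [measurable]: "cone_map \<in> N \<Otimes>\<^sub>M T \<rightarrow>\<^sub>M borel"
proof -
  have "(cone_map :: 'a \<times> real \<Rightarrow> _) \<in> borel \<rightarrow>\<^sub>M borel"
    by (intro borel_measurable_continuous_onI continuous_on_cone_map)
  moreover have "sets (N \<Otimes>\<^sub>M T) = sets borel"
    by (metis borel_prod sets_N sets_T sets_pair_measure_cong)
  ultimately show ?thesis by (simp cong: measurable_cong_sets)
qed

lemma sets_P [simp, measurable_cong]: "sets P = sets borel" and space_P [simp]: "space P = UNIV"
  by (simp_all add: P_def)

lemma compact_X: "compact X"
  unfolding X_def by (intro compact_continuous_image continuous_on_cone_map compact_Times compact_K) simp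

lemma AE_NT: "AE z in N \<Otimes>\<^sub>M T. fst z \<in> K \<and> snd z \<in> {0..1}"
proof (rule AE_pair_measure)
  have [measurable]: "K \<in> sets borel" using compact_K by (simp add: compact_imp_closed)
  show "{z \<in> space (N \<Otimes>\<^sub>M T). fst z \<in> K \<and> snd z \<in> {0..1}} \<in> sets (N \<Otimes>\<^sub>M T)"
    by measurable
  show "AE x in N. AE y in T. fst (x, y) \<in> K \<and> snd (x, y) \<in> {0..1}"
    using AE_N AE_T by auto
qed

lemma finite_P: "finite_measure P"
proof -
  interpret NT: finite_measure "N \<Otimes>\<^sub>M T"
    by (intro finite_measure_pair_measure finite_N finite_T)
  show ?thesis unfolding P_def by (intro NT.finite_measure_distr cone_map_measurable)
qed

sublocale P: finite_measure P by (rule finite_P)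

lemma AE_P: "AE p in P. p \<in> X"
proof -
  have "X \<in> sets borel" using compact_X by (simp add: compact_imp_closed)
  moreover have "AE z in N \<Otimes>\<^sub>M T. cone_map z \<in> X"
    using AE_NT by eventually_elim (auto simp: X_def mem_Times_iff)
  ultimately show ?thesis
    unfolding P_def by (subst AE_distr_iff) auto
qed

lemma integrable_P: "continuous_on UNIV f \<Longrightarrow> integrable P (f :: 'a \<times> real \<Rightarrow> real)"
  by (rule integrable_AE_compact[OF finite_P sets_P compact_X AE_P])

lemma integrable_N: "continuous_on UNIV f \<Longrightarrow> integrable N (f :: 'a \<Rightarrow> real)"
  by (rule integrable_AE_compact[OF finite_N sets_N compact_K AE_N])

text \<open>Fubini; a factorisation on K and [0, 1] suffices because these sets carry the measures.
  Homogeneous integrands thus split into a radial and an angular integral.\<close>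

lemma integral_P_factor:
  assumes F: "continuous_on UNIV F" and f: "continuous_on UNIV f" and a: "continuous_on UNIV a"
    and eq: "\<And>\<xi> t. \<xi> \<in> K \<Longrightarrow> t \<in> {0..1} \<Longrightarrow> F (sqrt t *\<^sub>R \<xi>, t) = a t * f \<xi>"
  shows "(\<integral>p. F p \<partial>P) = (\<integral>t. a t \<partial>T) * (\<integral>\<xi>. f \<xi> \<partial>N :: real)"
proof -
  have Fm: "F \<in> borel_measurable borel" and [measurable]: "f \<in> borel_measurable borel" "a \<in> borel_measurable borel"
    using F f a by (auto intro: borel_measurable_continuous_onI)
  have [measurable]: "(\<lambda>z. F (cone_map z)) \<in> borel_measurable (N \<Otimes>\<^sub>M T)"
    using Fm by (rule measurable_compose[OF cone_map_measurable])
  have int: "integrable (N \<Otimes>\<^sub>M T) (\<lambda>z. F (cone_map z))"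
    using integrable_P[OF F] Fm unfolding P_def by (simp add: integrable_distr_eq)
  have AE: "AE z in N \<Otimes>\<^sub>M T. F (cone_map z) = a (snd z) * f (fst z)"
    using AE_NT by eventually_elim (auto simp: cone_map_def eq split: prod.splits)
  have int': "integrable (N \<Otimes>\<^sub>M T) (\<lambda>z. a (snd z) * f (fst z))"
    using int AE by (subst integrable_cong_AE[symmetric]) auto
  have "(\<integral>p. F p \<partial>P) = (\<integral>z. F (cone_map z) \<partial>(N \<Otimes>\<^sub>M T))"
    unfolding P_def using Fm by (intro integral_distr) auto
  also have "\<dots> = (\<integral>z. a (snd z) * f (fst z) \<partial>(N \<Otimes>\<^sub>M T))"
    using AE by (intro integral_cong_AE) auto
  also have "\<dots> = (\<integral>\<xi>. \<integral>t. a t * f \<xi> \<partial>T \<partial>N)"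
    using integral_fst'[OF int'] by simp
  finally show ?thesis by simp
qed

lemma supp_P:
  assumes "open S" "S \<inter> X \<noteq> {}" shows "emeasure P S > 0"
proof -
  obtain \<xi> t where z: "\<xi> \<in> K" "t \<in> {0..1}" "cone_map (\<xi>, t) \<in> S"
    using assms(2) unfolding X_def by blast
  have "open (cone_map -` S)"
    by (rule open_vimage[OF assms(1) continuous_on_cone_map])
  then obtain A B where AB: "open A" "open B" "(\<xi>, t) \<in> A \<times> B" "A \<times> B \<subseteq> cone_map -` S"
    using z by (metis open_prod_elim vimageI)
  have "A \<inter> K \<noteq> {}" "B \<inter> {0..1} \<noteq> {}" using AB(3) z(1,2) by blast+
  then have pos: "emeasure N A > 0" "emeasure T B > 0"
    using supp_N[OF AB(1)] supp_T[OF AB(2)] by simp_all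
  have "emeasure N A * emeasure T B = emeasure (N \<Otimes>\<^sub>M T) (A \<times> B)"
    using AB sets_N sets_T by (intro T.emeasure_pair_measure_Times[symmetric]) auto
  also have "\<dots> \<le> emeasure (N \<Otimes>\<^sub>M T) (cone_map -` S \<inter> space (N \<Otimes>\<^sub>M T))"
  proof (rule emeasure_mono)
    show "A \<times> B \<subseteq> cone_map -` S \<inter> space (N \<Otimes>\<^sub>M T)"
      using AB sets_eq_imp_space_eq[OF sets_N] sets_eq_imp_space_eq[OF sets_T]
      by (auto simp: space_pair_measure)
    show "cone_map -` S \<inter> space (N \<Otimes>\<^sub>M T) \<in> sets (N \<Otimes>\<^sub>M T)"
      using assms(1) by (intro measurable_sets[OF cone_map_measurable]) auto
  qed
  also have "\<dots> = emeasure P S"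
    unfolding P_def using assms(1) by (simp add: emeasure_distr)
  finally show ?thesis
    using pos by (metis ennreal_zero_less_mult_iff order_less_le_trans)
qed

lemma measure_P_pos: "measure P UNIV > 0"
proof -
  have "UNIV \<inter> X \<noteq> {}" using K_nonempty by (auto simp: X_def)
  then have "emeasure P UNIV > 0" by (intro supp_P) auto
  then show ?thesis by (simp add: P.emeasure_eq_measure)
qed

lemma measure_P: "measure P UNIV = measure N UNIV * measure T UNIV"
proof -
  have "measure P UNIV = (\<integral>t. 1 \<partial>T) * (\<integral>\<xi>. 1 \<partial>N)"
    using integral_P_factor[of "\<lambda>_. 1" "\<lambda>_. 1" "\<lambda>_. 1"] by simp
  then show ?thesis
    using sets_eq_imp_space_eq[OF sets_N] sets_eq_imp_space_eq[OF sets_T] by simp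
qed

lemma measure_N_T_pos: "measure N UNIV > 0" "measure T UNIV > 0"
  using measure_P_pos unfolding measure_P by (auto simp: zero_less_mult_iff order.strict_iff_order)

text \<open>The set where f is nonzero is open and null, so by \<open>supp_P\<close> it misses
  X.\<close>

lemma ip_zero_imp:
  assumes f: "continuous_on UNIV f" and 0: "ip f f = 0" and p: "p \<in> X"
  shows "f p = 0"
proof -
  have c: "continuous_on UNIV (\<lambda>p. f p * f p)" by (intro continuous_intros f)
  have "(\<integral>p. f p * f p \<partial>P) = 0" using 0 measure_P_pos by (simp add: ip_def)
  then have "AE p in P. f p * f p = 0"
    using integral_nonneg_eq_0_iff_AE[OF integrable_P[OF c]] by simp
  then have "AE p in P. p \<notin> {p. f p \<noteq> 0}" by simp
  moreover have op: "open {p. f p \<noteq> 0}"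
    using f by (intro open_Collect_neq) auto
  ultimately have "emeasure P {p. f p \<noteq> 0} = 0"
    by (subst (asm) AE_iff_null_sets[symmetric]) auto
  then show ?thesis using supp_P[OF op] p by auto
qed

text \<open>X carries the measure, Y is where the polynomials live: \<open>V0\<close> itself for
  restrictions, the whole plane for the parabolic domain. Agreement with \<open>ip\<close> can be
  expected for measurable functions only, whereas symmetry and congruence are asked of
  \<open>ip'\<close> for all functions.\<close>

lemma poly_innerI:
  assumes agree: "\<And>f g. f \<in> borel_measurable borel \<Longrightarrow> g \<in> borel_measurable borel \<Longrightarrow> ip' f g = ip f g"
    and comm: "\<And>f g. ip' f g = ip' g f"
    and cong: "\<And>f f' g. (\<And>x. x \<in> Y \<Longrightarrow> f x = f' x) \<Longrightarrow> ip' f g = ip' f' g"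
    and Y: "\<And>f n y. f \<in> polys_upto n \<Longrightarrow> (\<And>x. x \<in> X \<Longrightarrow> f x = 0) \<Longrightarrow> y \<in> Y \<Longrightarrow> f y = 0"
  shows "poly_inner Y ip'"
proof
  note m = measurable_polys_upto cont_polys_upto
  show "ip' (\<lambda>x. a * f x + b * g x) h = a * ip' f h + b * ip' g h"
    if "f \<in> polys_upto n" "g \<in> polys_upto n" "h \<in> polys_upto n" for f g h a b n
  proof -
    have "(\<integral>p. (a * f p + b * g p) * h p \<partial>P) = (\<integral>p. a * (f p * h p) + b * (g p * h p) \<partial>P)"
      by (intro Bochner_Integration.integral_cong) (auto simp: algebra_simps)
    also have "\<dots> = a * (\<integral>p. f p * h p \<partial>P) + b * (\<integral>p. g p * h p \<partial>P)"
    proof -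
      have "integrable P (\<lambda>p. f p * h p)" "integrable P (\<lambda>p. g p * h p)"
        using that m(2) by (blast intro: integrable_P continuous_on_mult)+
      then show ?thesis by simp
    qed
    finally show ?thesis
      using that by (simp add: agree m(1)[OF polys_upto_lincomb] m(1) ip_def add_divide_distrib)
  qed
  show "ip' f f \<ge> 0" if "f \<in> polys_upto n" for f n
    using that m(1)[OF that] by (simp add: agree ip_def)
  show "f x = 0" if "f \<in> polys_upto n" "ip' f f = 0" "x \<in> Y" for f n x
    using Y[OF that(1) _ that(3)] ip_zero_imp[OF m(2)[OF that(1)]] that(2) agree[of f f] m(1)[OF that(1)]
    by auto
  show "ip' f g = ip' g f" for f g by (rule comm)
  show "ip' f g = ip' f' g" if "\<And>x. x \<in> Y \<Longrightarrow> f x = f' x" for f f' g using that by (rule cong)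
qed

end


section \<open>Jacobi, Gegenbauer and radial weights\<close>

lemma emeasure_lborel_open_pos:
  fixes S :: "'a::euclidean_space set"
  assumes "open S" "S \<noteq> {}" shows "emeasure lborel S > 0"
proof -
  have "S \<notin> null_sets lborel"
    using open_not_negligible[OF assms] null_sets_completionI[of S lborel]
    by (auto simp: negligible_iff_null_sets)
  then show ?thesis using assms by (auto simp: null_sets_def zero_less_iff_neq_zero)
qed

definition interval_density :: "real \<Rightarrow> real \<Rightarrow> (real \<Rightarrow> real) \<Rightarrow> real measure" where
  "interval_density a b w = density lborel (\<lambda>x. ennreal (indicat_real {a..b} x * w x))"

context
  fixes a b :: real and w :: "real \<Rightarrow> real"
  assumes ab: "a < b" and meas [measurable]: "w \<in> borel_measurable borel" and nonneg: "\<And>x. w x \<ge> 0"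
begin

lemma sets_interval_density [simp, measurable_cong]: "sets (interval_density a b w) = sets borel"
  and space_interval_density [simp]: "space (interval_density a b w) = UNIV"
  by (simp_all add: interval_density_def)

lemma finite_interval_density:
  assumes "set_integrable lborel {a..b} w" shows "finite_measure (interval_density a b w)"
proof
  have "emeasure (interval_density a b w) UNIV = (\<integral>\<^sup>+x. ennreal (indicat_real {a..b} x * w x) \<partial>lborel)"
    unfolding interval_density_def by (subst emeasure_density) auto
  also have "\<dots> < \<infinity>"
    using assms nonneg by (subst nn_integral_eq_integral) (auto simp: set_integrable_def)
  finally show "emeasure (interval_density a b w) (space (interval_density a b w)) \<noteq> \<infinity>" by simp
qed

lemma AE_interval_density: "AE x in interval_density a b w. x \<in> {a..b}"
  unfolding interval_density_def
  by (subst AE_density) (auto simp: indicator_def split: if_splits)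

text \<open>An open set that meets the closed interval also meets the open one, where the density is
  positive.\<close>

lemma supp_interval_density:
  assumes pos: "\<And>x. x \<in> {a<..<b} \<Longrightarrow> w x > 0" and S: "open S" "S \<inter> {a..b} \<noteq> {}"
  shows "emeasure (interval_density a b w) S > 0"
proof (rule ccontr)
  assume "\<not> ?thesis"
  then have "S \<in> null_sets (interval_density a b w)" using S by (auto simp: null_sets_def)
  then have "AE x in lborel. x \<in> S \<longrightarrow> ennreal (indicat_real {a..b} x * w x) = 0"
    unfolding interval_density_def by (subst (asm) null_sets_density_iff) auto
  then have "AE x in lborel. x \<notin> S \<inter> {a<..<b}"
    by eventually_elim (use pos nonneg in \<open>force simp: indicator_def\<close>)
  then have "emeasure lborel (S \<inter> {a<..<b}) = 0"
    using S by (subst (asm) AE_iff_null_sets[symmetric]) auto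
  moreover have "S \<inter> {a<..<b} \<noteq> {}"
  proof -
    have "closure {a<..<b} = {a..b}" using ab by simp
    then show ?thesis using S open_Int_closure_eq_empty[OF S(1), of "{a<..<b}"] by simp
  qed
  ultimately show False
    using emeasure_lborel_open_pos[of "S \<inter> {a<..<b}"] S by (auto simp: open_Int)
qed

lemma integral_interval_density:
  fixes f :: "real \<Rightarrow> real"
  assumes [measurable]: "f \<in> borel_measurable borel"
  shows "(\<integral>x. f x \<partial>interval_density a b w) = (LINT x:{a..b}|lborel. f x * w x)"
  unfolding interval_density_def set_lebesgue_integral_def
  by (subst integral_density) (auto simp: nonneg mult_ac intro!: Bochner_Integration.integral_cong)

end

definition jac_weight :: "real \<Rightarrow> real \<Rightarrow> real \<Rightarrow> real" where
  "jac_weight a b z = (1 - z) powr a * (1 + z) powr b"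

text \<open>Substituting \<open>w = (1 - z) / 2\<close> gives a Beta integral;
  \<open>2 powr (a + b)\<close> comes from the weight and one more factor 2 from the substitution.
  The powers are those in the binomial expansion of
  \<open>(1 - z1) / 2 * v + (1 + z1) / 2 * z2\<close>.\<close>

lemma jac_weight_moment:
  assumes a: "a > -1" and b: "b > -1"
  shows "has_bochner_integral lborel (\<lambda>z. indicat_real {-1..1} z *
           (((1 - z) / 2) ^ i * ((1 + z) / 2) ^ j * jac_weight a b z))
         (2 powr (a + b + 1) * Beta (a + 1 + real i) (b + 1 + real j))"
proof -
  define A B where "A = a + 1 + real i" and "B = b + 1 + real j"
  have AB: "A > 0" "B > 0" using a b by (simp_all add: A_def B_def)
  define f where "f w = indicat_real {0..1} w * (w powr (A - 1) * (1 - w) powr (B - 1))" for w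
  have int: "set_integrable lborel {0..1} (\<lambda>w. w powr (A - 1) * (1 - w) powr (B - 1))"
    by (rule integrable_Beta[OF AB])
  have "has_bochner_integral lborel f (Beta A B)"
    unfolding has_bochner_integral_iff
  proof
    show "integrable lborel f" using int by (simp add: set_integrable_def f_def[abs_def])
    have "integral\<^sup>L lborel f = (LINT w:{0..1}|lborel. w powr (A - 1) * (1 - w) powr (B - 1))"
      by (simp add: set_lebesgue_integral_def f_def[abs_def])
    also have "\<dots> = Beta A B"
      using set_borel_integral_eq_integral(2)[OF int] has_integral_Beta_real[OF AB]
      by (simp add: integral_unique)
    finally show "integral\<^sup>L lborel f = Beta A B" .
  qed
  then have "has_bochner_integral lborel (\<lambda>z. f (1 / 2 + (- 1 / 2) * z)) (2 * Beta A B)"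
    using lborel_has_bochner_integral_real_affine_iff[of "-1/2" f "Beta A B" "1/2"] by simp
  then have "has_bochner_integral lborel (\<lambda>z. 2 powr (a + b) * f (1 / 2 + (- 1 / 2) * z))
      (2 powr (a + b) * (2 * Beta A B))"
    by (rule has_bochner_integral_mult_right)
  moreover have "2 powr (a + b) * f (1 / 2 + (- 1 / 2) * z) =
      indicat_real {-1..1} z * (((1 - z) / 2) ^ i * ((1 + z) / 2) ^ j * jac_weight a b z)" for z
  proof (cases "z \<in> {-1..1}")
    case True
    have p: "2 powr c * (x / 2) powr (c + real k) = (x / 2) ^ k * x powr c" if "x \<ge> 0" for x c :: real and k :: nat
    proof (cases "x = 0")
      case False
      then have "(x / 2) powr (c + real k) = (x / 2) powr c * (x / 2) ^ k"
        using that by (simp add: powr_add powr_realpow)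
      moreover have "2 powr c * (x / 2) powr c = x powr c"
        using that by (simp add: powr_mult[symmetric])
      ultimately show ?thesis by (simp add: mult_ac)
    qed simp
    have "2 powr (a + b) * f (1 / 2 + (- 1 / 2) * z) =
        (2 powr a * ((1 - z) / 2) powr (a + real i)) * (2 powr b * ((1 + z) / 2) powr (b + real j))"
      using True by (simp add: f_def A_def B_def powr_add indicator_def diff_divide_distrib add_divide_distrib)
    also have "\<dots> = ((1 - z) / 2) ^ i * (1 - z) powr a * (((1 + z) / 2) ^ j * (1 + z) powr b)"
      using True by (subst (1 2) p) auto
    finally show ?thesis using True by (simp add: jac_weight_def mult_ac)
  next
    case False
    then have "1 / 2 + (- 1 / 2) * z \<notin> {0..1}" by auto
    then show ?thesis using False by (simp add: f_def)
  qed
  ultimately show ?thesis by (simp add: A_def B_def powr_add mult_ac)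
qed

definition geg_measure :: "real \<Rightarrow> real measure" where
  "geg_measure l = interval_density (-1) 1 (\<lambda>v. (1 - v\<^sup>2) powr (l - 1/2))"

definition rad_measure :: "real \<Rightarrow> real \<Rightarrow> real measure" where
  "rad_measure b \<gamma> = interval_density 0 1 (\<lambda>t. t powr b * (1 - t) powr \<gamma>)"

lemma gegenbauer_weight_jacobi:
  "v \<in> {-1..1} \<Longrightarrow> (1 - v\<^sup>2) powr c = jac_weight c c (v::real)"
  by (simp add: jac_weight_def powr_mult[symmetric] power2_eq_square algebra_simps)

lemma set_integrable_geg:
  fixes l :: real
  assumes "l > -1/2"
  shows "set_integrable lborel {-1..1} (\<lambda>v. (1 - v\<^sup>2) powr (l - 1/2))"
proof -
  have "set_integrable lborel {-1..1} (jac_weight (l - 1/2) (l - 1/2))"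
    using jac_weight_moment[of "l - 1/2" "l - 1/2" 0 0] assms
    by (simp add: set_integrable_def has_bochner_integral_iff)
  then show ?thesis
    by (subst set_integrable_cong[OF refl refl gegenbauer_weight_jacobi]) auto
qed

lemma set_integrable_radial:
  fixes b \<gamma> :: real
  assumes "b > -1" "\<gamma> > -1"
  shows "set_integrable lborel {0..1} (\<lambda>t. t powr b * (1 - t) powr \<gamma>)"
  using integrable_Beta[of "b + 1" "\<gamma> + 1"] assms by simp

lemma sets_rad_measure [measurable_cong, simp]: "sets (rad_measure b \<gamma>) = sets borel"
  by (simp add: rad_measure_def interval_density_def)

lemma sets_geg_measure [measurable_cong, simp]: "sets (geg_measure l) = sets borel"
  by (simp add: geg_measure_def interval_density_def)

lemma cone_measure_radialI:
  fixes N :: "'a::euclidean_space measure"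
  assumes "finite_measure N" "sets N = sets borel" "compact K" "K \<noteq> {}" "AE \<xi> in N. \<xi> \<in> K"
    and "\<And>A. open A \<Longrightarrow> A \<inter> K \<noteq> {} \<Longrightarrow> emeasure N A > 0" and b: "b > -1" "\<gamma> > -1"
  shows "cone_measure N (rad_measure b \<gamma>) K"
proof (rule cone_measure.intro)
  show "finite_measure (rad_measure b \<gamma>)"
    unfolding rad_measure_def by (rule finite_interval_density) (use set_integrable_radial[OF b] in auto)
  show "AE t in rad_measure b \<gamma>. t \<in> {0..1}"
    unfolding rad_measure_def by (rule AE_interval_density) auto
  show "emeasure (rad_measure b \<gamma>) B > 0" if "open B" "B \<inter> {0..1} \<noteq> {}" for B
    unfolding rad_measure_def by (rule supp_interval_density) (use that in auto)
qed (use assms in auto)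

lemma cone_measure_gegenbauer:
  assumes l: "l > -1/2" and b: "b > -1" "\<gamma> > -1"
  shows "cone_measure (geg_measure l) (rad_measure b \<gamma>) {-1..1}"
proof (rule cone_measure_radialI)
  have pos: "1 - x\<^sup>2 > 0" if "x \<in> {-1<..<1}" for x :: real
    using that by (simp add: abs_square_less_1 abs_less_iff)
  show "finite_measure (geg_measure l)"
    unfolding geg_measure_def
    by (rule finite_interval_density) (use set_integrable_geg[OF l] in auto)
  show "AE t in geg_measure l. t \<in> {-1..1}"
    unfolding geg_measure_def by (rule AE_interval_density) auto
  show "emeasure (geg_measure l) A > 0" if "open A" "A \<inter> {-1..1} \<noteq> {}" for A
    unfolding geg_measure_def by (rule supp_interval_density) (use that pos in force)+
qed (use b in auto)

text \<open>The derivative of \<open>x ^ (k + 1) * (1 - x\<^sup>2) powr (l + 1/2)\<close> integrates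
  to 0 because the boundary values vanish, which is the recursion of \<open>moments_unique\<close>.
  Omitting the power of x gives the vanishing first moment.\<close>

lemma geg_measure_moments:
  assumes l: "l \<ge> 0"
  shows "(\<integral>v. v ^ k \<partial>geg_measure l) / measure (geg_measure l) UNIV = gmoment l 0 k"
proof -
  \<comment> \<open>An arbitrary admissible radial measure; the angular facts of the locale are what
    is wanted.\<close>
  interpret cone_measure "geg_measure l" "rad_measure 0 0" "{-1..1}"
    by (rule cone_measure_gegenbauer) (use l in auto)
  let ?w = "\<lambda>v::real. (1 - v\<^sup>2) powr (l - 1/2)"
  define I where "I k = (LINT v:{-1..1}|lborel. v ^ k * ?w v)" for k
  have I: "(\<integral>v. v ^ k \<partial>geg_measure l) = I k" for k
    unfolding geg_measure_def I_def by (rule integral_interval_density) auto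
  have int: "set_integrable lborel {-1..1} (\<lambda>v. v ^ k * ?w v)" for k
  proof -
    have "integrable (geg_measure l) (\<lambda>v. v ^ k)" by (intro integrable_N continuous_intros)
    then show ?thesis
      unfolding geg_measure_def interval_density_def set_integrable_def
      by (subst (asm) integrable_density) (auto simp: mult_ac)
  qed
  have HK: "((\<lambda>v. v ^ k * ?w v) has_integral I k) {-1..1}" for k
    using set_borel_integral_eq_integral[OF int[of k]] unfolding I_def by (simp add: has_integral_integral)
  have pos: "1 - x\<^sup>2 > 0" if "x \<in> {-1<..<1}" for x :: real
    using that by (simp add: abs_square_less_1 abs_less_iff)
  have powr: "(1 - x\<^sup>2) powr (l + 1/2) = (1 - x\<^sup>2) * ?w x" if "x \<in> {-1<..<1}" for x :: real
    using pos[OF that] powr_add[of "1 - x\<^sup>2" 1 "l - 1/2"] by (simp add: add.commute)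
  have cont: "continuous_on {-1..1} (\<lambda>x::real. (1 - x\<^sup>2) powr (l + 1/2))"
    using l by (intro continuous_on_powr' continuous_intros) (auto simp: abs_square_le_1 abs_le_iff)
  have der: "((\<lambda>x::real. (1 - x\<^sup>2) powr (l + 1/2)) has_real_derivative - (2 * l + 1) * (x * ?w x)) (at x)"
    if "x \<in> {-1<..<1}" for x
    using pos[OF that] by (auto intro!: derivative_eq_intros simp: algebra_simps)
  have a1: "((\<lambda>x. - (2 * l + 1) * (x ^ 1 * ?w x)) has_integral (0 powr (l + 1/2) - 0 powr (l + 1/2))) {-1..1}"
    using fundamental_theorem_of_calculus_interior[OF _ cont, of "\<lambda>x. - (2 * l + 1) * (x * ?w x)"] der
    by (simp add: has_real_derivative_iff_has_vector_derivative)
  have a2: "((\<lambda>x. - (2 * l + 1) * (x ^ 1 * ?w x)) has_integral (- (2 * l + 1) * I 1)) {-1..1}"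
    by (intro has_integral_mult_right HK)
  have I1: "I 1 = 0" using has_integral_unique[OF a1 a2] l by simp
  have rec: "(real k + 2 * l + 2) * I (k + 2) = (real k + 1) * I k" for k
  proof -
    \<comment> \<open>In the derivative one factor \<open>1 - x\<^sup>2\<close> is split off the
      higher power and expanded, so that only moments of the given weight occur.\<close>
    let ?d = "\<lambda>x. (real k + 1) * (x ^ k * ?w x) - (real k + 2 * l + 2) * (x ^ (k + 2) * ?w x)"
    have der2: "((\<lambda>x. x ^ (k + 1) * (1 - x\<^sup>2) powr (l + 1/2)) has_real_derivative ?d x) (at x)"
      if "x \<in> {-1<..<1}" for x
    proof -
      have "((\<lambda>x. x ^ (k + 1) * (1 - x\<^sup>2) powr (l + 1/2)) has_real_derivative
          (real k + 1) * x ^ k * (1 - x\<^sup>2) powr (l + 1/2) + (- (2 * l + 1) * (x * ?w x)) * x ^ (k + 1)) (at x)"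
        using DERIV_mult[OF DERIV_pow[of "k + 1" x] der[OF that]] by (simp add: add.commute)
      moreover have "(real k + 1) * x ^ k * (1 - x\<^sup>2) powr (l + 1/2) + (- (2 * l + 1) * (x * ?w x)) * x ^ (k + 1) = ?d x"
        unfolding powr[OF that] by (simp add: algebra_simps power2_eq_square)
      ultimately show ?thesis by simp
    qed
    have b1: "(?d has_integral (0 powr (l + 1/2) - (-1) ^ (k + 1) * 0 powr (l + 1/2))) {-1..1}"
      using fundamental_theorem_of_calculus_interior[of "-1" 1 "\<lambda>x. x ^ (k + 1) * (1 - x\<^sup>2) powr (l + 1/2)" ?d]
        der2 continuous_on_mult[OF _ cont, of "\<lambda>x. x ^ (k + 1)"]
      by (simp add: has_real_derivative_iff_has_vector_derivative continuous_intros)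
    have b2: "(?d has_integral ((real k + 1) * I k - (real k + 2 * l + 2) * I (k + 2))) {-1..1}"
      by (intro has_integral_diff has_integral_mult_right HK)
    have "(real k + 1) * I k - (real k + 2 * l + 2) * I (k + 2) = 0"
      using has_integral_unique[OF b1 b2] l by simp
    then show ?thesis by simp
  qed
  have I0: "I 0 = measure (geg_measure l) UNIV"
    using I[of 0] sets_eq_imp_space_eq[OF sets_geg_measure, of l] by simp
  have "I k / I 0 = gmoment l 0 k"
    by (rule moments_unique) (use l I0 measure_N_T_pos I1 rec in \<open>auto simp: field_simps\<close>)
  then show ?thesis using I I0 by simp
qed


section \<open>The paraboloid and the parabolic domain as cones\<close>

lemma borel_measurable_sgn' [measurable]:
  "(sgn :: 'a::euclidean_space \<Rightarrow> 'a) \<in> borel_measurable borel"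
  unfolding sgn_div_norm[abs_def] by measurable

lemma sets_sphere_measure [simp, measurable_cong]: "sets sphere_measure = sets borel"
  by (simp add: sphere_measure_def)

lemma space_sphere_measure [simp]: "space sphere_measure = UNIV"
  using sets_eq_imp_space_eq[OF sets_sphere_measure] by simp

lemma measurable_sgn_cball:
  "sgn \<in> restrict_space lborel (cball 0 1) \<rightarrow>\<^sub>M (borel :: 'a::euclidean_space measure)"
  by (rule measurable_restrict_space1) simp

text \<open>Turns the scaling factor into a constant density, to which
  \<open>integral_density\<close> applies.\<close>

lemma sphere_measure_density:
  "sphere_measure = density (distr (restrict_space lborel (cball 0 1)) borel sgn)
     (\<lambda>_::'a::euclidean_space. of_nat DIM('a))"
  unfolding sphere_measure_def by (rule measure_eqI) (auto simp: emeasure_density_const)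

lemma emeasure_sphere_measure:
  fixes A :: "'a::euclidean_space set"
  assumes "A \<in> sets borel"
  shows "emeasure sphere_measure A = of_nat DIM('a) * emeasure lborel {x \<in> cball 0 1. sgn x \<in> A}"
proof -
  have "sgn -` A \<inter> space (restrict_space lborel (cball 0 1)) = {x \<in> cball 0 1. sgn x \<in> A}"
    by (auto simp: space_restrict_space)
  then have "emeasure (distr (restrict_space lborel (cball 0 1)) borel sgn) A
      = emeasure (restrict_space lborel (cball 0 1)) {x \<in> cball 0 1. sgn x \<in> A}"
    using emeasure_distr[OF measurable_sgn_cball assms] by simp
  also have "\<dots> = emeasure lborel {x \<in> cball 0 1. sgn x \<in> A}"
    by (rule emeasure_restrict_space) auto
  finally show ?thesis unfolding sphere_measure_def by simp
qed

lemma integral_sphere_measure: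
  fixes f :: "'a::euclidean_space \<Rightarrow> real"
  assumes [measurable]: "f \<in> borel_measurable borel"
  shows "(\<integral>\<xi>. f \<xi> \<partial>sphere_measure) = real DIM('a) * (LINT x:cball 0 1|lborel. f (sgn x))"
proof -
  have "(\<integral>\<xi>. f \<xi> \<partial>sphere_measure) =
      (\<integral>\<xi>. real DIM('a) * f \<xi> \<partial>distr (restrict_space lborel (cball 0 1)) borel sgn)"
    unfolding sphere_measure_density
    using integral_density[of f "distr (restrict_space lborel (cball 0 1)) borel sgn" "\<lambda>_. real DIM('a)"]
    by (simp add: ennreal_of_nat_eq_real_of_nat)
  also have "\<dots> = (\<integral>x. real DIM('a) * f (sgn x) \<partial>restrict_space lborel (cball 0 1))"
    by (rule integral_distr[OF measurable_sgn_cball]) measurable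
  also have "\<dots> = real DIM('a) * (LINT x:cball 0 1|lborel. f (sgn x))"
    by (simp add: integral_restrict_space set_lebesgue_integral_def)
  finally show ?thesis .
qed

lemma finite_sphere_measure: "finite_measure (sphere_measure :: 'a::euclidean_space measure)"
proof
  have "emeasure lborel (cball (0::'a) 1) < \<infinity>"
    by (intro emeasure_bounded_finite) simp
  then show "emeasure (sphere_measure :: 'a measure) (space sphere_measure) \<noteq> \<infinity>"
    by (simp add: emeasure_sphere_measure ennreal_mult_eq_top_iff cball_def)
qed

lemma cone_measure_sphere:
  assumes "b > -1" "\<gamma> > -1"
  shows "cone_measure (sphere_measure :: 'a::euclidean_space measure) (rad_measure b \<gamma>) (sphere 0 1)"
proof (rule cone_measure_radialI)
  have [measurable]: "sphere 0 1 \<in> sets (borel :: 'a measure)" by (simp add: borel_closed)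
  \<comment> \<open>Only the origin has its \<open>sgn\<close> off the sphere.\<close>
  have "{x::'a \<in> cball 0 1. sgn x \<in> - sphere 0 1} \<subseteq> {0}" by (auto simp: norm_sgn)
  then have "emeasure lborel {x::'a \<in> cball 0 1. sgn x \<in> - sphere 0 1} = 0"
    using emeasure_mono[of "{x::'a \<in> cball 0 1. sgn x \<in> - sphere 0 1}" "{0}" lborel] by simp
  then have "emeasure sphere_measure (- sphere (0::'a) 1) = 0"
    by (subst emeasure_sphere_measure) auto
  then show "AE \<xi> in sphere_measure. \<xi> \<in> sphere (0::'a) 1"
    by (intro AE_I[of _ _ "- sphere 0 1"]) auto
  show "emeasure sphere_measure A > 0" if A: "open A" "A \<inter> sphere (0::'a) 1 \<noteq> {}" for A
  proof -
    \<comment> \<open>The part of the cone over A inside the open ball; the origin is removed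
      because \<open>sgn\<close> is discontinuous there.\<close>
    have 1: "open (ball 0 1 \<inter> {x::'a. x \<noteq> 0 \<and> sgn x \<in> A})" (is "open ?S")
    proof -
      have "continuous_on (- {0::'a}) sgn"
        by (auto simp: continuous_on_eq_continuous_at open_Compl intro!: continuous_sgn continuous_ident)
      then have "open (sgn -` A \<inter> - {0::'a})"
        using A(1) by (subst (asm) continuous_on_open_vimage) auto
      moreover have "{x::'a. x \<noteq> 0 \<and> sgn x \<in> A} = sgn -` A \<inter> - {0}" by auto
      ultimately show ?thesis by auto
    qed
    obtain \<xi> where \<xi>: "\<xi> \<in> A" "norm \<xi> = 1" using A(2) by auto
    have "(1/2) *\<^sub>R \<xi> \<in> ?S" using \<xi> by (auto simp: sgn_div_norm)
    then have "?S \<noteq> {}" by blast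
    then have "emeasure lborel ?S > 0" by (rule emeasure_lborel_open_pos[OF 1])
    also have "emeasure lborel ?S \<le> emeasure lborel {x \<in> cball 0 1. sgn x \<in> A}"
    proof (rule emeasure_mono)
      have "{x \<in> cball 0 1. sgn x \<in> A} = cball 0 1 \<inter> sgn -` A" by auto
      moreover have "sgn -` A \<in> sets borel"
        using measurable_sets[OF borel_measurable_sgn', of A] A(1) by simp
      ultimately show "{x \<in> cball 0 1. sgn x \<in> A} \<in> sets lborel" by simp
    qed auto
    finally show ?thesis
      using A(1) by (subst emeasure_sphere_measure) (auto simp: ennreal_zero_less_mult_iff)
  qed
  show "sphere (0::'a) 1 \<noteq> {}" by simp
qed (use assms finite_sphere_measure in auto)

lemma V0_eq_cone: "V0 = cone_map ` (sphere (0::'a::euclidean_space) 1 \<times> {0..1})"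
proof (intro equalityI subsetI)
  fix p :: "'a \<times> real" assume "p \<in> V0"
  then obtain x where x: "p = (x, (norm x)\<^sup>2)" "(norm x)\<^sup>2 \<le> 1" by (auto simp: V0_def)
  obtain e :: 'a where e: "norm e = 1" using vector_choose_size[of 1] by auto
  \<comment> \<open>At the apex the direction is not determined and any unit vector will do.\<close>
  define \<xi> where "\<xi> = (if x = 0 then e else sgn x)"
  have "p = cone_map (\<xi>, (norm x)\<^sup>2)" "norm \<xi> = 1"
    using x e by (auto simp: cone_map_def \<xi>_def sgn_div_norm norm_sgn)
  with x show "p \<in> cone_map ` (sphere 0 1 \<times> {0..1})"
    by (intro image_eqI[where x = "(\<xi>, (norm x)\<^sup>2)"]) auto
qed (auto simp: V0_def cone_map_def)

lemma U_eq_cone: "U = cone_map ` ({-1..1} \<times> {0..1})"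
proof (intro equalityI subsetI)
  fix p :: "real \<times> real" assume "p \<in> U"
  then obtain u s where p: "p = (u, s)" "u\<^sup>2 \<le> s" "s \<le> 1" by (auto simp: U_def)
  have s: "s \<ge> 0" using p(2) zero_le_power2 order_trans by blast
  have "\<bar>u\<bar> \<le> sqrt s" using p(2) by (simp add: real_le_rsqrt)
  define v where "v = (if s = 0 then 0 else u / sqrt s)"
  have "p = cone_map (v, s)" "v \<in> {-1..1}"
    using p s \<open>\<bar>u\<bar> \<le> sqrt s\<close> by (auto simp: cone_map_def v_def divide_simps abs_le_iff)
  with p s show "p \<in> cone_map ` ({-1..1} \<times> {0..1})"
    by (intro image_eqI[where x = "(v, s)"]) auto
next
  fix p assume "p \<in> cone_map ` ({-1..1::real} \<times> {0..1})"
  then obtain v t where "p = cone_map (v, t)" and vt: "v \<in> {-1..1}" "t \<in> {0..1}" by blast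
  then have p: "p = (sqrt t * v, t)" "v \<in> {-1..1}" "t \<in> {0..1}" by (simp_all add: cone_map_def)
  have "t * v\<^sup>2 \<le> t * 1" using p by (intro mult_left_mono) (auto simp: abs_square_le_1 abs_le_iff)
  then show "p \<in> U" using p by (auto simp: U_def power_mult_distrib)
qed

lemma U_weight_nonneg: "U_weight a b p \<ge> 0"
  by (simp add: U_weight_def split: prod.split)

section \<open>The weighted parabolic domain as a cone over [-1, 1]\<close>

context
  fixes b \<gamma> :: real
  assumes b: "b > -1/2" and \<gamma>: "\<gamma> > -1"
begin

interpretation G: cone_measure "geg_measure b" "rad_measure b \<gamma>" "{-1..1}"
  by (rule cone_measure_gegenbauer) (use b \<gamma> in auto)

text \<open>Substitute \<open>u = sqrt t * v\<close> in each slice: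
  \<open>t - u\<^sup>2 = t * (1 - v\<^sup>2)\<close> contributes \<open>t powr (b - 1/2)\<close> and
  the Jacobian \<open>sqrt t\<close>, together \<open>t powr b\<close>. This is why b is both the
  Gegenbauer parameter and the radial exponent.\<close>

lemma gegenbauer_cone_P:
  "G.P = density lborel (\<lambda>p. ennreal (indicat_real U p * U_weight \<gamma> b p))"
proof (rule measure_eqI)
  fix A assume "A \<in> sets G.P"
  then have A [measurable]: "A \<in> sets borel" by simp
  have A': "A \<in> sets (borel \<Otimes>\<^sub>M borel)" unfolding borel_prod by (rule A)
  have [measurable]: "U \<in> sets borel"
    unfolding U_eq_cone using G.compact_X by (simp add: G.X_def compact_imp_closed)
  have [measurable]: "U_weight \<gamma> b \<in> borel_measurable borel"
    unfolding U_weight_def borel_prod[symmetric] by measurable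
  have [measurable]: "Measurable.pred (borel \<Otimes>\<^sub>M borel) (\<lambda>x. x \<in> A)"
    using A' by simp
  have [measurable]: "Measurable.pred (borel \<Otimes>\<^sub>M borel) (\<lambda>x. x \<in> U)"
    using \<open>U \<in> sets borel\<close> by (simp add: borel_prod)
  have [measurable]: "U_weight \<gamma> b \<in> borel_measurable (borel \<Otimes>\<^sub>M borel)"
    by (simp add: borel_prod)
  have "emeasure G.P A = (\<integral>\<^sup>+p. indicator A p \<partial>G.P)" by simp
  also have "\<dots> = (\<integral>\<^sup>+z. indicator A (cone_map z) \<partial>(geg_measure b \<Otimes>\<^sub>M rad_measure b \<gamma>))"
    unfolding G.P_def by (intro nn_integral_distr) auto
  also have "\<dots> = (\<integral>\<^sup>+t. \<integral>\<^sup>+v. indicator A (cone_map (v, t)) \<partial>geg_measure b \<partial>rad_measure b \<gamma>)"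
    by (rule G.nn_integral_snd[symmetric]) measurable
  also have "\<dots> = (\<integral>\<^sup>+t. ennreal (indicat_real {0..1} t * (t powr b * (1 - t) powr \<gamma>)) *
      (\<integral>\<^sup>+v. ennreal (indicat_real {-1..1} v * (1 - v\<^sup>2) powr (b - 1/2)) * indicator A (sqrt t * v, t) \<partial>lborel) \<partial>lborel)"
    unfolding geg_measure_def rad_measure_def interval_density_def cone_map_def
    by (simp add: nn_integral_density)
  also have "\<dots> = (\<integral>\<^sup>+t. \<integral>\<^sup>+u. ennreal (indicat_real U (u, t) * U_weight \<gamma> b (u, t)) * indicator A (u, t) \<partial>lborel \<partial>lborel)"
  proof (rule nn_integral_cong)
    fix t :: real
    show "ennreal (indicat_real {0..1} t * (t powr b * (1 - t) powr \<gamma>)) *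
      (\<integral>\<^sup>+v. ennreal (indicat_real {-1..1} v * (1 - v\<^sup>2) powr (b - 1/2)) * indicator A (sqrt t * v, t) \<partial>lborel)
      = (\<integral>\<^sup>+u. ennreal (indicat_real U (u, t) * U_weight \<gamma> b (u, t)) * indicator A (u, t) \<partial>lborel)"
    proof (cases "t \<in> {0<..1}")
      case True
      have "(\<integral>\<^sup>+u. ennreal (indicat_real U (u, t) * U_weight \<gamma> b (u, t)) * indicator A (u, t) \<partial>lborel)
          = ennreal (sqrt t) * (\<integral>\<^sup>+v. ennreal (indicat_real U (sqrt t * v, t) * U_weight \<gamma> b (sqrt t * v, t))
              * indicator A (sqrt t * v, t) \<partial>lborel)"
        using True by (subst nn_integral_real_affine[where c = "sqrt t" and t = 0]) auto
      also have "\<dots> = (\<integral>\<^sup>+v. ennreal (sqrt t) * (ennreal (indicat_real U (sqrt t * v, t) * U_weight \<gamma> b (sqrt t * v, t))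
              * indicator A (sqrt t * v, t)) \<partial>lborel)"
        by (rule nn_integral_cmult[symmetric]) measurable
      also have "\<dots> = (\<integral>\<^sup>+v. ennreal (indicat_real {0..1} t * (t powr b * (1 - t) powr \<gamma>)) *
          (ennreal (indicat_real {-1..1} v * (1 - v\<^sup>2) powr (b - 1/2)) * indicator A (sqrt t * v, t)) \<partial>lborel)"
      proof (rule nn_integral_cong)
        fix v :: real
        have "(sqrt t * v, t) \<in> U \<longleftrightarrow> v \<in> {-1..1}"
        proof -
          have "(sqrt t * v)\<^sup>2 \<le> t \<longleftrightarrow> v\<^sup>2 \<le> 1"
            using True by (simp add: power_mult_distrib mult_le_cancel_left1)
          then show ?thesis using True by (auto simp: U_def abs_square_le_1 abs_le_iff)
        qed
        moreover have "sqrt t * U_weight \<gamma> b (sqrt t * v, t)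
            = t powr b * (1 - t) powr \<gamma> * (1 - v\<^sup>2) powr (b - 1/2)" if "v \<in> {-1..1}"
        proof -
          have "1 - v\<^sup>2 \<ge> 0" using that by (simp add: abs_square_le_1 abs_le_iff)
          moreover have "t - (sqrt t * v)\<^sup>2 = t * (1 - v\<^sup>2)"
            using True by (simp add: power_mult_distrib algebra_simps)
          ultimately have "(t - (sqrt t * v)\<^sup>2) powr (b - 1/2) = t powr (b - 1/2) * (1 - v\<^sup>2) powr (b - 1/2)"
            using True by (simp add: powr_mult)
          moreover have "sqrt t * t powr (b - 1/2) = t powr b"
            using True by (simp add: powr_half_sqrt[symmetric] powr_add[symmetric])
          ultimately show ?thesis by (simp add: U_weight_def mult_ac)
        qed
        ultimately show "ennreal (sqrt t) * (ennreal (indicat_real U (sqrt t * v, t) * U_weight \<gamma> b (sqrt t * v, t))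
              * indicator A (sqrt t * v, t)) = ennreal (indicat_real {0..1} t * (t powr b * (1 - t) powr \<gamma>)) *
          (ennreal (indicat_real {-1..1} v * (1 - v\<^sup>2) powr (b - 1/2)) * indicator A (sqrt t * v, t))"
          using True by (cases "v \<in> {-1..1}")
            (auto simp: mult.assoc[symmetric] ennreal_mult''[symmetric] indicator_def U_weight_nonneg)
      qed
      also have "\<dots> = ennreal (indicat_real {0..1} t * (t powr b * (1 - t) powr \<gamma>)) *
          (\<integral>\<^sup>+v. ennreal (indicat_real {-1..1} v * (1 - v\<^sup>2) powr (b - 1/2)) * indicator A (sqrt t * v, t) \<partial>lborel)"
        by (rule nn_integral_cmult) measurable
      finally show ?thesis ..
    next
      \<comment> \<open>Both sides vanish here. At t = 0 the slice of U is the single point 0, where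
        \<open>U_weight\<close> is 0 because a power \<open>powr\<close> of base 0 is 0.\<close>
      case False
      have "indicat_real U (u, t) * U_weight \<gamma> b (u, t) = 0" for u
      proof (cases "(u, t) \<in> U")
        case True
        then have "u\<^sup>2 \<le> t" "t \<le> 1" by (auto simp: U_def)
        with False have "t = 0" using zero_le_power2[of u] by (smt (verit) greaterThanAtMost_iff)
        with \<open>u\<^sup>2 \<le> t\<close> show ?thesis by (simp add: U_weight_def)
      qed simp
      moreover have "indicat_real {0..1} t * (t powr b * (1 - t) powr \<gamma>) = 0"
        using False by (cases "t = 0") (auto simp: indicator_def)
      ultimately show ?thesis by (simp only: ennreal_0 mult_zero_left nn_integral_const)
    qed
  qed
  also have "\<dots> = (\<integral>\<^sup>+p. ennreal (indicat_real U p * U_weight \<gamma> b p) * indicator A p \<partial>(lborel \<Otimes>\<^sub>M lborel))"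
    by (rule lborel_pair.nn_integral_snd) measurable
  also have "\<dots> = emeasure (density lborel (\<lambda>p. ennreal (indicat_real U p * U_weight \<gamma> b p))) A"
    unfolding lborel_prod by (subst emeasure_density) auto
  finally show "emeasure G.P A = emeasure (density lborel (\<lambda>p. ennreal (indicat_real U p * U_weight \<gamma> b p))) A" .
qed simp

lemma integral_U_weight:
  assumes [measurable]: "h \<in> borel_measurable borel"
  shows "(LINT x:U|lborel. h x * U_weight \<gamma> b x) = (\<integral>p. h p \<partial>G.P)"
proof -
  have [measurable]: "U \<in> sets borel"
    unfolding U_eq_cone using G.compact_X by (simp add: G.X_def compact_imp_closed)
  have [measurable]: "U_weight \<gamma> b \<in> borel_measurable borel"
    unfolding U_weight_def borel_prod[symmetric] by measurable
  show ?thesis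
    unfolding gegenbauer_cone_P set_lebesgue_integral_def
    by (subst integral_density) (auto simp: U_weight_nonneg mult_ac intro!: Bochner_Integration.integral_cong AE_I2)
qed

lemma U_inner_eq_ip:
  assumes "f \<in> borel_measurable borel" "g \<in> borel_measurable borel"
  shows "U_inner \<gamma> b f g = G.ip f g"
proof -
  have "(LINT x:U|lborel. U_weight \<gamma> b x) = measure G.P UNIV"
    using integral_U_weight[of "\<lambda>_. 1"] by simp
  then show ?thesis
    using integral_U_weight[of "\<lambda>x. f x * g x"] assms by (simp add: U_inner_def U_const_def G.ip_def)
qed

text \<open>A polynomial vanishing on U vanishes on its nonempty interior and hence everywhere, so
  the form is definite for polynomials on the whole plane.\<close>

lemma poly_inner_U: "poly_inner UNIV (U_inner \<gamma> b)"
proof (rule G.poly_innerI)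
  show "f y = 0" if "f \<in> polys_upto n" "\<And>x. x \<in> G.X \<Longrightarrow> f x = 0" for f n y
  proof (rule polys_upto_eq_zero[OF that(1)])
    have "(0, 1/2) \<in> {p :: real \<times> real. (fst p)\<^sup>2 < snd p \<and> snd p < 1}" by simp
    then show "{p :: real \<times> real. (fst p)\<^sup>2 < snd p \<and> snd p < 1} \<noteq> {}" by blast
    show "open {p :: real \<times> real. (fst p)\<^sup>2 < snd p \<and> snd p < 1}"
      by (intro open_Collect_conj open_Collect_less continuous_intros)
    show "f x = 0" if "x \<in> {p :: real \<times> real. (fst p)\<^sup>2 < snd p \<and> snd p < 1}" for x
    proof -
      have "x \<in> G.X" using that unfolding G.X_def U_eq_cone[symmetric] by (cases x) (simp add: U_def)
      then show ?thesis using \<open>\<And>x. x \<in> G.X \<Longrightarrow> f x = 0\<close> by blast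
    qed
  qed
  show "U_inner \<gamma> b f g = U_inner \<gamma> b g f" for f g by (simp add: U_inner_def mult.commute[of "f _"])
  show "U_inner \<gamma> b f g = U_inner \<gamma> b f' g" if "\<And>x. x \<in> UNIV \<Longrightarrow> f x = f' x" for f f' g
    using that by (simp add: U_inner_def)
qed (rule U_inner_eq_ip)

end

section \<open>The weighted paraboloid as a cone over the sphere\<close>

context
  fixes \<beta> \<gamma> b :: real
  assumes \<beta>: "\<beta> \<ge> -1/2" and \<gamma>: "\<gamma> > -1" and b: "b = \<beta> + (real DIM('a::euclidean_space) - 1) / 2"
begin

lemma V0_exponent: "b > -1"
proof -
  have "real DIM('a) \<ge> 1" using DIM_positive[where 'a = 'a] by linarith
  then have "(real DIM('a) - 1) / 2 \<ge> 0" by simp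
  then show ?thesis using \<beta> b by linarith
qed

interpretation S: cone_measure "sphere_measure :: 'a measure" "rad_measure b \<gamma>" "sphere 0 1"
  by (rule cone_measure_sphere[OF V0_exponent \<gamma>])

text \<open>The exponents \<open>(d - 1) / 2\<close> of the surface measure and \<beta> of the
  weight add up to b, so the radial measure is the one found for \<open>U_weight \<gamma> b\<close>.
  Almost every direction lies on the sphere, which turns the indicator of \<open>V0\<close> into
  that of [0, 1].\<close>

lemma integral_V0_weight:
  fixes h :: "'a \<times> real \<Rightarrow> real"
  assumes h [measurable]: "h \<in> borel_measurable borel"
  shows "(LINT p:V0|V0_measure. h p * varpi \<beta> \<gamma> (snd p)) = (\<integral>p. h p \<partial>S.P)"
proof -
  let ?c = "(real DIM('a) - 1) / 2"
  let ?M = "(sphere_measure :: 'a measure) \<Otimes>\<^sub>M (lborel :: real measure)"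
  define w1 where "w1 = (\<lambda>(\<xi>::'a, t). indicat_real {0..1} t * t powr ?c)"
  define w2 where "w2 = (\<lambda>(\<xi>::'a, t). indicat_real {0..1} t * (t powr b * (1 - t) powr \<gamma>))"
  have sM: "sets ?M = sets borel"
    by (metis borel_prod sets_sphere_measure sets_lborel sets_pair_measure_cong)
  have cm [measurable]: "cone_map \<in> ?M \<rightarrow>\<^sub>M borel"
    using borel_measurable_continuous_onI[OF continuous_on_cone_map[of "UNIV :: ('a \<times> real) set"]] sM
    by (simp cong: measurable_cong_sets)
  have [measurable]: "w1 \<in> borel_measurable ?M" "w2 \<in> borel_measurable ?M"
    unfolding w1_def w2_def by measurable
  have V0 [measurable]: "(V0 :: ('a \<times> real) set) \<in> sets borel"
    unfolding V0_eq_cone using S.compact_X by (simp add: S.X_def compact_imp_closed)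
  define g where "g p = indicat_real V0 p *\<^sub>R (h p * varpi \<beta> \<gamma> (snd p))" for p :: "'a \<times> real"
  have g [measurable]: "g \<in> borel_measurable borel"
  proof -
    have [measurable]: "(snd :: 'a \<times> real \<Rightarrow> real) \<in> borel_measurable borel"
      by (intro borel_measurable_continuous_onI continuous_intros)
    show ?thesis unfolding g_def varpi_def by measurable
  qed
  have gc [measurable]: "(\<lambda>z. g (cone_map z)) \<in> borel_measurable ?M" by measurable
  have hc [measurable]: "(\<lambda>z. h (cone_map z)) \<in> borel_measurable ?M" by measurable
  interpret SL: pair_sigma_finite "sphere_measure :: 'a measure" "lborel :: real measure" ..
  have AE: "AE z in ?M. fst z \<in> sphere 0 1"
  proof (rule SL.AE_pair_measure)
    have [measurable]: "sphere 0 1 \<in> sets (borel :: 'a measure)" by (simp add: borel_closed)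
    show "{z \<in> space ?M. fst z \<in> sphere 0 1} \<in> sets ?M" by measurable
    show "AE x in sphere_measure. AE y in lborel. fst (x::'a, y::real) \<in> sphere 0 1"
      using S.AE_N by auto
  qed
  have "(LINT p:V0|V0_measure. h p * varpi \<beta> \<gamma> (snd p)) = (\<integral>p. g p \<partial>V0_measure)"
    by (simp add: set_lebesgue_integral_def g_def)
  also have "\<dots> = (\<integral>z. g (cone_map z) \<partial>density ?M (\<lambda>z. ennreal (w1 z)))"
  proof -
    have w: "(\<lambda>(\<xi>::'a, t). ennreal (indicat_real {0..1} t * t powr ((real DIM('a) - 1) / 2)))
        = (\<lambda>z. ennreal (w1 z))"
      by (auto simp: w1_def fun_eq_iff)
    show ?thesis
      unfolding V0_measure_def cone_map_def[symmetric] w by (rule integral_distr) measurable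
  qed
  also have "\<dots> = (\<integral>z. w1 z *\<^sub>R g (cone_map z) \<partial>?M)"
    by (rule integral_density) (auto simp: w1_def)
  also have "\<dots> = (\<integral>z. w2 z *\<^sub>R h (cone_map z) \<partial>?M)"
  proof (rule integral_cong_AE)
    show "AE z in ?M. w1 z *\<^sub>R g (cone_map z) = w2 z *\<^sub>R h (cone_map z)"
      using AE
    proof eventually_elim
      case (elim z)
      obtain \<xi> t where z: "z = (\<xi>, t)" by (cases z)
      show ?case
      proof (cases "t \<in> {0..1}")
        case True
        then have "cone_map z \<in> V0" using elim unfolding V0_eq_cone z by auto
        moreover have "t powr ?c * t powr \<beta> = t powr b" by (simp add: b powr_add[symmetric] add.commute)
        ultimately show ?thesis
          using True by (simp add: w1_def w2_def g_def z varpi_def cone_map_def)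
      qed (simp add: w1_def w2_def z)
    qed
  qed measurable
  also have "\<dots> = (\<integral>z. h (cone_map z) \<partial>density ?M (\<lambda>z. ennreal (w2 z)))"
    by (rule integral_density[symmetric]) (auto simp: w2_def)
  also have "density ?M (\<lambda>z. ennreal (w2 z)) = sphere_measure \<Otimes>\<^sub>M rad_measure b \<gamma>"
  proof -
    have "sigma_finite_measure (rad_measure b \<gamma>)" by unfold_locales
    then show ?thesis
      using pair_measure_density[of "\<lambda>_. 1" "sphere_measure :: 'a measure"
          "\<lambda>t. ennreal (indicat_real {0..1} t * (t powr b * (1 - t) powr \<gamma>))" lborel]
      unfolding rad_measure_def interval_density_def w2_def
      by (simp add: density_1 case_prod_beta' lborel.sigma_finite_measure_axioms)
  qed
  also have "(\<integral>z. h (cone_map z) \<partial>(sphere_measure \<Otimes>\<^sub>M rad_measure b \<gamma>)) = (\<integral>p. h p \<partial>S.P)"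
    unfolding S.P_def by (rule integral_distr[symmetric]) measurable
  finally show ?thesis .
qed

lemma V0_inner_eq_ip:
  fixes f g :: "'a \<times> real \<Rightarrow> real"
  assumes "f \<in> borel_measurable borel" "g \<in> borel_measurable borel"
  shows "V0_inner \<beta> \<gamma> f g = S.ip f g"
proof -
  have "(LINT p:(V0 :: ('a \<times> real) set)|V0_measure. varpi \<beta> \<gamma> (snd p)) = measure S.P UNIV"
    using integral_V0_weight[of "\<lambda>_. 1"] by simp
  then show ?thesis
    using integral_V0_weight[of "\<lambda>x. f x * g x"] assms by (simp add: V0_inner_def V0_const_def S.ip_def)
qed

lemma V0_inner_cong:
  fixes f f' :: "'a \<times> real \<Rightarrow> real"
  assumes "\<And>x. x \<in> V0 \<Longrightarrow> f x = f' x"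
  shows "V0_inner \<beta> \<gamma> f g = V0_inner \<beta> \<gamma> f' g"
proof -
  have "(\<lambda>p. indicat_real V0 p *\<^sub>R (f p * g p * varpi \<beta> \<gamma> (snd p)))
      = (\<lambda>p. indicat_real V0 p *\<^sub>R (f' p * g p * varpi \<beta> \<gamma> (snd p)))"
    using assms by (auto simp: indicator_def fun_eq_iff)
  then show ?thesis by (simp only: V0_inner_def set_lebesgue_integral_def)
qed

lemma poly_inner_V0: "poly_inner (V0 :: ('a \<times> real) set) (V0_inner \<beta> \<gamma>)"
proof (rule S.poly_innerI)
  show "V0_inner \<beta> \<gamma> f g = V0_inner \<beta> \<gamma> g f" for f g :: "'a \<times> real \<Rightarrow> real"
    by (simp add: V0_inner_def mult.commute[of "f _"])
  show "f y = 0" if "\<And>x. x \<in> S.X \<Longrightarrow> f x = 0" "y \<in> V0" for f and y :: "'a \<times> real"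
    using that by (simp add: S.X_def V0_eq_cone)
qed (use V0_inner_eq_ip V0_inner_cong in blast)+

end

section \<open>Radial integration over the unit ball\<close>

lemma integral_lborel_scale:
  fixes f :: "'a::euclidean_space \<Rightarrow> real"
  assumes [measurable]: "f \<in> borel_measurable borel" and c: "c \<noteq> 0"
  shows "(\<integral>x. f x \<partial>lborel) = \<bar>c\<bar> ^ DIM('a) * (\<integral>x. f (c *\<^sub>R x) \<partial>lborel)"
  by (subst lborel_affine[OF c, of 0]) (simp add: integral_density integral_distr)

lemma integral_lborel_translate:
  fixes f :: "'a::euclidean_space \<Rightarrow> real"
  assumes [measurable]: "f \<in> borel_measurable borel"
  shows "(\<integral>x. f (x + e) \<partial>lborel) = (\<integral>x. f x \<partial>lborel)"
  by (subst (2) lborel_distr_plus[symmetric, of e]) (simp add: integral_distr add.commute)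

text \<open>Polar coordinates from scaling alone: \<open>1 - norm x ^ j\<close> is the integral of
  \<open>j * r ^ (j - 1)\<close> over r from \<open>norm x\<close> to 1. After exchanging integrals,
  the ball of radius r contributes \<open>r ^ d\<close> times the unit ball integral J, so
  \<open>j / (d + j) * J\<close> is to be subtracted from J.\<close>

lemma integral_ball_radial:
  fixes f :: "'a::euclidean_space \<Rightarrow> real"
  assumes f: "continuous_on UNIV f"
  shows "(LINT x:cball 0 1|lborel. norm x ^ j * f (sgn x))
       = real DIM('a) / (real DIM('a) + real j) * (LINT x:cball 0 1|lborel. f (sgn x))"
proof -
  have [measurable]: "f \<in> borel_measurable borel" by (rule borel_measurable_continuous_onI[OF f])
  have [measurable]: "(\<lambda>x. f (sgn x)) \<in> borel_measurable borel"
    by (rule measurable_compose[OF borel_measurable_sgn']) measurable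
  have "bounded (f ` cball 0 1)"
    using f by (meson compact_cball compact_continuous_image compact_imp_bounded continuous_on_subset subset_UNIV)
  then obtain B where B: "\<And>x. norm x \<le> 1 \<Longrightarrow> \<bar>f x\<bar> \<le> B" unfolding bounded_iff by fastforce
  then have B': "\<bar>f (sgn x)\<bar> \<le> B" for x by (simp add: norm_sgn)
  define J where "J = (LINT x:cball 0 1|lborel. f (sgn x))"
  define G where "G x r = indicat_real (cball 0 1 \<times> {0..1}) (x, r) * (of_bool (norm x \<le> r) * (real j * r ^ (j - 1)) * f (sgn x))"
    for x :: 'a and r :: real
  have [measurable]: "(\<lambda>p. G (fst p) (snd p)) \<in> borel_measurable (lborel \<Otimes>\<^sub>M lborel)"
  proof -
    have "(\<lambda>p. indicat_real (cball 0 1 \<times> {0..1}) (p :: 'a \<times> real)) \<in> borel_measurable (borel \<Otimes>\<^sub>M borel)"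
      by measurable
    then show ?thesis unfolding G_def by simp
  qed
  have int: "integrable (lborel \<Otimes>\<^sub>M lborel) (\<lambda>(x, r). G x r)"
  proof (rule integrableI_bounded_set[where A = "cball 0 1 \<times> {0..1}" and B = "real j * B"])
    have "emeasure (lborel \<Otimes>\<^sub>M lborel) (cball (0::'a) 1 \<times> {0..1::real})
        = emeasure lborel (cball (0::'a) 1) * emeasure lborel {0..1::real}"
      by (intro lborel.emeasure_pair_measure_Times) auto
    also have "\<dots> < \<infinity>" using emeasure_bounded_finite[of "cball (0::'a) 1"] by simp
    finally show "emeasure (lborel \<Otimes>\<^sub>M lborel) (cball (0::'a) 1 \<times> {0..1::real}) < \<infinity>" .
    show "AE p\<in>cball 0 1 \<times> {0..1} in lborel \<Otimes>\<^sub>M lborel. norm (case p of (x, r) \<Rightarrow> G x r) \<le> real j * B"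
    proof (intro AE_I2 impI)
      fix p :: "'a \<times> real" assume p: "p \<in> cball 0 1 \<times> {0..1}"
      obtain x r where [simp]: "p = (x, r)" by (cases p)
      have "real j * r ^ (j - 1) \<le> real j * 1"
        using p by (intro mult_left_mono power_le_one) auto
      then have "of_bool (norm x \<le> r) * (real j * r ^ (j - 1)) \<le> real j"
        using p by (auto split: split_of_bool)
      then have "of_bool (norm x \<le> r) * (real j * r ^ (j - 1)) * \<bar>f (sgn x)\<bar> \<le> real j * B"
        using p B'[of x] by (intro mult_mono) auto
      then show "norm (case p of (x, r) \<Rightarrow> G x r) \<le> real j * B"
        using p by (simp add: G_def abs_mult)
    qed
  qed (auto simp: case_prod_beta G_def indicator_def)
  have inner_r: "(\<integral>r. G x r \<partial>lborel) = indicat_real (cball 0 1) x * ((1 - norm x ^ j) * f (sgn x))" for x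
  proof (cases "norm x \<le> 1")
    case True
    have eq: "G x r = f (sgn x) * ((real j * r ^ (j - 1)) * indicat_real {norm x..1} r)" for r
      using True order_trans[OF norm_ge_zero, of x r] by (auto simp: G_def indicator_def)
    have "(\<integral>r. (real j * r ^ (j - 1)) * indicat_real {norm x..1} r \<partial>lborel) = 1 ^ j - norm x ^ j"
      using True by (intro integral_FTC_Icc_real) (auto intro!: derivative_eq_intros continuous_intros)
    then show ?thesis using True by (simp add: eq)
  qed (simp add: G_def)
  have inner_x: "(\<integral>x. G x r \<partial>lborel) = J * (real j * r ^ (DIM('a) + j - 1) * indicat_real {0..1} r)" for r
  proof (cases "r \<in> {0<..1}")
    case True
    have "(\<integral>x. G x r \<partial>lborel) = real j * r ^ (j - 1) * (\<integral>x. indicat_real (cball 0 r) x * f (sgn x) \<partial>lborel)"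
    proof -
      have "G x r = real j * r ^ (j - 1) * (indicat_real (cball 0 r) x * f (sgn x))" for x
        using True by (auto simp: G_def indicator_def)
      then show ?thesis by simp
    qed
    also have "(\<integral>x. indicat_real (cball 0 r) x * f (sgn x) \<partial>lborel)
        = \<bar>r\<bar> ^ DIM('a) * (\<integral>x. indicat_real (cball 0 r) (r *\<^sub>R x) * f (sgn (r *\<^sub>R x)) \<partial>lborel)"
    proof (rule integral_lborel_scale)
      have "cball (0::'a) r \<in> sets borel" by simp
      then show "(\<lambda>x. indicat_real (cball (0::'a) r) x * f (sgn x)) \<in> borel_measurable borel"
        by (intro borel_measurable_times borel_measurable_indicator) measurable
    qed (use True in simp)
    also have "(\<integral>x. indicat_real (cball 0 r) (r *\<^sub>R x) * f (sgn (r *\<^sub>R x)) \<partial>lborel) = J"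
      unfolding J_def set_lebesgue_integral_def
      using True by (intro Bochner_Integration.integral_cong) (auto simp: indicator_def sgn_scaleR)
    finally show ?thesis using True
      by (cases j) (auto simp: power_add mult_ac)
  next
    case False
    show ?thesis
    proof (cases "r = 0")
      case True
      have "AE x in lborel. G x r = 0"
        using AE_lborel_singleton[of "0::'a"] by eventually_elim (simp add: G_def True)
      then have "(\<integral>x. G x r \<partial>lborel) = 0" by (intro integral_eq_zero_AE)
      then show ?thesis using True by (cases j) auto
    qed (use False in \<open>auto simp: G_def indicator_def\<close>)
  qed
  have "(\<integral>r. real j * r ^ (DIM('a) + j - 1) * indicat_real {0..1} r \<partial>lborel)
      = real j / (real DIM('a) + real j) * 1 ^ (DIM('a) + j) - real j / (real DIM('a) + real j) * 0 ^ (DIM('a) + j)"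
  proof (intro integral_FTC_Icc_real)
    fix r :: real
    have nz: "real DIM('a) + real j \<noteq> 0" using DIM_positive[where 'a='a] by (metis add_is_0 of_nat_0_eq_iff of_nat_add not_gr_zero)
    show "((\<lambda>r. real j / (real DIM('a) + real j) * r ^ (DIM('a) + j)) has_real_derivative
        real j * r ^ (DIM('a) + j - 1)) (at r)"
      using DERIV_cmult[OF DERIV_pow[of "DIM('a) + j" r], of "real j / (real DIM('a) + real j)"] nz by simp
  qed (auto intro!: continuous_intros)
  then have rad: "(\<integral>r. real j * r ^ (DIM('a) + j - 1) * indicat_real {0..1} r \<partial>lborel) = real j / (real DIM('a) + real j)"
    using DIM_positive[where 'a = 'a] by simp
  have "(\<integral>x. \<integral>r. G x r \<partial>lborel \<partial>lborel) = (\<integral>r. \<integral>x. G x r \<partial>lborel \<partial>lborel)"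
    by (rule lborel_pair.Fubini_integral[OF int, symmetric])
  then have "(\<integral>x. indicat_real (cball 0 1) x * ((1 - norm x ^ j) * f (sgn x)) \<partial>lborel) = J * (real j / (real DIM('a) + real j))"
    unfolding inner_r inner_x integral_mult_right_zero rad .
  moreover have "(\<integral>x. indicat_real (cball 0 1) x * ((1 - norm x ^ j) * f (sgn x)) \<partial>lborel)
      = J - (LINT x:cball 0 1|lborel. norm x ^ j * f (sgn x))"
  proof -
    have bd: "integrable lborel (\<lambda>x. indicat_real (cball 0 1) x * g x)"
      if [measurable]: "g \<in> borel_measurable borel" and "\<And>x. norm x \<le> 1 \<Longrightarrow> \<bar>g x\<bar> \<le> B" for g :: "'a \<Rightarrow> real"
    proof (rule integrableI_bounded_set[where A = "cball 0 1" and B = B])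
      show "emeasure lborel (cball (0::'a) 1) < \<infinity>" by (intro emeasure_bounded_finite) simp
      show "AE x\<in>cball 0 1 in lborel. norm (indicat_real (cball 0 1) x * g x) \<le> B"
        using that(2) by (auto simp: indicator_def)
      have "cball (0::'a) 1 \<in> sets borel" by simp
      then show "(\<lambda>x. indicat_real (cball (0::'a) 1) x * g x) \<in> borel_measurable lborel"
        using that(1) by (simp add: borel_measurable_times borel_measurable_indicator)
    qed auto
    have 1: "\<bar>norm x ^ j * f (sgn x)\<bar> \<le> B" if "norm x \<le> 1" for x
      using mult_mono[of "norm x ^ j" 1 "\<bar>f (sgn x)\<bar>" B] B'[of x] that by (simp add: abs_mult power_le_one)
    have "(\<integral>x. indicat_real (cball 0 1) x * ((1 - norm x ^ j) * f (sgn x)) \<partial>lborel)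
        = (\<integral>x. indicat_real (cball 0 1) x * f (sgn x) - indicat_real (cball 0 1) x * (norm x ^ j * f (sgn x)) \<partial>lborel)"
      by (simp add: algebra_simps)
    also have "\<dots> = J - (LINT x:cball 0 1|lborel. norm x ^ j * f (sgn x))"
      using bd[of "\<lambda>x. f (sgn x)"] bd[of "\<lambda>x. norm x ^ j * f (sgn x)"] B' 1
      by (simp add: J_def set_lebesgue_integral_def Bochner_Integration.integral_diff)
    finally show ?thesis .
  qed
  ultimately have "(LINT x:cball 0 1|lborel. norm x ^ j * f (sgn x)) = J - J * (real j / (real DIM('a) + real j))"
    by simp
  also have "\<dots> = real DIM('a) / (real DIM('a) + real j) * J"
  proof -
    have "J - J * (y / (z + y)) = z / (z + y) * J" if "z + y > 0" for z y :: real
      using that by (simp add: divide_simps) (simp add: algebra_simps)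
    moreover have "real DIM('a) > 0" by simp
    ultimately show ?thesis by (simp add: add_pos_nonneg)
  qed
  finally show ?thesis by (simp add: J_def)
qed


section \<open>Integration of homogeneous polynomials over the sphere\<close>

text \<open>A lists the admissible linear forms: \<open>UNIV\<close> gives all homogeneous
  polynomials, \<open>perp\<close> those in the coordinates orthogonal to \<xi>. The inductive form
  lets derivatives and the splitting of linear forms go by rule induction.\<close>

inductive hom_poly :: "'a::euclidean_space set \<Rightarrow> nat \<Rightarrow> ('a \<Rightarrow> real) \<Rightarrow> bool" for A where
  const: "hom_poly A 0 (\<lambda>_. c)"
| mult: "hom_poly A k f \<Longrightarrow> e \<in> A \<Longrightarrow> hom_poly A (Suc k) (\<lambda>x. (e \<bullet> x) * f x)"
| add: "hom_poly A k f \<Longrightarrow> hom_poly A k g \<Longrightarrow> hom_poly A k (\<lambda>x. f x + g x)"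

lemma hom_poly_cmul:
  "hom_poly A k f \<Longrightarrow> hom_poly A k (\<lambda>x. c * f x)"
proof (induction rule: hom_poly.induct)
  case (mult k f e)
  then show ?case using hom_poly.mult[OF mult(3,2)] by (simp add: mult_ac)
next
  case (add k f g)
  then show ?case using hom_poly.add[OF add(3,4)] by (simp add: distrib_left)
qed (rule hom_poly.const)

lemma hom_poly_scaleR: "hom_poly A k f \<Longrightarrow> f (c *\<^sub>R x) = c ^ k * f x"
  by (induction rule: hom_poly.induct) (simp_all add: algebra_simps)

lemma continuous_on_hom_poly: "hom_poly A k f \<Longrightarrow> continuous_on S f"
  by (induction rule: hom_poly.induct) (auto intro!: continuous_intros)

lemma hom_poly_sgn:
  assumes "hom_poly A k f" shows "f x = norm x ^ k * f (sgn x)"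
proof -
  have "x = norm x *\<^sub>R sgn x" by (cases "x = 0") (simp_all add: sgn_div_norm)
  then show ?thesis using hom_poly_scaleR[OF assms, of "norm x" "sgn x"] by simp
qed

text \<open>In degree 0 the derivative is pinned to the zero function; knowing only that it is
  homogeneous of degree 0 would not do in \<open>sphere_recursion\<close>.\<close>

lemma hom_poly_deriv:
  assumes "hom_poly A k f"
  shows "\<exists>f'. (\<forall>x h. ((\<lambda>h. f (x + h *\<^sub>R e)) has_real_derivative f' (x + h *\<^sub>R e)) (at h)) \<and>
           (case k of 0 \<Rightarrow> f' = (\<lambda>_. 0) | Suc j \<Rightarrow> hom_poly A j f')"
  using assms
proof (induction rule: hom_poly.induct)
  case (const c)
  show ?case by (intro exI[of _ "\<lambda>_. 0"]) simp
next
  case (mult k f a)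
  then obtain f' where f': "\<And>x h. ((\<lambda>h. f (x + h *\<^sub>R e)) has_real_derivative f' (x + h *\<^sub>R e)) (at h)"
    and k: "case k of 0 \<Rightarrow> f' = (\<lambda>_. 0) | Suc j \<Rightarrow> hom_poly A j f'" by blast
  have "((\<lambda>h. (a \<bullet> (x + h *\<^sub>R e)) * f (x + h *\<^sub>R e)) has_real_derivative
      (a \<bullet> e) * f (x + h *\<^sub>R e) + (a \<bullet> (x + h *\<^sub>R e)) * f' (x + h *\<^sub>R e)) (at h)" for x h
  proof -
    have "((\<lambda>h. a \<bullet> x + h * (a \<bullet> e)) has_real_derivative a \<bullet> e) (at h)"
      by (auto intro!: derivative_eq_intros)
    then have "((\<lambda>h. a \<bullet> (x + h *\<^sub>R e)) has_real_derivative a \<bullet> e) (at h)"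
      by (simp add: inner_add_right)
    from DERIV_mult[OF this f'[of x h]] show ?thesis by (simp add: algebra_simps)
  qed
  moreover have "hom_poly A k (\<lambda>x. (a \<bullet> e) * f x + (a \<bullet> x) * f' x)"
  proof (cases k)
    case 0
    then show ?thesis using k hom_poly_cmul[OF mult(1)] by simp
  next
    case (Suc j)
    then have "hom_poly A (Suc j) (\<lambda>x. (a \<bullet> x) * f' x)"
      using k mult(2) by (intro hom_poly.mult) auto
    then show ?thesis
      using hom_poly.add[OF hom_poly_cmul[OF mult(1)]] Suc by blast
  qed
  ultimately show ?case by (intro exI[of _ "\<lambda>x. (a \<bullet> e) * f x + (a \<bullet> x) * f' x"]) simp
next
  case (add k f g)
  then obtain f' g' where der:
    "\<And>x h. ((\<lambda>h. f (x + h *\<^sub>R e)) has_real_derivative f' (x + h *\<^sub>R e)) (at h)"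
    "\<And>x h. ((\<lambda>h. g (x + h *\<^sub>R e)) has_real_derivative g' (x + h *\<^sub>R e)) (at h)"
    and k: "case k of 0 \<Rightarrow> f' = (\<lambda>_. 0) | Suc j \<Rightarrow> hom_poly A j f'"
    "case k of 0 \<Rightarrow> g' = (\<lambda>_. 0) | Suc j \<Rightarrow> hom_poly A j g'" by blast
  have "case k of 0 \<Rightarrow> (\<lambda>x. f' x + g' x) = (\<lambda>_. 0) | Suc j \<Rightarrow> hom_poly A j (\<lambda>x. f' x + g' x)"
    using k by (cases k) (auto intro: hom_poly.add)
  with DERIV_add[OF der] show ?case by (intro exI[of _ "\<lambda>x. f' x + g' x"]) blast
qed

lemma has_real_derivative_pos_part_square:
  "((\<lambda>y. (max 0 y)\<^sup>2) has_real_derivative 2 * max 0 y) (at (y::real))"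
proof -
  consider "y > 0" | "y < 0" | "y = 0" by linarith
  then show ?thesis
  proof cases
    case 1
    have "((\<lambda>y. y\<^sup>2) has_real_derivative 2 * max 0 y) (at y)"
      using 1 by (auto intro!: derivative_eq_intros)
    then show ?thesis
      by (rule has_field_derivative_transform_within_open[where S = "{0<..}"]) (use 1 in auto)
  next
    case 2
    have "((\<lambda>y. 0) has_real_derivative 2 * max 0 y) (at y)"
      using 2 by simp
    then show ?thesis
      by (rule has_field_derivative_transform_within_open[where S = "{..<0}"]) (use 2 in auto)
  next
    case 3
    have "((\<lambda>h. (max 0 h)\<^sup>2 / h) \<longlongrightarrow> 0) (at (0::real))"
    proof (rule Lim_null_comparison)
      show "\<forall>\<^sub>F h in at 0. norm ((max 0 h)\<^sup>2 / h) \<le> \<bar>h::real\<bar>"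
        by (intro always_eventually) (auto simp: max_def power2_eq_square)
      show "((\<lambda>h. \<bar>h::real\<bar>) \<longlongrightarrow> 0) (at 0)" by (auto intro!: tendsto_eq_intros)
    qed
    then show ?thesis using 3 by (simp add: has_field_derivative_iff)
  qed
qed

text \<open>
  Squaring the positive part of \<open>1 - |x|\<^sup>2\<close> makes the cut-off continuously differentiable, so that
  translation invariance of the Lebesgue measure gives the divergence theorem without boundary terms.
\<close>

lemma divergence_ball:
  fixes g g' :: "'a::euclidean_space \<Rightarrow> real"
  assumes g: "continuous_on UNIV g" and g': "continuous_on UNIV g'"
    and der: "\<And>x h. ((\<lambda>h. g (x + h *\<^sub>R e)) has_real_derivative g' (x + h *\<^sub>R e)) (at h)"
  shows "(LINT x:cball 0 1|lborel. (1 - (norm x)\<^sup>2)\<^sup>2 * g' x - 4 * (1 - (norm x)\<^sup>2) * ((e \<bullet> x) * g x)) = 0"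
proof -
  define m where "m x = max 0 (1 - (norm x)\<^sup>2)" for x :: 'a
  define \<Psi> where "\<Psi> x = (m x)\<^sup>2 * g x" for x
  define D where "D x = (m x)\<^sup>2 * g' x - 4 * m x * ((e \<bullet> x) * g x)" for x
  have cont: "continuous_on UNIV \<Psi>" "continuous_on UNIV D"
    unfolding \<Psi>_def D_def m_def using g g' by (intro continuous_intros; auto)+
  have [measurable]: "\<Psi> \<in> borel_measurable borel" "D \<in> borel_measurable borel"
    using cont by (auto intro: borel_measurable_continuous_onI)
  have zero: "m x = 0" if "norm x \<ge> 1" for x using that by (simp add: m_def)
  have der\<Psi>: "((\<lambda>h. \<Psi> (x + h *\<^sub>R e)) has_real_derivative D (x + h *\<^sub>R e)) (at h)" for x h
  proof -
    have "((\<lambda>h. 1 - (x \<bullet> x + 2 * h * (e \<bullet> x) + h * h * (e \<bullet> e))) has_real_derivative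
        - (2 * (e \<bullet> (x + h *\<^sub>R e)))) (at h)"
      by (auto intro!: derivative_eq_intros simp: inner_add_right)
    moreover have "1 - (x \<bullet> x + 2 * h * (e \<bullet> x) + h * h * (e \<bullet> e)) = 1 - (norm (x + h *\<^sub>R e))\<^sup>2" for h
      by (simp add: power2_norm_eq_inner inner_add_left inner_add_right inner_commute algebra_simps)
    ultimately have "((\<lambda>h. 1 - (norm (x + h *\<^sub>R e))\<^sup>2) has_real_derivative - (2 * (e \<bullet> (x + h *\<^sub>R e)))) (at h)"
      by simp
    from DERIV_chain2[OF has_real_derivative_pos_part_square this]
    have "((\<lambda>h. (m (x + h *\<^sub>R e))\<^sup>2) has_real_derivative
        2 * m (x + h *\<^sub>R e) * - (2 * (e \<bullet> (x + h *\<^sub>R e)))) (at h)"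
      by (simp add: m_def)
    from DERIV_mult[OF this der[of x h]] show ?thesis
      unfolding \<Psi>_def D_def by (simp add: algebra_simps)
  qed
  have int\<Psi>: "integrable lborel \<Psi>"
  proof -
    have "integrable lborel (\<lambda>x. indicat_real (cball 0 1) x *\<^sub>R \<Psi> x)"
      by (intro borel_integrable_compact continuous_on_subset[OF cont(1)]) auto
    moreover have "(\<lambda>x. indicat_real (cball 0 1) x *\<^sub>R \<Psi> x) = \<Psi>"
      by (auto simp: fun_eq_iff indicator_def \<Psi>_def zero)
    ultimately show ?thesis by simp
  qed
  have int\<Psi>': "integrable lborel (\<lambda>x. \<Psi> (x + e))"
  proof -
    have "integrable (distr lborel borel ((+) e)) \<Psi>" using int\<Psi> by (simp add: lborel_distr_plus)
    then show ?thesis by (subst (asm) integrable_distr_eq) (auto simp: add.commute)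
  qed
  \<comment> \<open>The directional derivative D of \<Psi> along the segment from x to
    \<open>x + e\<close>.\<close>
  define G where "G x h = indicat_real {0..1} h * D (x + h *\<^sub>R e)" for x h
  have intG: "integrable (lborel \<Otimes>\<^sub>M lborel) (\<lambda>(x, h). G x h)"
  proof -
    let ?K = "cball (0::'a) (1 + norm e) \<times> {0..1::real}"
    have "integrable lborel (\<lambda>p. indicat_real ?K p *\<^sub>R D (fst p + snd p *\<^sub>R e))"
    proof (rule borel_integrable_compact)
      show "continuous_on ?K (\<lambda>p. D (fst p + snd p *\<^sub>R e))"
        by (rule continuous_on_compose2[OF cont(2)]) (auto intro!: continuous_intros)
    qed (auto intro: compact_Times)
    moreover have "indicat_real ?K p *\<^sub>R D (fst p + snd p *\<^sub>R e) = (case p of (x, h) \<Rightarrow> G x h)" for p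
    proof -
      obtain x h where p: "p = (x, h)" by (cases p)
      have "D (x + h *\<^sub>R e) = 0" if "norm x > 1 + norm e" "h \<in> {0..1}"
      proof -
        have "norm (h *\<^sub>R e) \<le> norm e" using that by (simp add: mult_left_le_one_le)
        moreover have "norm x \<le> norm (x + h *\<^sub>R e) + norm (h *\<^sub>R e)"
          using norm_triangle_ineq4[of "x + h *\<^sub>R e" "h *\<^sub>R e"] by simp
        ultimately have "norm (x + h *\<^sub>R e) \<ge> 1" using that by linarith
        then show ?thesis by (simp add: D_def zero)
      qed
      then show ?thesis by (auto simp: p G_def indicator_def not_le)
    qed
    ultimately show ?thesis unfolding lborel_prod by simp
  qed
  \<comment> \<open>Translation invariance makes the total increment 0; written as an integral along
    the segment, with the order of integration exchanged, it becomes the integral of D.\<close>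
  have "0 = (\<integral>x. \<Psi> (x + e) - \<Psi> x \<partial>lborel)"
    using int\<Psi> int\<Psi>' by (simp add: integral_lborel_translate)
  also have "\<dots> = (\<integral>x. \<integral>h. G x h \<partial>lborel \<partial>lborel)"
  proof (rule Bochner_Integration.integral_cong)
    fix x
    have "continuous_on UNIV (\<lambda>h. D (x + h *\<^sub>R e))"
      by (rule continuous_on_compose2[OF cont(2)]) (auto intro!: continuous_intros)
    then have "(\<integral>h. D (x + h *\<^sub>R e) * indicat_real {0..1} h \<partial>lborel) = \<Psi> (x + 1 *\<^sub>R e) - \<Psi> (x + 0 *\<^sub>R e)"
      by (intro integral_FTC_Icc_real der\<Psi>) (auto simp: continuous_on_eq_continuous_at)
    then show "\<Psi> (x + e) - \<Psi> x = (\<integral>h. G x h \<partial>lborel)" by (simp add: G_def mult.commute)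
  qed simp
  also have "\<dots> = (\<integral>h. \<integral>x. G x h \<partial>lborel \<partial>lborel)"
    by (rule lborel_pair.Fubini_integral[OF intG, symmetric])
  also have "\<dots> = (\<integral>h. indicat_real {0..1::real} h * (\<integral>x. D x \<partial>lborel) \<partial>lborel)"
    unfolding G_def by (simp add: integral_lborel_translate)
  also have "\<dots> = (\<integral>x. D x \<partial>lborel)" by simp
  also have "\<dots> = (LINT x:cball 0 1|lborel. (1 - (norm x)\<^sup>2)\<^sup>2 * g' x - 4 * (1 - (norm x)\<^sup>2) * ((e \<bullet> x) * g x))"
    unfolding set_lebesgue_integral_def
  proof (rule Bochner_Integration.integral_cong)
    fix x :: 'a
    show "D x = indicat_real (cball 0 1) x *\<^sub>R ((1 - (norm x)\<^sup>2)\<^sup>2 * g' x - 4 * (1 - (norm x)\<^sup>2) * ((e \<bullet> x) * g x))"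
    proof (cases "norm x \<le> 1")
      case True
      then have "m x = 1 - (norm x)\<^sup>2" by (simp add: m_def power_le_one)
      then show ?thesis using True by (simp add: D_def)
    qed (simp add: D_def zero)
  qed simp
  finally show ?thesis by simp
qed

text \<open>From \<open>divergence_ball\<close>: by \<open>integral_ball_radial\<close> both ball
  integrals become sphere integrals, as \<open>(e \<bullet> x) * f x\<close> has degree k + 1 and f'
  has degree k - 1 (or is 0). The rational radial factors combine to
  \<open>d + k - 1\<close>.\<close>

lemma sphere_recursion:
  fixes f :: "'a::euclidean_space \<Rightarrow> real"
  assumes f: "hom_poly A k f" and f': "case k of 0 \<Rightarrow> f' = (\<lambda>_. 0) | Suc j \<Rightarrow> hom_poly A j f'"
    and der: "\<And>x h. ((\<lambda>h. f (x + h *\<^sub>R e)) has_real_derivative f' (x + h *\<^sub>R e)) (at h)"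
  shows "(real DIM('a) + real k - 1) * (\<integral>\<xi>. (e \<bullet> \<xi>) * f \<xi> \<partial>sphere_measure) = (\<integral>\<xi>. f' \<xi> \<partial>sphere_measure)"
proof -
  let ?d = "real DIM('a)"
  have d: "?d \<ge> 1" using DIM_positive[where 'a = 'a] by linarith
  define \<phi> where "\<phi> x = (e \<bullet> x) * f x" for x
  have f_cont: "continuous_on UNIV f" by (rule continuous_on_hom_poly[OF f])
  have \<phi>: "hom_poly UNIV (Suc k) \<phi>"
  proof -
    have "hom_poly UNIV k f" using f
      by (induction rule: hom_poly.induct) (auto intro: hom_poly.intros)
    then show ?thesis unfolding \<phi>_def[abs_def] by (intro hom_poly.mult) auto
  qed
  have \<phi>_cont: "continuous_on UNIV \<phi>" by (rule continuous_on_hom_poly[OF \<phi>])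
  have f'_cont: "continuous_on UNIV f'"
    using f' by (auto split: nat.splits intro: continuous_on_hom_poly)
  define J where "J g = (LINT x:cball 0 1|lborel. g (sgn x))" for g :: "'a \<Rightarrow> real"
  have int: "set_integrable lborel (cball 0 1) h" if "continuous_on UNIV h" for h :: "'a \<Rightarrow> real"
    unfolding set_integrable_def using that
    by (intro borel_integrable_compact) (auto intro: continuous_on_subset)
  have J\<phi>: "(LINT x:cball 0 1|lborel. (norm x) ^ i * \<phi> x) = ?d / (?d + real (i + Suc k)) * J \<phi>" for i
  proof -
    have "norm x ^ i * \<phi> x = norm x ^ (i + Suc k) * \<phi> (sgn x)" for x
      by (subst hom_poly_sgn[OF \<phi>]) (simp add: power_add)
    then show ?thesis using integral_ball_radial[OF \<phi>_cont, of "i + Suc k"] by (simp add: J_def)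
  qed
  have "(LINT x:cball 0 1|lborel. 4 * (1 - (norm x)\<^sup>2) * \<phi> x)
      = (LINT x:cball 0 1|lborel. 4 * (norm x ^ 0 * \<phi> x) - 4 * (norm x ^ 2 * \<phi> x))"
    by (simp add: algebra_simps)
  also have "\<dots> = 4 * (LINT x:cball 0 1|lborel. norm x ^ 0 * \<phi> x) - 4 * (LINT x:cball 0 1|lborel. norm x ^ 2 * \<phi> x)"
    by (subst set_integral_diff) (auto intro!: int continuous_intros \<phi>_cont)
  finally have I1: "(LINT x:cball 0 1|lborel. 4 * (1 - (norm x)\<^sup>2) * \<phi> x)
      = 4 * (?d / (?d + real (Suc k)) - ?d / (?d + real (Suc k) + 2)) * J \<phi>"
    using J\<phi>[of 0] J\<phi>[of 2] by (simp add: algebra_simps)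
  have I: "(LINT x:cball 0 1|lborel. (1 - (norm x)\<^sup>2)\<^sup>2 * f' x) = (LINT x:cball 0 1|lborel. 4 * (1 - (norm x)\<^sup>2) * \<phi> x)"
    using divergence_ball[OF f_cont f'_cont der]
    by (subst (asm) set_integral_diff) (auto intro!: int continuous_intros f_cont f'_cont simp: \<phi>_def)
  have "(?d + real k - 1) * J \<phi> = J f'"
  proof (cases k)
    case 0
    then have "J f' = 0" using f' by (simp add: J_def)
    moreover have "J \<phi> = 0"
    proof -
      have "4 * (?d / (?d + 1) - ?d / (?d + 1 + 2)) * J \<phi> = 0"
        using I I1 0 f' by simp
      moreover have "?d / (?d + 1) - ?d / (?d + 1 + 2) > 0"
        using d by (simp add: frac_less2)
      ultimately show ?thesis by simp
    qed
    ultimately show ?thesis by simp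
  next
    case (Suc j)
    then have h: "hom_poly A j f'" using f' by simp
    have J': "(LINT x:cball 0 1|lborel. (norm x) ^ i * f' x) = ?d / (?d + real (i + j)) * J f'" for i
    proof -
      have "norm x ^ i * f' x = norm x ^ (i + j) * f' (sgn x)" for x
        by (subst hom_poly_sgn[OF h]) (simp add: power_add)
      then show ?thesis using integral_ball_radial[OF f'_cont, of "i + j"] by (simp add: J_def)
    qed
    have "(LINT x:cball 0 1|lborel. (1 - (norm x)\<^sup>2)\<^sup>2 * f' x)
        = (LINT x:cball 0 1|lborel. (norm x ^ 0 * f' x - 2 * (norm x ^ 2 * f' x)) + norm x ^ 4 * f' x)"
      by (intro set_lebesgue_integral_cong) (auto simp: power2_eq_square power4_eq_xxxx algebra_simps)
    also have "\<dots> = (LINT x:cball 0 1|lborel. norm x ^ 0 * f' x) - 2 * (LINT x:cball 0 1|lborel. norm x ^ 2 * f' x)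
        + (LINT x:cball 0 1|lborel. norm x ^ 4 * f' x)"
      by (subst set_integral_add set_integral_diff; (intro int continuous_intros f'_cont set_integral_diff)?)+ simp
    finally have I2: "(LINT x:cball 0 1|lborel. (1 - (norm x)\<^sup>2)\<^sup>2 * f' x)
        = (?d / (?d + j) - 2 * (?d / (?d + j + 2)) + ?d / (?d + j + 4)) * J f'"
      using J'[of 0] J'[of 2] J'[of 4] by (simp add: algebra_simps)
    \<comment> \<open>\<open>E = d + k - 1\<close>. Both radial combinations are multiples of
      \<open>8 * d / (E * (E + 2) * (E + 4))\<close>, one of them with the extra factor E.\<close>
    define E where "E = ?d + j"
    have E: "E > 0" using d by (simp add: E_def add_pos_nonneg)
    have "(?d / E - 2 * (?d / (E + 2)) + ?d / (E + 4)) = 8 * ?d / (E * (E + 2) * (E + 4))"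
      using E by (simp add: divide_simps) (simp add: algebra_simps)
    moreover have "4 * (?d / (E + 2) - ?d / (E + 4)) = 8 * ?d / (E * (E + 2) * (E + 4)) * E"
      using E by (simp add: divide_simps) (simp add: algebra_simps)
    moreover have "(?d / E - 2 * (?d / (E + 2)) + ?d / (E + 4)) * J f' = 4 * (?d / (E + 2) - ?d / (E + 4)) * J \<phi>"
      using I I1 I2 Suc by (simp add: E_def algebra_simps)
    ultimately have "8 * ?d / (E * (E + 2) * (E + 4)) * J f' = 8 * ?d / (E * (E + 2) * (E + 4)) * (E * J \<phi>)"
      by (simp add: mult.assoc)
    moreover have "8 * ?d / (E * (E + 2) * (E + 4)) \<noteq> 0" using E d by simp
    ultimately have "J f' = E * J \<phi>" using mult_left_cancel by blast
    then show ?thesis using Suc by (simp add: E_def)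
  qed
  moreover have "(\<integral>\<xi>. \<phi> \<xi> \<partial>sphere_measure) = ?d * J \<phi>" "(\<integral>\<xi>. f' \<xi> \<partial>sphere_measure) = ?d * J f'"
    unfolding J_def by (intro integral_sphere_measure borel_measurable_continuous_onI \<phi>_cont f'_cont)+
  ultimately show ?thesis by (simp add: \<phi>_def mult_ac)
qed

section \<open>Normalised means and homogenised Gegenbauer polynomials\<close>

definition mean :: "'a measure \<Rightarrow> ('a \<Rightarrow> real) \<Rightarrow> real" where
  "mean M f = (\<integral>x. f x \<partial>M) / measure M UNIV"

lemma mean_lincomb:
  assumes "integrable M f" "integrable M g"
  shows "mean M (\<lambda>x. a * f x + b * g x) = a * mean M f + b * mean M g"
  using assms by (simp add: mean_def add_divide_distrib)

lemma (in cone_measure) mean_N_lincomb: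
  "continuous_on UNIV f \<Longrightarrow> continuous_on UNIV g \<Longrightarrow>
     mean N (\<lambda>x. a * f x + b * g x) = a * mean N f + b * mean N g"
  by (intro mean_lincomb integrable_N)

lemma (in cone_measure) mean_N_cmul:
  "continuous_on UNIV f \<Longrightarrow> mean N (\<lambda>x. a * f x) = a * mean N f"
  using mean_N_lincomb[of f f a 0] by simp

lemma (in cone_measure) mean_N_sum:
  assumes "finite I" "\<And>i. i \<in> I \<Longrightarrow> continuous_on UNIV (f i)"
  shows "mean N (\<lambda>x. \<Sum>i\<in>I. c i * f i x) = (\<Sum>i\<in>I. c i * mean N (f i))"
  using assms integrable_N
  by (simp add: mean_def sum_divide_distrib Bochner_Integration.integral_sum)

lemma (in cone_measure) linear_cont_mean:
  "continuous_on UNIV h \<Longrightarrow> linear_cont (\<lambda>\<phi>. mean N (\<lambda>x. \<phi> (h x)))"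
  unfolding linear_cont_def
  by (intro allI impI mean_N_lincomb; rule continuous_on_compose2[where f = h]) auto

text \<open>The variable s stands for \<open>(norm x)\<^sup>2\<close> and has weight two. So
  \<open>hgeg l m u s\<close> is a polynomial on the parabolic domain with radial part
  \<open>sqrt s ^ m\<close> and the Gegenbauer polynomial as angular part.\<close>

lemma hgeg_homogeneous: "s \<ge> 0 \<Longrightarrow> hgeg l m (sqrt s * v) s = sqrt s ^ m * hgeg l m v 1"
proof (induction l m v "1::real" rule: hgeg.induct)
  case (3 l m u)
  define r where "r = sqrt s"
  have s: "s = r * r" using 3 by (simp add: r_def)
  have "hgeg l (Suc (Suc m)) (r * u) s = (2 * (real m + 1 + l) * (r * u) * (r ^ Suc m * hgeg l (Suc m) u 1)
      - (real m + 1) * s * (r ^ m * hgeg l m u 1)) / (real m + 1 + 2 * l)"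
    using 3 by (simp add: r_def)
  also have "\<dots> = r ^ Suc (Suc m) * hgeg l (Suc (Suc m)) u 1"
    unfolding s by (simp add: algebra_simps)
  finally show ?case by (simp add: r_def)
qed simp_all

text \<open>The coefficients satisfy \<open>2 * (m + 1 + l) - (m + 1) = m + 1 + 2 * l\<close>. As
  the value is independent of l, changing the parameter preserves the value at the pole, as the
  adjoint must.\<close>

lemma hgeg_one: "l \<ge> 0 \<Longrightarrow> hgeg l m 1 1 = 1"
proof (induction l m "1::real" "1::real" rule: hgeg.induct)
  case (3 l m)
  then have "real m + 1 + 2 * l > 0" by simp
  then show ?case using 3 by (simp add: field_simps)
qed simp_all

lemma hgeg_polys_upto: "(\<lambda>p. hgeg l m (fst p) (snd p)) \<in> polys_upto m"
proof (induction m rule: less_induct)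
  case (less m)
  consider "m = 0" | "m = 1" | j where "m = Suc (Suc j)" by (metis One_nat_def not0_implies_Suc)
  then show ?case
  proof cases
    case 1
    then show ?thesis by (simp add: polys_upto_const)
  next
    case 2
    then show ?thesis using polys_upto_fst by simp
  next
    case (3 j)
    have "(\<lambda>p. fst p * hgeg l (Suc j) (fst p) (snd p)) \<in> polys_upto m"
      using polys_upto_mult[OF polys_upto_fst less.IH[of "Suc j"]] 3 by simp
    moreover have "(\<lambda>p. snd p * hgeg l j (fst p) (snd p)) \<in> polys_upto m"
      using polys_upto_mono[OF polys_upto_mult[OF polys_upto_snd less.IH[of j]], of m] 3 by simp
    ultimately have "(\<lambda>p. 2 * (real j + 1 + l) / (real j + 1 + 2 * l) * (fst p * hgeg l (Suc j) (fst p) (snd p))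
        + - ((real j + 1) / (real j + 1 + 2 * l)) * (snd p * hgeg l j (fst p) (snd p))) \<in> polys_upto m"
      by (rule polys_upto_lincomb)
    then show ?thesis unfolding 3 hgeg.simps by (simp add: diff_divide_distrib mult.assoc)
  qed
qed

text \<open>\<xi> is the direction of the first kernel argument and \<sigma> stands for
  \<open>\<beta> + 1/2\<close>; admitting \<sigma> = 0 lets the limiting case share all lemmas.
  \<mu> and \<open>\<mu> + \<sigma>\<close> are the Gegenbauer parameters on the sphere and on the
  parabolic domain.\<close>

locale zonal =
  fixes \<xi> :: "'a::euclidean_space" and \<sigma> \<mu> :: real
  assumes \<mu>_def: "\<mu> = (real DIM('a) - 2) / 2" and norm_\<xi>: "norm \<xi> = 1" and dim: "DIM('a) \<ge> 2" and \<sigma>: "\<sigma> \<ge> 0"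
begin

abbreviation smean :: "('a \<Rightarrow> real) \<Rightarrow> real" where "smean \<equiv> mean sphere_measure"
abbreviation gmean :: "(real \<Rightarrow> real) \<Rightarrow> real" where "gmean \<equiv> mean (geg_measure (\<mu> + \<sigma>))"

sublocale S: cone_measure "sphere_measure :: 'a measure" "rad_measure 0 0" "sphere 0 1"
  by (rule cone_measure_sphere) auto

lemma \<mu>_nonneg: "\<mu> \<ge> 0" using dim by (simp add: \<mu>_def)

sublocale G: cone_measure "geg_measure (\<mu> + \<sigma>)" "rad_measure 0 0" "{-1..1}"
  by (rule cone_measure_gegenbauer) (use \<mu>_nonneg \<sigma> in auto)

lemma \<xi>_inner_\<xi> [simp]: "\<xi> \<bullet> \<xi> = 1" using norm_\<xi> by (simp add: norm_eq_1)

lemma gmean_moments: "gmean (\<lambda>v. v ^ k) = gmoment (\<mu> + \<sigma>) 0 k"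
  unfolding mean_def by (rule geg_measure_moments) (use \<mu>_nonneg \<sigma> in simp)

lemma gmean_hgeg: "gmean (\<lambda>v. hgeg (\<mu> + \<sigma>) m v 1 * v ^ k) = gmoment (\<mu> + \<sigma>) m k"
  using hgeg_moments[OF G.linear_cont_mean[of "\<lambda>v. v"] gmean_moments] \<mu>_nonneg \<sigma>
  by (simp add: continuous_on_id)

lemma smean_recursion:
  assumes f: "hom_poly A k f" and f': "case k of 0 \<Rightarrow> f' = (\<lambda>_. 0) | Suc j \<Rightarrow> hom_poly A j f'"
    and der: "\<And>x h. ((\<lambda>h. f (x + h *\<^sub>R e)) has_real_derivative f' (x + h *\<^sub>R e)) (at h)"
  shows "(real DIM('a) + real k - 1) * smean (\<lambda>x. (e \<bullet> x) * f x) = smean f'"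
  using sphere_recursion[OF f f' der] by (simp add: mean_def)

lemma homogeneous_power: "hom_poly {\<xi>} k (\<lambda>x. (\<xi> \<bullet> x) ^ k)"
  by (induction k) (auto intro: hom_poly.intros hom_poly.const[of _ 1])

lemma smean_rec:
  "smean (\<lambda>x. (\<xi> \<bullet> x) ^ 1) = 0"
  "(real k + real DIM('a)) * smean (\<lambda>x. (\<xi> \<bullet> x) ^ (k + 2)) = (real k + 1) * smean (\<lambda>x. (\<xi> \<bullet> x) ^ k)"
proof -
  have der: "((\<lambda>h. (\<xi> \<bullet> (x + h *\<^sub>R \<xi>)) ^ j) has_real_derivative real j * (\<xi> \<bullet> (x + h *\<^sub>R \<xi>)) ^ (j - 1)) (at h)"
    for x h j
    by (auto intro!: derivative_eq_intros simp: inner_add_right)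
  have "(real DIM('a) + real 0 - 1) * smean (\<lambda>x. (\<xi> \<bullet> x) * 1) = smean (\<lambda>_. 0)"
    by (rule smean_recursion[of "{\<xi>}"]) (use hom_poly.const in auto)
  moreover have "smean (\<lambda>_. 0) = 0" by (simp add: mean_def)
  ultimately show "smean (\<lambda>x. (\<xi> \<bullet> x) ^ 1) = 0" using dim by simp
  have "(real DIM('a) + real (Suc k) - 1) * smean (\<lambda>x. (\<xi> \<bullet> x) * (\<xi> \<bullet> x) ^ Suc k)
      = smean (\<lambda>x. real (Suc k) * (\<xi> \<bullet> x) ^ k)"
    using der[where j = "Suc k"]
    by (intro smean_recursion[OF homogeneous_power]) (auto intro: hom_poly_cmul homogeneous_power simp del: of_nat_Suc power_Suc)
  also have "\<dots> = real (Suc k) * smean (\<lambda>x. (\<xi> \<bullet> x) ^ k)"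
    by (intro S.mean_N_cmul continuous_intros)
  finally show "(real k + real DIM('a)) * smean (\<lambda>x. (\<xi> \<bullet> x) ^ (k + 2)) = (real k + 1) * smean (\<lambda>x. (\<xi> \<bullet> x) ^ k)"
    by (simp add: add_ac)
qed

text \<open>Since \<open>2 * \<mu> + 2\<close> is the dimension, \<open>smean_rec\<close> is the
  recursion of \<open>moments_unique\<close>: projected to the axis \<xi>, the sphere has the
  moments of the Gegenbauer weight with parameter \<mu>.\<close>

lemma smean_moments: "smean (\<lambda>x. (\<xi> \<bullet> x) ^ k) = gmoment \<mu> 0 k"
proof (rule moments_unique[OF \<mu>_nonneg])
  have "measure (sphere_measure :: 'a measure) UNIV > 0" by (rule S.measure_N_T_pos)
  then show "smean (\<lambda>x. (\<xi> \<bullet> x) ^ 0) = 1" by (simp add: mean_def)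
  show "(real k + 2 * \<mu> + 2) * smean (\<lambda>x. (\<xi> \<bullet> x) ^ (k + 2)) = (real k + 1) * smean (\<lambda>x. (\<xi> \<bullet> x) ^ k)" for k
  proof -
    have "real k + 2 * \<mu> + 2 = real k + real DIM('a)" by (simp add: \<mu>_def diff_divide_distrib)
    then show ?thesis using smean_rec(2)[of k] by (simp only:)
  qed
qed (rule smean_rec)

lemma smean_hgeg_trans:
  "smean (\<lambda>x. hgeg \<mu> m (\<xi> \<bullet> x) 1 * geg_trans \<mu> \<sigma> k (\<xi> \<bullet> x)) = gmoment (\<mu> + \<sigma>) m k"
  using geg_trans_moments[OF S.linear_cont_mean[of "\<lambda>x. \<xi> \<bullet> x"] smean_moments \<mu>_nonneg \<sigma>]
  by (simp add: continuous_intros)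

text \<open>Expanding one factor gives \<open>W (Suc p) k = W p k - W p (k + 2)\<close>, and a
  recursion in k, proved by induction on p, eliminates the last term. The form is chosen to match
  the recursion in \<open>smean_perp\<close>.\<close>

lemma smean_one_minus_square:
  defines "W \<equiv> \<lambda>p k. smean (\<lambda>x. (\<xi> \<bullet> x) ^ k * (1 - (\<xi> \<bullet> x)\<^sup>2) ^ p)"
  shows "(real k + real DIM('a) + 2 * real p) * W (Suc p) k = (real DIM('a) - 1 + 2 * real p) * W p k"
proof -
  have split: "W (Suc p) k = W p k - W p (k + 2)" for p k
  proof -
    have "W (Suc p) k = smean (\<lambda>x. 1 * ((\<xi> \<bullet> x) ^ k * (1 - (\<xi> \<bullet> x)\<^sup>2) ^ p)
        + (-1) * ((\<xi> \<bullet> x) ^ (k + 2) * (1 - (\<xi> \<bullet> x)\<^sup>2) ^ p))"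
      unfolding W_def by (intro arg_cong[of _ _ smean]) (auto simp: fun_eq_iff algebra_simps power2_eq_square)
    also have "\<dots> = 1 * W p k + (-1) * W p (k + 2)"
      unfolding W_def by (intro S.mean_N_lincomb continuous_intros)
    finally show ?thesis by simp
  qed
  have rec: "(real k + real DIM('a) + 2 * real p) * W p (k + 2) = (real k + 1) * W p k" for k p
  proof (induction p arbitrary: k)
    case 0
    then show ?case using smean_rec(2)[of k] by (simp add: W_def)
  next
    case (Suc p)
    let ?c = "real k + real DIM('a) + 2 * real p"
    have "?c > 0" using dim by simp
    have 1: "?c * W (Suc p) k = (real DIM('a) - 1 + 2 * real p) * W p k"
      unfolding split right_diff_distrib Suc by (simp add: algebra_simps)
    have 2: "(?c + 2) * W (Suc p) (k + 2) = (real DIM('a) - 1 + 2 * real p) * W p (k + 2)"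
    proof -
      have "(real (k + 2) + real DIM('a) + 2 * real p) * W (Suc p) (k + 2) = (real DIM('a) - 1 + 2 * real p) * W p (k + 2)"
        unfolding split right_diff_distrib Suc by (simp add: algebra_simps)
      then show ?thesis by (simp add: algebra_simps)
    qed
    have "?c * ((?c + 2) * W (Suc p) (k + 2)) = (real DIM('a) - 1 + 2 * real p) * (?c * W p (k + 2))"
      unfolding 2 by simp
    also have "\<dots> = ?c * ((real k + 1) * W (Suc p) k)"
      unfolding Suc[of k] mult.left_commute[of ?c] 1 by simp
    finally have "(?c + 2) * W (Suc p) (k + 2) = (real k + 1) * W (Suc p) k"
      using \<open>?c > 0\<close> by (simp only: mult_left_cancel[OF less_imp_neq[THEN not_sym]])
    then show ?case by (simp add: algebra_simps)
  qed
  show ?thesis unfolding split right_diff_distrib rec by (simp add: algebra_simps)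
qed

definition perp :: "'a set" where "perp = {e. e \<bullet> \<xi> = 0}"

lemma homogeneous_perp_at_\<xi>: "hom_poly perp k q \<Longrightarrow> k > 0 \<Longrightarrow> q \<xi> = 0"
  by (induction rule: hom_poly.induct) (auto simp: perp_def)

lemma hom_poly_mono: "hom_poly A k f \<Longrightarrow> A \<subseteq> B \<Longrightarrow> hom_poly B k f"
  by (induction rule: hom_poly.induct) (auto intro: hom_poly.intros)

lemma hom_poly_power_mult:
  "hom_poly UNIV m q \<Longrightarrow> hom_poly UNIV (k + m) (\<lambda>x. (\<xi> \<bullet> x) ^ k * q x)"
proof (induction k)
  case (Suc k)
  then show ?case using hom_poly.mult[of UNIV "k + m" "\<lambda>x. (\<xi> \<bullet> x) ^ k * q x" \<xi>]
    by (simp add: mult.assoc)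
qed simp

text \<open>Averaging q over the rotations about \<xi> would give
  \<open>\<kappa> * (1 - (\<xi> \<bullet> x)\<^sup>2) ^ (l div 2)\<close> on the sphere, or 0 for
  odd l. Here this is proved weakly, against powers of \<open>\<xi> \<bullet> x\<close>, by
  differentiating along directions orthogonal to \<xi>; the point is that \<kappa> does not depend
  on k.\<close>

lemma smean_perp:
  assumes "hom_poly perp l q"
  shows "\<exists>\<kappa>. (\<forall>k. smean (\<lambda>x. (\<xi> \<bullet> x) ^ k * q x)
              = \<kappa> * smean (\<lambda>x. (\<xi> \<bullet> x) ^ k * (1 - (\<xi> \<bullet> x)\<^sup>2) ^ (l div 2))) \<and>
           (odd l \<longrightarrow> \<kappa> = 0) \<and> (l = 0 \<longrightarrow> q = (\<lambda>_. \<kappa>))"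
  using assms
proof (induction l arbitrary: q rule: less_induct)
  case (less l)
  from less.prems less.IH show ?case
  proof (induction rule: hom_poly.induct)
    case (const c)
    have "smean (\<lambda>x. (\<xi> \<bullet> x) ^ k * c) = c * smean (\<lambda>x. (\<xi> \<bullet> x) ^ k)" for k
      using S.mean_N_cmul[of "\<lambda>x. (\<xi> \<bullet> x) ^ k" c] by (simp add: mult.commute continuous_intros)
    then show ?case by (intro exI[of _ c]) simp
  next
    case (mult m q e)
    \<comment> \<open>Differentiation along e leaves \<open>(\<xi> \<bullet> x) ^ k\<close> alone,
      so the recursion passes to the derivative of q with the same k.\<close>
    have e: "\<xi> \<bullet> e = 0" using mult by (simp add: perp_def inner_commute)
    obtain q' where q': "\<And>x h. ((\<lambda>h. q (x + h *\<^sub>R e)) has_real_derivative q' (x + h *\<^sub>R e)) (at h)"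
      and m: "case m of 0 \<Rightarrow> q' = (\<lambda>_. 0) | Suc j \<Rightarrow> hom_poly perp j q'"
      using hom_poly_deriv[OF mult(1)] by blast
    have qU: "hom_poly UNIV m q" using hom_poly_mono[OF mult(1)] by simp
    have rec: "(real DIM('a) + real (k + m) - 1) * smean (\<lambda>x. (\<xi> \<bullet> x) ^ k * ((e \<bullet> x) * q x))
        = smean (\<lambda>x. (\<xi> \<bullet> x) ^ k * q' x)" for k
    proof -
      define f where "f x = (\<xi> \<bullet> x) ^ k * q x" for x
      have f: "hom_poly UNIV (k + m) f"
        unfolding f_def[abs_def] by (rule hom_poly_power_mult[OF qU])
      have der: "((\<lambda>h. f (x + h *\<^sub>R e)) has_real_derivative (\<xi> \<bullet> (x + h *\<^sub>R e)) ^ k * q' (x + h *\<^sub>R e)) (at h)" for x h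
        using DERIV_cmult[OF q'[of x h], of "(\<xi> \<bullet> x) ^ k"] by (simp add: f_def inner_add_right e)
      have "case k + m of 0 \<Rightarrow> (\<lambda>x. (\<xi> \<bullet> x) ^ k * q' x) = (\<lambda>_. 0)
          | Suc j \<Rightarrow> hom_poly UNIV j (\<lambda>x. (\<xi> \<bullet> x) ^ k * q' x)"
      proof (cases m)
        case 0
        then have "q' = (\<lambda>_. 0)" using m by simp
        then show ?thesis using hom_poly_cmul[OF hom_poly_mono[OF homogeneous_power subset_UNIV], where c = 0]
          by (simp split: nat.splits)
      next
        case (Suc j)
        then have "hom_poly UNIV j q'" using m hom_poly_mono[of perp j q' UNIV] by simp
        then show ?thesis using hom_poly_power_mult Suc by simp
      qed
      from smean_recursion[OF f this der] show ?thesis by (simp add: f_def mult_ac)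
    qed
    show ?case
    proof (cases m)
      case 0
      have "smean (\<lambda>x. (\<xi> \<bullet> x) ^ k * ((e \<bullet> x) * q x)) = 0" for k
      proof -
        have "smean (\<lambda>x. (\<xi> \<bullet> x) ^ k * q' x) = 0" using 0 m by (simp add: mean_def)
        then show ?thesis using rec[of k] 0 dim by simp
      qed
      then show ?thesis using 0 by (intro exI[of _ 0]) simp
    next
      case (Suc j)
      then have "hom_poly perp j q'" using m by simp
      then obtain \<kappa> where \<kappa>: "\<And>k. smean (\<lambda>x. (\<xi> \<bullet> x) ^ k * q' x)
          = \<kappa> * smean (\<lambda>x. (\<xi> \<bullet> x) ^ k * (1 - (\<xi> \<bullet> x)\<^sup>2) ^ (j div 2))" "odd j \<Longrightarrow> \<kappa> = 0"
        using mult.prems[of j q'] Suc by auto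
      show ?thesis
      proof (cases "odd j")
        case True
        then have "smean (\<lambda>x. (\<xi> \<bullet> x) ^ k * ((e \<bullet> x) * q x)) = 0" for k
          using rec[of k] \<kappa> Suc dim by simp
        then show ?thesis using True Suc by (intro exI[of _ 0]) simp
      next
        case False
        then obtain p where j: "j = 2 * p" unfolding dvd_def by blast
        let ?W = "\<lambda>p k. smean (\<lambda>x. (\<xi> \<bullet> x) ^ k * (1 - (\<xi> \<bullet> x)\<^sup>2) ^ p)"
        \<comment> \<open>By \<open>smean_one_minus_square\<close> the k-dependent factor D stands
          on both sides and cancels; c is free of k, so \<open>\<kappa> / c\<close> can be the new
          constant.\<close>
        define c where "c = real DIM('a) - 1 + 2 * real p"
        have c: "c > 0" using dim by (simp add: c_def)
        have "smean (\<lambda>x. (\<xi> \<bullet> x) ^ k * ((e \<bullet> x) * q x)) = \<kappa> / c * ?W (Suc p) k" for k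
        proof -
          define D where "D = real k + real DIM('a) + 2 * real p"
          have D: "D > 0" using dim by (simp add: D_def)
          have "D * smean (\<lambda>x. (\<xi> \<bullet> x) ^ k * ((e \<bullet> x) * q x)) = \<kappa> * ?W p k"
            using rec[of k] \<kappa>(1)[of k] Suc j by (simp add: D_def algebra_simps)
          also have "c * \<dots> = \<kappa> * (D * ?W (Suc p) k)"
            using smean_one_minus_square[of k p] by (simp add: c_def D_def)
          finally have "D * (c * smean (\<lambda>x. (\<xi> \<bullet> x) ^ k * ((e \<bullet> x) * q x))) = D * (\<kappa> * ?W (Suc p) k)"
            by (simp only: mult_ac)
          then have "c * smean (\<lambda>x. (\<xi> \<bullet> x) ^ k * ((e \<bullet> x) * q x)) = \<kappa> * ?W (Suc p) k"
            using D by (simp only: mult_left_cancel[OF less_imp_neq[THEN not_sym]])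
          then show ?thesis using c by (simp add: field_simps)
        qed
        then show ?thesis using Suc j by (intro exI[of _ "\<kappa> / c"]) simp
      qed
    qed
  next
    case (add l f g)
    obtain \<kappa>1 where \<kappa>1: "\<And>k. smean (\<lambda>x. (\<xi> \<bullet> x) ^ k * f x)
              = \<kappa>1 * smean (\<lambda>x. (\<xi> \<bullet> x) ^ k * (1 - (\<xi> \<bullet> x)\<^sup>2) ^ (l div 2))"
          "odd l \<longrightarrow> \<kappa>1 = 0" "l = 0 \<longrightarrow> f = (\<lambda>_. \<kappa>1)"
      using add.IH(1)[OF add.prems] by blast
    obtain \<kappa>2 where \<kappa>2: "\<And>k. smean (\<lambda>x. (\<xi> \<bullet> x) ^ k * g x)
              = \<kappa>2 * smean (\<lambda>x. (\<xi> \<bullet> x) ^ k * (1 - (\<xi> \<bullet> x)\<^sup>2) ^ (l div 2))"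
          "odd l \<longrightarrow> \<kappa>2 = 0" "l = 0 \<longrightarrow> g = (\<lambda>_. \<kappa>2)"
      using add.IH(2)[OF add.prems] by blast
    have "smean (\<lambda>x. (\<xi> \<bullet> x) ^ k * (f x + g x)) = (\<kappa>1 + \<kappa>2) * smean (\<lambda>x. (\<xi> \<bullet> x) ^ k * (1 - (\<xi> \<bullet> x)\<^sup>2) ^ (l div 2))" for k
    proof -
      have "smean (\<lambda>x. 1 * ((\<xi> \<bullet> x) ^ k * f x) + 1 * ((\<xi> \<bullet> x) ^ k * g x))
          = 1 * smean (\<lambda>x. (\<xi> \<bullet> x) ^ k * f x) + 1 * smean (\<lambda>x. (\<xi> \<bullet> x) ^ k * g x)"
        by (intro S.mean_N_lincomb continuous_intros continuous_on_hom_poly[OF add(1)]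
            continuous_on_hom_poly[OF add(2)])
      then show ?thesis using \<kappa>1(1)[of k] \<kappa>2(1)[of k] by (simp add: distrib_left distrib_right)
    qed
    then show ?case using \<kappa>1(2,3) \<kappa>2(2,3) by (intro exI[of _ "\<kappa>1 + \<kappa>2"]) auto
  qed
qed

end


section \<open>The adjoint of the Gegenbauer transform\<close>

context zonal
begin

text \<open>
  \<open>\<rho>\<close> is the polynomial on the parabolic domain corresponding to the homogeneous polynomial \<open>f\<close> of degree
  \<open>k\<close> under the adjoint, and \<open>\<psi>\<close> is its angular part.
\<close>

definition adj_on :: "nat \<Rightarrow> ('a \<Rightarrow> real) \<Rightarrow> bool" where
  "adj_on k f \<longleftrightarrow> continuous_on UNIV f \<and>
     (\<exists>\<rho>\<in>polys_upto k. \<exists>\<psi>. continuous_on UNIV \<psi> \<and>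
        (\<forall>s\<ge>0. \<forall>v. \<rho> (sqrt s * v, s) = sqrt s ^ k * \<psi> v) \<and> \<psi> 1 = f \<xi> \<and>
        (\<forall>i. smean (\<lambda>x. f x * geg_trans \<mu> \<sigma> i (\<xi> \<bullet> x)) = gmean (\<lambda>v. \<psi> v * v ^ i)))"

lemma adj_onI:
  assumes "continuous_on UNIV f" "\<rho> \<in> polys_upto k" "continuous_on UNIV \<psi>"
    "\<And>s v. s \<ge> 0 \<Longrightarrow> \<rho> (sqrt s * v, s) = sqrt s ^ k * \<psi> v" "\<psi> 1 = f \<xi>"
    "\<And>i. smean (\<lambda>x. f x * geg_trans \<mu> \<sigma> i (\<xi> \<bullet> x)) = gmean (\<lambda>v. \<psi> v * v ^ i)"
  shows "adj_on k f"
  unfolding adj_on_def using assms by blast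

lemma adj_onE:
  assumes "adj_on k f"
  obtains \<rho> \<psi> where "continuous_on UNIV f" "\<rho> \<in> polys_upto k" "continuous_on UNIV \<psi>"
    "\<And>s v. s \<ge> 0 \<Longrightarrow> \<rho> (sqrt s * v, s) = sqrt s ^ k * \<psi> v" "\<psi> 1 = f \<xi>"
    "\<And>i. smean (\<lambda>x. f x * geg_trans \<mu> \<sigma> i (\<xi> \<bullet> x)) = gmean (\<lambda>v. \<psi> v * v ^ i)"
  using assms unfolding adj_on_def by blast

lemma adj_on_lincomb:
  assumes "adj_on k f" "adj_on k g"
  shows "adj_on k (\<lambda>x. a * f x + b * g x)"
proof -
  obtain \<rho>1 \<psi>1 where 1: "continuous_on UNIV f" "\<rho>1 \<in> polys_upto k" "continuous_on UNIV \<psi>1"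
    "\<And>s v. s \<ge> 0 \<Longrightarrow> \<rho>1 (sqrt s * v, s) = sqrt s ^ k * \<psi>1 v" "\<psi>1 1 = f \<xi>"
    "\<And>i. smean (\<lambda>x. f x * geg_trans \<mu> \<sigma> i (\<xi> \<bullet> x)) = gmean (\<lambda>v. \<psi>1 v * v ^ i)"
    using assms(1) by (rule adj_onE) (rule that; assumption)
  obtain \<rho>2 \<psi>2 where 2: "continuous_on UNIV g" "\<rho>2 \<in> polys_upto k" "continuous_on UNIV \<psi>2"
    "\<And>s v. s \<ge> 0 \<Longrightarrow> \<rho>2 (sqrt s * v, s) = sqrt s ^ k * \<psi>2 v" "\<psi>2 1 = g \<xi>"
    "\<And>i. smean (\<lambda>x. g x * geg_trans \<mu> \<sigma> i (\<xi> \<bullet> x)) = gmean (\<lambda>v. \<psi>2 v * v ^ i)"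
    using assms(2) by (rule adj_onE) (rule that; assumption)
  show ?thesis
  proof (rule adj_onI[where \<rho> = "\<lambda>p. a * \<rho>1 p + b * \<rho>2 p" and \<psi> = "\<lambda>v. a * \<psi>1 v + b * \<psi>2 v"])
    fix i
    have "smean (\<lambda>x. (a * f x + b * g x) * geg_trans \<mu> \<sigma> i (\<xi> \<bullet> x))
        = smean (\<lambda>x. a * (f x * geg_trans \<mu> \<sigma> i (\<xi> \<bullet> x)) + b * (g x * geg_trans \<mu> \<sigma> i (\<xi> \<bullet> x)))"
      by (simp add: algebra_simps)
    also have "\<dots> = a * smean (\<lambda>x. f x * geg_trans \<mu> \<sigma> i (\<xi> \<bullet> x)) + b * smean (\<lambda>x. g x * geg_trans \<mu> \<sigma> i (\<xi> \<bullet> x))"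
      by (intro S.mean_N_lincomb continuous_intros 1 2)
    also have "\<dots> = gmean (\<lambda>v. a * (\<psi>1 v * v ^ i) + b * (\<psi>2 v * v ^ i))"
      unfolding 1(6) 2(6) by (intro G.mean_N_lincomb[symmetric] continuous_intros 1 2)
    finally show "smean (\<lambda>x. (a * f x + b * g x) * geg_trans \<mu> \<sigma> i (\<xi> \<bullet> x)) = gmean (\<lambda>v. (a * \<psi>1 v + b * \<psi>2 v) * v ^ i)"
      by (simp add: algebra_simps)
  qed (use 1(4,5) 2(4,5) in \<open>auto intro!: continuous_intros polys_upto_lincomb 1 2 simp: algebra_simps\<close>)
qed

text \<open>On the sphere f may equally count as having degree k + 2; on the parabolic domain this
  costs a factor s, whose degree 1 is within the two degrees gained.\<close>

lemma adj_on_shift: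
  assumes "adj_on k f" shows "adj_on (k + 2) f"
proof -
  obtain \<rho> \<psi> where 1: "continuous_on UNIV f" "\<rho> \<in> polys_upto k" "continuous_on UNIV \<psi>"
    "\<And>s v. s \<ge> 0 \<Longrightarrow> \<rho> (sqrt s * v, s) = sqrt s ^ k * \<psi> v" "\<psi> 1 = f \<xi>"
    "\<And>i. smean (\<lambda>x. f x * geg_trans \<mu> \<sigma> i (\<xi> \<bullet> x)) = gmean (\<lambda>v. \<psi> v * v ^ i)"
    using assms by (rule adj_onE) (rule that; assumption)
  show ?thesis
  proof (rule adj_onI[where \<rho> = "\<lambda>p. \<rho> p * snd p" and \<psi> = \<psi>])
    show "(\<lambda>p. \<rho> p * snd p) \<in> polys_upto (k + 2)"
      using polys_upto_mono[OF polys_upto_mult[OF 1(2) polys_upto_snd], of "k + 2"] by simp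
    show "\<rho> (sqrt s * v, s) * snd (sqrt s * v, s) = sqrt s ^ (k + 2) * \<psi> v" if "s \<ge> 0" for s v
      using 1(4)[OF that, of v] that by (simp add: power_add)
  qed (use 1 in auto)
qed

text \<open>Both pairings equal \<open>gmoment (\<mu> + \<sigma>) m i\<close>, by
  \<open>geg_trans_moments\<close> on the sphere and \<open>hgeg_moments\<close> on the
  interval.\<close>

lemma adj_on_hgeg: "adj_on m (\<lambda>x. hgeg \<mu> m (\<xi> \<bullet> x) 1)"
proof (rule adj_onI[where \<rho> = "\<lambda>p. hgeg (\<mu> + \<sigma>) m (fst p) (snd p)" and \<psi> = "\<lambda>v. hgeg (\<mu> + \<sigma>) m v 1"])
  show "(\<lambda>p. hgeg (\<mu> + \<sigma>) m (fst p) (snd p)) \<in> polys_upto m" by (rule hgeg_polys_upto)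
  show "hgeg (\<mu> + \<sigma>) m 1 1 = hgeg \<mu> m (\<xi> \<bullet> \<xi>) 1"
    using hgeg_one \<mu>_nonneg \<sigma> by simp
  show "smean (\<lambda>x. hgeg \<mu> m (\<xi> \<bullet> x) 1 * geg_trans \<mu> \<sigma> i (\<xi> \<bullet> x)) = gmean (\<lambda>v. hgeg (\<mu> + \<sigma>) m v 1 * v ^ i)" for i
    by (simp add: smean_hgeg_trans gmean_hgeg)
qed (auto intro!: continuous_intros simp: hgeg_homogeneous)

text \<open>Solving the three-term recursion for v times the polynomial of degree m trades a power
  of v for degrees m + 1 and m - 1. The lower term is short by 2 in total degree, which
  \<open>adj_on_shift\<close> repairs.\<close>

lemma adj_on_power_hgeg: "adj_on (m + j) (\<lambda>x. (\<xi> \<bullet> x) ^ j * hgeg \<mu> m (\<xi> \<bullet> x) 1)"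
proof (induction j arbitrary: m)
  case 0
  show ?case using adj_on_hgeg by simp
next
  case (Suc j)
  show ?case
  proof (cases m)
    case 0
    then show ?thesis using Suc[of 1] by (simp add: mult.commute)
  next
    case (Suc n)
    let ?h = "\<lambda>m x. hgeg \<mu> m (\<xi> \<bullet> x) 1"
    define c where "c = real n + 1 + \<mu>"
    have c: "c > 0" "real n + 1 + 2 * \<mu> > 0" using \<mu>_nonneg by (simp_all add: c_def)
    have rel: "(\<xi> \<bullet> x) * ?h m x = (real n + 1 + 2 * \<mu>) / (2 * c) * ?h (Suc m) x + (real n + 1) / (2 * c) * ?h n x" for x
    proof -
      have "(real n + 1 + 2 * \<mu>) * ?h (Suc m) x = 2 * c * ((\<xi> \<bullet> x) * ?h m x) - (real n + 1) * ?h n x"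
        using c(2) unfolding Suc by (simp add: c_def)
      then have "2 * c * ((\<xi> \<bullet> x) * ?h m x) = (real n + 1 + 2 * \<mu>) * ?h (Suc m) x + (real n + 1) * ?h n x" by simp
      then have "(\<xi> \<bullet> x) * ?h m x = ((real n + 1 + 2 * \<mu>) * ?h (Suc m) x + (real n + 1) * ?h n x) / (2 * c)"
        using c(1) by (metis less_irrefl mult_eq_0_iff nonzero_mult_div_cancel_left zero_neq_numeral)
      then show ?thesis by (simp only: times_divide_eq_left add_divide_distrib[symmetric])
    qed
    have A: "adj_on (m + Suc j) (\<lambda>x. (\<xi> \<bullet> x) ^ j * ?h (Suc m) x)" using Suc.IH[of "Suc m"] by simp
    have B: "adj_on (m + Suc j) (\<lambda>x. (\<xi> \<bullet> x) ^ j * ?h n x)"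
      using adj_on_shift[OF Suc.IH[of n]] Suc by simp
    have "(\<lambda>x. (\<xi> \<bullet> x) ^ Suc j * ?h m x) = (\<lambda>x. (real n + 1 + 2 * \<mu>) / (2 * c) * ((\<xi> \<bullet> x) ^ j * ?h (Suc m) x)
        + (real n + 1) / (2 * c) * ((\<xi> \<bullet> x) ^ j * ?h n x))"
    proof
      fix x
      have "(\<xi> \<bullet> x) ^ Suc j * ?h m x = (\<xi> \<bullet> x) ^ j * ((\<xi> \<bullet> x) * ?h m x)" by simp
      also have "\<dots> = (real n + 1 + 2 * \<mu>) / (2 * c) * ((\<xi> \<bullet> x) ^ j * ?h (Suc m) x)
        + (real n + 1) / (2 * c) * ((\<xi> \<bullet> x) ^ j * ?h n x)"
        unfolding rel by (simp only: distrib_left mult_ac)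
      finally show "(\<xi> \<bullet> x) ^ Suc j * ?h m x = (real n + 1 + 2 * \<mu>) / (2 * c) * ((\<xi> \<bullet> x) ^ j * ?h (Suc m) x)
        + (real n + 1) / (2 * c) * ((\<xi> \<bullet> x) ^ j * ?h n x)" .
    qed
    then show ?thesis using adj_on_lincomb[OF A B] by (simp only:)
  qed
qed

text \<open>Expand one factor \<open>1 - (\<xi> \<bullet> x)\<^sup>2\<close> at a time; the degrees
  of the two terms differ by 2, and \<open>adj_on_shift\<close> aligns them.\<close>

lemma adj_on_zonal: "adj_on (a + 2 * p) (\<lambda>x. (\<xi> \<bullet> x) ^ a * (1 - (\<xi> \<bullet> x)\<^sup>2) ^ p)"
proof (induction p arbitrary: a)
  case 0
  show ?case using adj_on_power_hgeg[of 0 a] by simp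
next
  case (Suc p)
  have "(\<lambda>x. (\<xi> \<bullet> x) ^ a * (1 - (\<xi> \<bullet> x)\<^sup>2) ^ Suc p) = (\<lambda>x. 1 * ((\<xi> \<bullet> x) ^ a * (1 - (\<xi> \<bullet> x)\<^sup>2) ^ p)
      + (-1) * ((\<xi> \<bullet> x) ^ (a + 2) * (1 - (\<xi> \<bullet> x)\<^sup>2) ^ p))"
    by (auto simp: fun_eq_iff algebra_simps power2_eq_square)
  moreover have "adj_on (a + 2 * Suc p) (\<lambda>x. (\<xi> \<bullet> x) ^ a * (1 - (\<xi> \<bullet> x)\<^sup>2) ^ p)"
    using adj_on_shift[OF Suc[of a]] by (simp add: algebra_simps)
  moreover have "adj_on (a + 2 * Suc p) (\<lambda>x. (\<xi> \<bullet> x) ^ (a + 2) * (1 - (\<xi> \<bullet> x)\<^sup>2) ^ p)"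
    using Suc[of "a + 2"] by (simp add: algebra_simps)
  ultimately show ?case using adj_on_lincomb[where a = 1 and b = "-1"] by simp
qed

text \<open>Beyond continuity, \<open>adj_on\<close> sees only the value at \<xi> and pairings with
  functions of \<open>\<xi> \<bullet> x\<close>, so a polynomial may be traded for its zonal
  average.\<close>

lemma adj_on_transfer:
  assumes "adj_on k f" "continuous_on UNIV g" "g \<xi> = f \<xi>"
    "\<And>i. smean (\<lambda>x. g x * geg_trans \<mu> \<sigma> i (\<xi> \<bullet> x)) = smean (\<lambda>x. f x * geg_trans \<mu> \<sigma> i (\<xi> \<bullet> x))"
  shows "adj_on k g"
  using assms by (elim adj_onE) (auto intro!: adj_onI)

lemma adj_on_zero: "adj_on k (\<lambda>_. 0)"
  by (rule adj_onI[where \<rho> = "\<lambda>_. 0" and \<psi> = "\<lambda>_. 0"])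
     (auto simp: polys_upto_zero mean_def)

text \<open>Against functions of \<open>\<xi> \<bullet> x\<close>, q acts like
  \<open>\<kappa> * (1 - (\<xi> \<bullet> x)\<^sup>2) ^ (l div 2)\<close>. The values at \<xi> agree
  as well: both vanish for l > 0 and both are \<kappa> for l = 0.\<close>

lemma adj_on_perp:
  assumes q: "hom_poly perp l q"
  shows "adj_on (a + l) (\<lambda>x. (\<xi> \<bullet> x) ^ a * q x)"
proof -
  note qc = continuous_on_hom_poly[OF q]
  obtain \<kappa> where \<kappa>: "\<And>k. smean (\<lambda>x. (\<xi> \<bullet> x) ^ k * q x)
        = \<kappa> * smean (\<lambda>x. (\<xi> \<bullet> x) ^ k * (1 - (\<xi> \<bullet> x)\<^sup>2) ^ (l div 2))"
      "odd l \<Longrightarrow> \<kappa> = 0" "l = 0 \<Longrightarrow> q = (\<lambda>_. \<kappa>)"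
    using smean_perp[OF q] by blast
  define f where "f x = \<kappa> * ((\<xi> \<bullet> x) ^ a * (1 - (\<xi> \<bullet> x)\<^sup>2) ^ (l div 2))" for x
  have "adj_on (a + l) f"
  proof (cases "odd l")
    case True
    then show ?thesis using \<kappa>(2) adj_on_zero by (simp add: f_def[abs_def])
  next
    case False
    then obtain p where l: "l = 2 * p" unfolding dvd_def by blast
    have "adj_on (a + l) (\<lambda>x. (\<xi> \<bullet> x) ^ a * (1 - (\<xi> \<bullet> x)\<^sup>2) ^ (l div 2))"
      using adj_on_zonal[of a p] l by simp
    from adj_on_lincomb[OF this this, of \<kappa> 0] show ?thesis by (simp add: f_def[abs_def])
  qed
  then show ?thesis
  proof (rule adj_on_transfer)
    show "continuous_on UNIV (\<lambda>x. (\<xi> \<bullet> x) ^ a * q x)" by (intro continuous_intros qc)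
    show "(\<xi> \<bullet> \<xi>) ^ a * q \<xi> = f \<xi>"
    proof (cases "l = 0")
      case True
      then show ?thesis using \<kappa>(3) by (simp add: f_def)
    next
      case False
      then have "q \<xi> = 0" using homogeneous_perp_at_\<xi>[OF q] by simp
      moreover have "f \<xi> = 0"
      proof (cases "odd l")
        case True
        then show ?thesis using \<kappa>(2) by (simp add: f_def)
      next
        case even: False
        then have "l div 2 \<noteq> 0" using False by (auto elim!: evenE)
        then show ?thesis by (simp add: f_def power_0_left)
      qed
      ultimately show ?thesis by simp
    qed
    fix i
    define c where "c j = real (i choose j) * pochhammer (\<mu> + 1) j * pochhammer \<sigma> (i - j)
       / pochhammer (\<mu> + \<sigma> + 1) i * gmoment \<sigma> 0 (i - j)" for j
    have gt: "geg_trans \<mu> \<sigma> i v = (\<Sum>j\<le>i. c j * v ^ j)" for v by (simp add: geg_trans_def c_def)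
    have "smean (\<lambda>x. (\<xi> \<bullet> x) ^ a * q x * geg_trans \<mu> \<sigma> i (\<xi> \<bullet> x))
        = smean (\<lambda>x. \<Sum>j\<le>i. c j * ((\<xi> \<bullet> x) ^ (a + j) * q x))"
      by (simp add: gt sum_distrib_left power_add mult_ac)
    also have "\<dots> = (\<Sum>j\<le>i. c j * smean (\<lambda>x. (\<xi> \<bullet> x) ^ (a + j) * q x))"
      by (intro S.mean_N_sum continuous_intros qc) simp
    also have "\<dots> = (\<Sum>j\<le>i. (c j * \<kappa>) * smean (\<lambda>x. (\<xi> \<bullet> x) ^ (a + j) * (1 - (\<xi> \<bullet> x)\<^sup>2) ^ (l div 2)))"
      by (simp add: \<kappa>(1) mult.assoc)
    also have "\<dots> = smean (\<lambda>x. \<Sum>j\<le>i. (c j * \<kappa>) * ((\<xi> \<bullet> x) ^ (a + j) * (1 - (\<xi> \<bullet> x)\<^sup>2) ^ (l div 2)))"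
      by (intro S.mean_N_sum[symmetric] continuous_intros) simp
    also have "\<dots> = smean (\<lambda>x. f x * geg_trans \<mu> \<sigma> i (\<xi> \<bullet> x))"
    proof -
      have "(\<Sum>j\<le>i. (c j * \<kappa>) * ((\<xi> \<bullet> x) ^ (a + j) * (1 - (\<xi> \<bullet> x)\<^sup>2) ^ (l div 2)))
          = f x * geg_trans \<mu> \<sigma> i (\<xi> \<bullet> x)" for x
        unfolding gt sum_distrib_left by (intro sum.cong) (simp_all add: f_def power_add)
      then show ?thesis by simp
    qed
    finally show "smean (\<lambda>x. (\<xi> \<bullet> x) ^ a * q x * geg_trans \<mu> \<sigma> i (\<xi> \<bullet> x)) = smean (\<lambda>x. f x * geg_trans \<mu> \<sigma> i (\<xi> \<bullet> x))" .
  qed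
qed

text \<open>Each linear form splits into a multiple of \<open>\<xi> \<bullet> x\<close> and a form
  orthogonal to \<xi>. The extra factor \<open>(\<xi> \<bullet> x) ^ a * q x\<close> collects the
  pieces already split, and the induction ends in \<open>adj_on_perp\<close>.\<close>

lemma adj_on_homogeneous_mult:
  assumes "hom_poly UNIV k f"
  shows "hom_poly perp l q \<Longrightarrow> adj_on (k + a + l) (\<lambda>x. f x * ((\<xi> \<bullet> x) ^ a * q x))"
  using assms
proof (induction arbitrary: a l q rule: hom_poly.induct)
  case (const c)
  have A: "adj_on (a + l) (\<lambda>x. (\<xi> \<bullet> x) ^ a * q x)" by (rule adj_on_perp[OF const])
  from adj_on_lincomb[OF A A, where a = c and b = 0] show ?case by simp
next
  case (mult k f e)
  define e' where "e' = e - (e \<bullet> \<xi>) *\<^sub>R \<xi>"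
  have e': "e' \<in> perp" by (simp add: e'_def perp_def inner_diff_left)
  have e: "e \<bullet> x = (e \<bullet> \<xi>) * (\<xi> \<bullet> x) + e' \<bullet> x" for x by (simp add: e'_def inner_diff_left)
  have 1: "adj_on (Suc k + a + l) (\<lambda>x. f x * ((\<xi> \<bullet> x) ^ (Suc a) * q x))"
    using mult.IH[OF mult.prems, of "Suc a"] by simp
  have 2: "adj_on (Suc k + a + l) (\<lambda>x. f x * ((\<xi> \<bullet> x) ^ a * ((e' \<bullet> x) * q x)))"
    using mult.IH[OF hom_poly.mult[OF mult.prems e'], of a] by simp
  have "(\<lambda>x. (e \<bullet> x) * f x * ((\<xi> \<bullet> x) ^ a * q x)) = (\<lambda>x. (e \<bullet> \<xi>) * (f x * ((\<xi> \<bullet> x) ^ (Suc a) * q x))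
      + 1 * (f x * ((\<xi> \<bullet> x) ^ a * ((e' \<bullet> x) * q x))))"
  proof
    fix x
    show "(e \<bullet> x) * f x * ((\<xi> \<bullet> x) ^ a * q x) = (e \<bullet> \<xi>) * (f x * ((\<xi> \<bullet> x) ^ (Suc a) * q x))
      + 1 * (f x * ((\<xi> \<bullet> x) ^ a * ((e' \<bullet> x) * q x)))"
      unfolding e[of x] by (simp add: algebra_simps)
  qed
  then show ?case using adj_on_lincomb[OF 1 2, of "e \<bullet> \<xi>" 1] by simp
next
  case (add k f g)
  from adj_on_lincomb[OF add.IH(1)[OF add.prems, of a] add.IH(2)[OF add.prems, of a], of 1 1]
  show ?case by (simp add: distrib_right)
qed

theorem adj_on_homogeneous: "hom_poly UNIV k f \<Longrightarrow> adj_on k f"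
  using adj_on_homogeneous_mult[OF _ hom_poly.const[of perp 1], of k f 0] by simp

end

section \<open>From angular adjointness to the kernel identity\<close>

lemma hom_poly_monom_fun: "hom_poly UNIV (\<Sum>i\<in>Basis. \<alpha> i) (monom_fun \<alpha>)"
proof -
  have step: "hom_poly UNIV (j + k) (\<lambda>x. (x \<bullet> i) ^ j * f x)" if "hom_poly UNIV k f"
    for i :: 'a and j k f
  proof (induction j)
    case (Suc j)
    from hom_poly.mult[OF this, of i] show ?case by (simp add: mult.assoc inner_commute)
  qed (use that in simp)
  have "finite A \<Longrightarrow> hom_poly UNIV (\<Sum>i\<in>A. \<alpha> i) (\<lambda>x. \<Prod>i\<in>A. (x \<bullet> i) ^ \<alpha> i)" for A
  proof (induction A rule: finite_induct)
    case empty
    show ?case using hom_poly.const[of UNIV 1] by simp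
  next
    case (insert i A)
    then show ?case using step[of "\<Sum>i\<in>A. \<alpha> i" "\<lambda>x. \<Prod>i\<in>A. (x \<bullet> i) ^ \<alpha> i" "\<alpha> i" i] by simp
  qed
  from this[OF finite_Basis] show ?thesis by (simp add: monom_fun_def[abs_def])
qed

lemma monom_fun_real: "monom_fun \<alpha> (u::real) = u ^ \<alpha> 1"
  by (simp add: monom_fun_def)

lemma polys_upto_2_induct [consumes 1, case_names monom lincomb]:
  fixes f :: "real \<times> real \<Rightarrow> real"
  assumes "f \<in> polys_upto n"
    and "\<And>i j. i + j \<le> n \<Longrightarrow> P (\<lambda>p. fst p ^ i * snd p ^ j)"
    and "\<And>f g a b. f \<in> polys_upto n \<Longrightarrow> g \<in> polys_upto n \<Longrightarrow> P f \<Longrightarrow> P g \<Longrightarrow>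
      P (\<lambda>x. a * f x + b * g x)"
  shows "P f"
  using assms(1)
proof (induction rule: polys_upto_induct)
  case (monom \<alpha>)
  have "monom_fun \<alpha> = (\<lambda>p. fst p ^ \<alpha> (1, 0) * snd p ^ \<alpha> (0, 1))"
    by (auto simp: fun_eq_iff monom_fun_prod(1) monom_fun_real)
  moreover have "\<alpha> (1, 0) + \<alpha> (0, 1) \<le> n" using monom monom_fun_prod(2)[of \<alpha>] by simp
  ultimately show ?case using assms(2) by simp
qed (use assms(3) in auto)

lemma V0E:
  assumes "p \<in> (V0 :: ('a::euclidean_space \<times> real) set)"
  obtains \<eta> s where "p = (sqrt s *\<^sub>R \<eta>, s)" "norm \<eta> = 1" "s \<in> {0..1}"
proof -
  obtain \<eta> s where "p = cone_map (\<eta>, s)" "\<eta> \<in> sphere 0 1" "s \<in> {0..1}"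
    using assms unfolding V0_eq_cone by blast
  then show ?thesis by (intro that) (auto simp: cone_map_def)
qed

context zonal
begin

text \<open>\<open>gmoment \<sigma> 0 (i - l)\<close> vanishes for odd \<open>i - l\<close>, so the
  leftover powers of \<open>sqrt s\<close> are integer powers of s. Their degree
  \<open>(i - l) div 2\<close> is at most \<open>i - l\<close>, hence the total does not exceed i +
  j.\<close>

lemma trans_monom_poly:
  "\<exists>F\<in>polys_upto (i + j). \<forall>s\<ge>0. \<forall>\<eta>. F (sqrt s *\<^sub>R \<eta>, s) = s ^ j * sqrt s ^ i * geg_trans \<mu> \<sigma> i (\<xi> \<bullet> \<eta>)"
proof -
  define c where "c l = real (i choose l) * pochhammer (\<mu> + 1) l * pochhammer \<sigma> (i - l)
       / pochhammer (\<mu> + \<sigma> + 1) i * gmoment \<sigma> 0 (i - l)" for l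
  define F where "F p = (\<Sum>l\<le>i. c l * ((\<xi> \<bullet> fst p) ^ l * snd p ^ (j + (i - l) div 2)))" for p :: "'a \<times> real"
  have "(\<lambda>p. (\<xi> \<bullet> fst p) ^ l * snd p ^ (j + (i - l) div 2)) \<in> polys_upto (i + j)" if "l \<le> i" for l
  proof -
    have "(\<lambda>p. (\<xi> \<bullet> fst p) ^ l * snd p ^ (j + (i - l) div 2)) \<in> polys_upto (l * Suc 0 + (j + (i - l) div 2) * Suc 0)"
      by (intro polys_upto_mult polys_upto_power polys_upto_snd polys_upto_fst_inner)
    moreover have "l * Suc 0 + (j + (i - l) div 2) * Suc 0 \<le> i + j" using that by simp
    ultimately show ?thesis by (rule polys_upto_mono)
  qed
  then have "F \<in> polys_upto (i + j)" unfolding F_def[abs_def] by (intro polys_upto_sum) auto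
  moreover have "F (sqrt s *\<^sub>R \<eta>, s) = s ^ j * sqrt s ^ i * geg_trans \<mu> \<sigma> i (\<xi> \<bullet> \<eta>)" if s: "s \<ge> 0" for s \<eta>
  proof -
    have "c l * ((\<xi> \<bullet> sqrt s *\<^sub>R \<eta>) ^ l * s ^ (j + (i - l) div 2)) = s ^ j * sqrt s ^ i * (c l * (\<xi> \<bullet> \<eta>) ^ l)"
      if l: "l \<le> i" for l
    proof (cases "even (i - l)")
      case True
      then obtain p where p: "i - l = 2 * p" unfolding dvd_def by blast
      have "sqrt s ^ i = sqrt s ^ l * sqrt s ^ (2 * p)" using p l by (metis le_add_diff_inverse power_add)
      also have "sqrt s ^ (2 * p) = s ^ p" using s by (simp add: power_mult)
      finally show ?thesis using p by (simp add: power_mult_distrib power_add mult_ac)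
    next
      case False
      then have "c l = 0" by (simp add: c_def gmoment_eq_0(2))
      then show ?thesis by simp
    qed
    moreover have "geg_trans \<mu> \<sigma> i v = (\<Sum>l\<le>i. c l * v ^ l)" for v by (simp add: geg_trans_def c_def)
    ultimately show ?thesis by (simp only: F_def sum_distrib_left fst_conv snd_conv) (intro sum.cong; simp)
  qed
  ultimately show ?thesis by blast
qed

text \<open>T enters through linearity and its values on monomials, so the double average and, for
  \<sigma> = 0, plain evaluation are both instances. Adjointness is checked on monomials, where both
  inner products factor into the same radial mean and an angular pairing supplied by
  \<open>adj_on\<close>.\<close>

lemma kernel_identity:
  fixes T :: "(real \<times> real \<Rightarrow> real) \<Rightarrow> 'a \<times> real \<Rightarrow> real"
  assumes \<sigma>_def: "\<sigma> = \<beta> + 1/2" and \<gamma>: "\<gamma> > -1" and b_def: "b = \<mu> + \<sigma>"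
    and T_monom: "\<And>i j s \<eta>. s \<in> {0..1} \<Longrightarrow> norm \<eta> = 1 \<Longrightarrow>
        T (\<lambda>p. fst p ^ i * snd p ^ j) (sqrt s *\<^sub>R \<eta>, s) = s ^ j * sqrt s ^ i * geg_trans \<mu> \<sigma> i (\<xi> \<bullet> \<eta>)"
    and T_lin: "\<And>f g n a b p. f \<in> polys_upto n \<Longrightarrow> g \<in> polys_upto n \<Longrightarrow> p \<in> V0 \<Longrightarrow>
        T (\<lambda>q. a * f q + b * g q) p = a * T f p + b * T g p"
    and t: "t \<in> {0..1}" and p: "p \<in> V0"
  shows "V0_kernel n \<beta> \<gamma> (sqrt t *\<^sub>R \<xi>, t) p = T (U_kernel n \<gamma> b (sqrt t, t)) p"
proof -
  have \<beta>: "\<beta> \<ge> -1/2" using \<sigma> \<sigma>_def by simp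
  \<comment> \<open>The Gegenbauer parameter of the parabolic domain is also the radial exponent of
    the paraboloid, so both cones share \<open>?\<tau>\<close>.\<close>
  have b: "b = \<beta> + (real DIM('a) - 1) / 2" by (simp add: b_def \<sigma>_def \<mu>_def diff_divide_distrib)
  have b0: "b \<ge> 0" using \<mu>_nonneg \<sigma> by (simp add: b_def)
  let ?\<tau> = "rad_measure b \<gamma>"
  interpret V: cone_measure "sphere_measure :: 'a measure" ?\<tau> "sphere 0 1"
    by (rule cone_measure_sphere) (use b0 \<gamma> in auto)
  interpret U: cone_measure "geg_measure b" ?\<tau> "{-1..1}"
    by (rule cone_measure_gegenbauer) (use b0 \<gamma> in auto)
  interpret PV: poly_inner "V0 :: ('a \<times> real) set" "V0_inner \<beta> \<gamma>" by (rule poly_inner_V0[OF \<beta> \<gamma> b])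
  interpret PU: poly_inner UNIV "U_inner \<gamma> b" by (rule poly_inner_U) (use b0 \<gamma> in auto)
  have T_poly: "\<exists>F\<in>polys_upto n. \<forall>p\<in>V0. F p = T f p" if "f \<in> polys_upto n" for n f
    using that
  proof (induction rule: polys_upto_2_induct)
    case (monom i j)
    obtain F where F: "F \<in> polys_upto (i + j)"
      "\<And>s \<eta>. s \<ge> 0 \<Longrightarrow> F (sqrt s *\<^sub>R \<eta>, s) = s ^ j * sqrt s ^ i * geg_trans \<mu> \<sigma> i (\<xi> \<bullet> \<eta>)"
      using trans_monom_poly by blast
    have "F p = T (\<lambda>p. fst p ^ i * snd p ^ j) p" if "p \<in> V0" for p
    proof -
      obtain \<eta> s where "p = (sqrt s *\<^sub>R \<eta>, s)" "norm \<eta> = 1" "s \<in> {0..1}"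
        using V0E[OF \<open>p \<in> V0\<close>] .
      then show ?thesis using F(2)[of s \<eta>] T_monom[of s \<eta> i j] by simp
    qed
    then show ?case using polys_upto_mono[OF F(1) monom] by blast
  next
    case (lincomb f g a c)
    then obtain F G where "F \<in> polys_upto n" "G \<in> polys_upto n" "\<forall>p\<in>V0. F p = T f p" "\<forall>p\<in>V0. G p = T g p"
      by blast
    then show ?case using polys_upto_lincomb T_lin[OF lincomb(1,2)]
      by (intro bexI[of _ "\<lambda>x. a * F x + c * G x"]) auto
  qed
  have T_lincomb: "V0_inner \<beta> \<gamma> g (T (\<lambda>q. a * f1 q + b * f2 q))
      = a * V0_inner \<beta> \<gamma> g (T f1) + b * V0_inner \<beta> \<gamma> g (T f2)"
    if g: "g \<in> polys_upto m" and f: "f1 \<in> polys_upto n" "f2 \<in> polys_upto n" for g m f1 f2 n a b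
  proof -
    obtain F1 F2 where F: "F1 \<in> polys_upto n" "F2 \<in> polys_upto n"
      "\<And>p. p \<in> V0 \<Longrightarrow> F1 p = T f1 p" "\<And>p. p \<in> V0 \<Longrightarrow> F2 p = T f2 p"
      using T_poly[OF f(1)] T_poly[OF f(2)] by blast
    have "V0_inner \<beta> \<gamma> g (T (\<lambda>q. a * f1 q + b * f2 q)) = V0_inner \<beta> \<gamma> g (\<lambda>p. a * F1 p + b * F2 p)"
      by (rule PV.ip_cong2) (simp add: T_lin[OF f] F)
    also have "\<dots> = V0_inner \<beta> \<gamma> (\<lambda>p. a * F1 p + b * F2 p) g" by (rule PV.ip_commute)
    also have "\<dots> = a * V0_inner \<beta> \<gamma> F1 g + b * V0_inner \<beta> \<gamma> F2 g"
      by (rule PV.ip_lincomb[of _ "max m n"]) (auto intro: polys_upto_mono F g)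
    also have "V0_inner \<beta> \<gamma> F1 g = V0_inner \<beta> \<gamma> g (T f1)"
      using PV.ip_cong2[of F1 "T f1" g] F(3) PV.ip_commute by metis
    also have "V0_inner \<beta> \<gamma> F2 g = V0_inner \<beta> \<gamma> g (T f2)"
      using PV.ip_cong2[of F2 "T f2" g] F(4) PV.ip_commute by metis
    finally show ?thesis .
  qed
  have U_lincomb: "U_inner \<gamma> b r (\<lambda>q. a * f1 q + c * f2 q) = a * U_inner \<gamma> b r f1 + c * U_inner \<gamma> b r f2"
    if "r \<in> polys_upto m" "f1 \<in> polys_upto n" "f2 \<in> polys_upto n" for r m f1 f2 n a c
  proof -
    have "U_inner \<gamma> b (\<lambda>q. a * f1 q + c * f2 q) r = a * U_inner \<gamma> b f1 r + c * U_inner \<gamma> b f2 r"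
      by (rule PU.ip_lincomb[of _ "max m n"]) (auto intro: polys_upto_mono that)
    then show ?thesis using PU.ip_commute by metis
  qed
  have adj: "\<exists>r\<in>polys_upto m. (\<forall>n f. f \<in> polys_upto n \<longrightarrow> V0_inner \<beta> \<gamma> g (T f) = U_inner \<gamma> b r f)
      \<and> r (sqrt t, t) = g (sqrt t *\<^sub>R \<xi>, t)" if "g \<in> polys_upto m" for m g
    using that
  proof (induction rule: polys_upto_induct)
    case (monom \<alpha>)
    define k where "k = (\<Sum>i\<in>Basis. \<alpha> (i, 0))"
    define j where "j = \<alpha> (0, 1)"
    define h where "h = (monom_fun (\<lambda>i. \<alpha> (i, 0)) :: 'a \<Rightarrow> real)"
    have kj: "k + j \<le> m" using monom monom_fun_prod(2)[of \<alpha>] by (simp add: k_def j_def)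
    have g: "monom_fun \<alpha> p = h (fst p) * snd p ^ j" for p
      by (cases p) (simp add: monom_fun_prod(1) h_def j_def)
    have g_poly: "monom_fun \<alpha> \<in> polys_upto m" using monom by (rule monom_fun_polys_upto)
    have h: "hom_poly UNIV k h" unfolding h_def k_def by (rule hom_poly_monom_fun)
    obtain \<rho> \<psi> where \<rho>: "continuous_on UNIV h" "\<rho> \<in> polys_upto k" "continuous_on UNIV \<psi>"
      "\<And>s v. s \<ge> 0 \<Longrightarrow> \<rho> (sqrt s * v, s) = sqrt s ^ k * \<psi> v" "\<psi> 1 = h \<xi>"
      "\<And>i. smean (\<lambda>x. h x * geg_trans \<mu> \<sigma> i (\<xi> \<bullet> x)) = gmean (\<lambda>v. \<psi> v * v ^ i)"
      using adj_on_homogeneous[OF h] by (rule adj_onE) (rule that; assumption)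
    define r where "r = (\<lambda>p. \<rho> p * snd p ^ j)"
    have r: "r \<in> polys_upto m"
      using polys_upto_mono[OF polys_upto_mult[OF \<rho>(2) polys_upto_power[OF polys_upto_snd, of j]]] kj
      by (simp add: r_def)
    have "V0_inner \<beta> \<gamma> (monom_fun \<alpha>) (T f) = U_inner \<gamma> b r f" if "f \<in> polys_upto n" for n f
      using that
    proof (induction rule: polys_upto_2_induct)
      case (monom i j')
      let ?f = "\<lambda>p::real \<times> real. fst p ^ i * snd p ^ j'"
      \<comment> \<open>The radial part of the integrand on either domain: k + i from the
        homogeneous factors, \<open>j + j'\<close> from the powers of the last coordinate.\<close>
      define a where "a t = sqrt t ^ (k + i) * t ^ (j + j')" for t :: real
      have a: "continuous_on UNIV a" unfolding a_def by (intro continuous_intros)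
      obtain F where F: "F \<in> polys_upto (i + j')"
        "\<And>s \<eta>. s \<ge> 0 \<Longrightarrow> F (sqrt s *\<^sub>R \<eta>, s) = s ^ j' * sqrt s ^ i * geg_trans \<mu> \<sigma> i (\<xi> \<bullet> \<eta>)"
        using trans_monom_poly by blast
      have "V0_inner \<beta> \<gamma> (monom_fun \<alpha>) (T ?f) = V0_inner \<beta> \<gamma> (monom_fun \<alpha>) F"
      proof (rule PV.ip_cong2)
        fix p :: "'a \<times> real" assume "p \<in> V0"
        then obtain \<eta> s where "p = (sqrt s *\<^sub>R \<eta>, s)" "norm \<eta> = 1" "s \<in> {0..1}"
          by (rule V0E)
        then show "T ?f p = F p" using F(2)[of s \<eta>] T_monom[of s \<eta> i j'] by simp
      qed
      also have "\<dots> = V.ip (monom_fun \<alpha>) F"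
        using V0_inner_eq_ip[OF \<beta> \<gamma> b] measurable_polys_upto g_poly F(1) by blast
      also have "\<dots> = mean ?\<tau> a * smean (\<lambda>x. h x * geg_trans \<mu> \<sigma> i (\<xi> \<bullet> x))"
      proof -
        have "(\<integral>p. monom_fun \<alpha> p * F p \<partial>V.P) = (\<integral>t. a t \<partial>?\<tau>) * (\<integral>x. h x * geg_trans \<mu> \<sigma> i (\<xi> \<bullet> x) \<partial>sphere_measure)"
        proof (rule V.integral_P_factor)
          show "continuous_on UNIV (\<lambda>p. monom_fun \<alpha> p * F p)"
            using cont_polys_upto[OF g_poly] cont_polys_upto[OF F(1)] by (intro continuous_intros)
          show "continuous_on UNIV (\<lambda>x. h x * geg_trans \<mu> \<sigma> i (\<xi> \<bullet> x))"
            by (intro continuous_intros \<rho>(1))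
          show "monom_fun \<alpha> (sqrt t *\<^sub>R \<eta>, t) * F (sqrt t *\<^sub>R \<eta>, t) = a t * (h \<eta> * geg_trans \<mu> \<sigma> i (\<xi> \<bullet> \<eta>))"
            if "t \<in> {0..1}" for \<eta> t
            using that by (simp add: g F(2) hom_poly_scaleR[OF h] a_def power_add mult_ac)
        qed (rule a)
        then show ?thesis unfolding V.ip_def V.measure_P mean_def by simp
      qed
      also have "\<dots> = mean ?\<tau> a * gmean (\<lambda>v. \<psi> v * v ^ i)" by (simp only: \<rho>(6))
      also have "\<dots> = U.ip r ?f"
      proof -
        have f: "?f \<in> polys_upto (i * Suc 0 + j' * Suc 0)"
          by (intro polys_upto_mult polys_upto_power polys_upto_snd polys_upto_fst)
        have "(\<integral>p. r p * ?f p \<partial>U.P) = (\<integral>t. a t \<partial>?\<tau>) * (\<integral>v. \<psi> v * v ^ i \<partial>geg_measure b)"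
        proof (rule U.integral_P_factor)
          show "continuous_on UNIV (\<lambda>p. r p * ?f p)"
            by (rule continuous_on_mult[OF cont_polys_upto[OF r] cont_polys_upto[OF f]])
          show "continuous_on UNIV (\<lambda>v. \<psi> v * v ^ i)" by (intro continuous_intros \<rho>(3))
          show "r (sqrt t *\<^sub>R v, t) * (fst (sqrt t *\<^sub>R v, t) ^ i * snd (sqrt t *\<^sub>R v, t) ^ j') = a t * (\<psi> v * v ^ i)"
            if "t \<in> {0..1}" for v t
            using that \<rho>(4)[of t v] by (simp add: r_def a_def power_add power_mult_distrib mult_ac)
        qed (rule a)
        then show ?thesis unfolding U.ip_def U.measure_P mean_def b_def[symmetric] by simp
      qed
      also have "\<dots> = U_inner \<gamma> b r ?f"
      proof -
        have "?f \<in> borel_measurable borel"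
          by (intro borel_measurable_continuous_onI continuous_intros)
        then show ?thesis
          using U_inner_eq_ip[of b \<gamma> r ?f] b0 \<gamma> measurable_polys_upto[OF r] by simp
      qed
      finally show ?case .
    next
      case (lincomb f1 f2 a c)
      then show ?case
        using T_lincomb[OF g_poly lincomb(1,2)] U_lincomb[OF r lincomb(1,2)] by simp
    qed
    \<comment> \<open>The point \<open>(sqrt t, t)\<close> is the case v = 1, where \<psi> takes the
      value of h at \<xi>.\<close>
    moreover have "r (sqrt t, t) = monom_fun \<alpha> (sqrt t *\<^sub>R \<xi>, t)"
      using \<rho>(4)[of t 1] t \<rho>(5) by (simp add: r_def g hom_poly_scaleR[OF h])
    ultimately show ?case using r by blast
  next
    case (lincomb g1 g2 a c)
    then obtain r1 r2 where r: "r1 \<in> polys_upto m" "r2 \<in> polys_upto m"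
      "\<And>n f. f \<in> polys_upto n \<Longrightarrow> V0_inner \<beta> \<gamma> g1 (T f) = U_inner \<gamma> b r1 f" "r1 (sqrt t, t) = g1 (sqrt t *\<^sub>R \<xi>, t)"
      "\<And>n f. f \<in> polys_upto n \<Longrightarrow> V0_inner \<beta> \<gamma> g2 (T f) = U_inner \<gamma> b r2 f" "r2 (sqrt t, t) = g2 (sqrt t *\<^sub>R \<xi>, t)"
      by blast
    have "V0_inner \<beta> \<gamma> (\<lambda>x. a * g1 x + c * g2 x) (T f) = U_inner \<gamma> b (\<lambda>x. a * r1 x + c * r2 x) f" if f: "f \<in> polys_upto n" for n f
    proof -
      obtain F where F: "F \<in> polys_upto n" "\<And>p. p \<in> V0 \<Longrightarrow> F p = T f p" using T_poly[OF f] by blast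
      have FT: "V0_inner \<beta> \<gamma> g F = V0_inner \<beta> \<gamma> g (T f)" for g using F by (intro PV.ip_cong2) auto
      have "V0_inner \<beta> \<gamma> (\<lambda>x. a * g1 x + c * g2 x) F = a * V0_inner \<beta> \<gamma> g1 F + c * V0_inner \<beta> \<gamma> g2 F"
        by (rule PV.ip_lincomb[of _ "max m n"]) (auto intro: polys_upto_mono F lincomb)
      moreover have "U_inner \<gamma> b (\<lambda>x. a * r1 x + c * r2 x) f = a * U_inner \<gamma> b r1 f + c * U_inner \<gamma> b r2 f"
        by (rule PU.ip_lincomb[of _ "max m n"]) (auto intro: polys_upto_mono f r)
      ultimately show ?thesis using r(3,5)[OF f] by (simp add: FT)
    qed
    then show ?case using r polys_upto_lincomb[OF r(1,2)] by (intro bexI[of _ "\<lambda>x. a * r1 x + c * r2 x"]) auto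
  qed
  have p0: "(sqrt t *\<^sub>R \<xi>, t) \<in> V0" using t norm_\<xi> by (auto simp: V0_def power_mult_distrib)
  have restr: "(\<lambda>f p. if p \<in> V0 then f p else 0) = (restr V0 :: ('a \<times> real \<Rightarrow> real) \<Rightarrow> _)"
    by (simp add: fun_eq_iff restr_def)
  show ?thesis
    unfolding V0_kernel_def U_kernel_def V0_ortho_def restr
    by (rule reproducing_kernel_adjoint[OF PV.poly_inner_axioms PU.poly_inner_axioms T_poly adj p0 p])
qed

end


section \<open>The double integral\<close>

context
  fixes \<mu> \<sigma> :: real
  assumes \<mu>: "\<mu> \<ge> 0" and \<sigma>: "\<sigma> > 0"
begin

definition jac_measure :: "real measure" where
  "jac_measure = interval_density (-1) 1 (jac_weight \<mu> (\<sigma> - 1))"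

lemma jac_weight_measurable [measurable]: "jac_weight a b \<in> borel_measurable borel"
  unfolding jac_weight_def by measurable

lemma jac_weight_nonneg: "jac_weight a b z \<ge> 0"
  by (simp add: jac_weight_def)

lemma sets_jac_measure [simp, measurable_cong]: "sets jac_measure = sets borel"
  by (simp add: jac_measure_def interval_density_def)

lemma jacobi_integral:
  "(\<integral>z. ((1 - z) / 2) ^ i * ((1 + z) / 2) ^ j \<partial>jac_measure)
     = 2 powr (\<mu> + \<sigma>) * Beta (\<mu> + 1 + real i) (\<sigma> + real j)"
proof -
  have "(\<integral>z. ((1 - z) / 2) ^ i * ((1 + z) / 2) ^ j \<partial>jac_measure)
      = (LINT z:{-1..1}|lborel. ((1 - z) / 2) ^ i * ((1 + z) / 2) ^ j * jac_weight \<mu> (\<sigma> - 1) z)"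
    unfolding jac_measure_def by (rule integral_interval_density) (auto simp: jac_weight_nonneg)
  also have "\<dots> = 2 powr (\<mu> + \<sigma>) * Beta (\<mu> + 1 + real i) (\<sigma> + real j)"
    using has_bochner_integral_integral_eq[OF jac_weight_moment[of \<mu> "\<sigma> - 1" i j]] \<mu> \<sigma>
    by (simp add: set_lebesgue_integral_def)
  finally show ?thesis .
qed

lemma finite_jac_measure: "finite_measure jac_measure"
  unfolding jac_measure_def
proof (rule finite_interval_density)
  show "set_integrable lborel {-1..1} (jac_weight \<mu> (\<sigma> - 1))"
    using jac_weight_moment[of \<mu> "\<sigma> - 1" 0 0] \<mu> \<sigma>
    by (simp add: set_integrable_def has_bochner_integral_iff)
qed (auto simp: jac_weight_nonneg)

lemma space_JG: "space (jac_measure \<Otimes>\<^sub>M geg_measure \<sigma>) = UNIV"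
  using sets_eq_imp_space_eq[OF sets_jac_measure] sets_eq_imp_space_eq[OF sets_geg_measure, of \<sigma>]
  by (auto simp: space_pair_measure)

interpretation J: finite_measure jac_measure by (rule finite_jac_measure)

interpretation G: cone_measure "geg_measure \<sigma>" "rad_measure 0 0" "{-1..1}"
  by (rule cone_measure_gegenbauer) (use \<sigma> in auto)

interpretation JG: pair_sigma_finite jac_measure "geg_measure \<sigma>" ..

lemma integrable_JG:
  fixes \<phi> :: "real \<times> real \<Rightarrow> real"
  assumes \<phi>: "continuous_on UNIV \<phi>"
  shows "integrable (jac_measure \<Otimes>\<^sub>M geg_measure \<sigma>) \<phi>"
proof -
  let ?M = "jac_measure \<Otimes>\<^sub>M geg_measure \<sigma>"
  have sM: "sets ?M = sets borel"
    by (metis borel_prod sets_jac_measure sets_geg_measure sets_pair_measure_cong)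
  have "AE z in ?M. z \<in> {-1..1} \<times> {-1..1}"
  proof (rule JG.AE_pair_measure)
    have "({-1..1} \<times> {-1..1} :: (real \<times> real) set) \<in> sets ?M" by (intro pair_measureI) auto
    then show "{z \<in> space ?M. z \<in> {-1..1} \<times> {-1..1}} \<in> sets ?M"
      using sets_eq_imp_space_eq[OF sM] by simp
    have J: "AE x in jac_measure. x \<in> {-1..1}"
      unfolding jac_measure_def by (rule AE_interval_density) (auto simp: jac_weight_nonneg)
    have "AE y in geg_measure \<sigma>. (x, y) \<in> {-1..1} \<times> {-1..1}" if "x \<in> {-1..1}" for x :: real
      using G.AE_N by (rule eventually_mono) (use that in auto)
    with J show "AE x in jac_measure. AE y in geg_measure \<sigma>. (x, y) \<in> {-1..1} \<times> {-1..1}"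
      by (rule eventually_mono)
  qed
  then show ?thesis
    by (intro integrable_AE_compact[OF _ sM _ _ \<phi>, of "{-1..1} \<times> {-1..1}"] compact_Times
        finite_measure_pair_measure finite_jac_measure G.finite_N) auto
qed

lemma integral_JG_iterated:
  fixes \<phi> :: "real \<times> real \<Rightarrow> real"
  assumes "continuous_on UNIV \<phi>"
  shows "(\<integral>z2. \<integral>z1. \<phi> (z1, z2) \<partial>jac_measure \<partial>geg_measure \<sigma>)
       = (\<integral>z. \<phi> z \<partial>(jac_measure \<Otimes>\<^sub>M geg_measure \<sigma>))"
  using JG.integral_snd[of "\<lambda>x y. \<phi> (x, y)"] integrable_JG[OF assms] by simp

text \<open>In terms of \<mu> and \<sigma> the exponents of \<open>z_weight\<close> are \<mu>,
  \<open>\<sigma> - 1\<close> and \<open>\<sigma> - 1/2\<close>: a Jacobi weight in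
  \<open>z1\<close> times the Gegenbauer weight of parameter \<sigma> in \<open>z2\<close>.
  Continuity of the integrand licenses the passage to the product measure.\<close>

lemma z_weight_integral:
  fixes \<phi> :: "real \<times> real \<Rightarrow> real"
  assumes \<phi>: "continuous_on UNIV \<phi>" and \<mu>_def: "\<mu> = (real d - 2) / 2" and \<sigma>_def: "\<sigma> = \<beta> + 1/2"
  shows "(LINT z2:{-1..1}|lborel. LINT z1:{-1..1}|lborel. \<phi> (z1, z2) * z_weight d \<beta> z1 z2)
       = (\<integral>z. \<phi> z \<partial>(jac_measure \<Otimes>\<^sub>M geg_measure \<sigma>))"
proof -
  have \<phi>m: "(\<lambda>z1. \<phi> (z1, z2)) \<in> borel_measurable borel" for z2
    by (intro borel_measurable_continuous_onI continuous_on_compose2[OF \<phi>] continuous_intros) auto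
  have inner: "(LINT z1:{-1..1}|lborel. \<phi> (z1, z2) * z_weight d \<beta> z1 z2)
      = (\<integral>z1. \<phi> (z1, z2) \<partial>jac_measure) * (1 - z2\<^sup>2) powr (\<sigma> - 1/2)" for z2
  proof -
    have "(LINT z1:{-1..1}|lborel. \<phi> (z1, z2) * z_weight d \<beta> z1 z2)
        = (LINT z1:{-1..1}|lborel. (\<phi> (z1, z2) * jac_weight \<mu> (\<sigma> - 1) z1) * (1 - z2\<^sup>2) powr (\<sigma> - 1/2))"
      by (simp add: z_weight_def jac_weight_def \<mu>_def \<sigma>_def mult_ac)
    also have "\<dots> = (LINT z1:{-1..1}|lborel. \<phi> (z1, z2) * jac_weight \<mu> (\<sigma> - 1) z1) * (1 - z2\<^sup>2) powr (\<sigma> - 1/2)"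
      by simp
    also have "(LINT z1:{-1..1}|lborel. \<phi> (z1, z2) * jac_weight \<mu> (\<sigma> - 1) z1) = (\<integral>z1. \<phi> (z1, z2) \<partial>jac_measure)"
      unfolding jac_measure_def
      by (rule integral_interval_density[symmetric]) (auto simp: jac_weight_nonneg \<phi>m)
    finally show ?thesis .
  qed
  have "(\<lambda>z2. \<integral>z1. \<phi> (z1, z2) \<partial>jac_measure) \<in> borel_measurable borel"
  proof -
    have "(\<lambda>(z2, z1). \<phi> (z1, z2)) \<in> borel_measurable (borel \<Otimes>\<^sub>M borel)"
      unfolding borel_prod case_prod_beta
      by (intro borel_measurable_continuous_onI continuous_on_compose2[OF \<phi>] continuous_intros) auto
    then have "(\<lambda>(z2, z1). \<phi> (z1, z2)) \<in> borel_measurable (borel \<Otimes>\<^sub>M jac_measure)"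
      by (simp cong: measurable_cong_sets sets_pair_measure_cong)
    then show ?thesis by (rule J.borel_measurable_lebesgue_integral)
  qed
  then have "(\<integral>z2. \<integral>z1. \<phi> (z1, z2) \<partial>jac_measure \<partial>geg_measure \<sigma>)
      = (LINT z2:{-1..1}|lborel. (\<integral>z1. \<phi> (z1, z2) \<partial>jac_measure) * (1 - z2\<^sup>2) powr (\<sigma> - 1/2))"
    unfolding geg_measure_def by (intro integral_interval_density) auto
  then show ?thesis unfolding inner integral_JG_iterated[OF \<phi>, symmetric] by simp
qed

text \<open>\<open>Gamma (x + k) = pochhammer x k * Gamma x\<close> turns the normalised Beta
  integrals into the coefficients of \<open>geg_trans\<close>.\<close>

lemma Beta_ratio:
  "Beta (\<mu> + 1 + real i) (\<sigma> + real j) / Beta (\<mu> + 1) \<sigma>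
     = pochhammer (\<mu> + 1) i * pochhammer \<sigma> j / pochhammer (\<mu> + \<sigma> + 1) (i + j)"
proof -
  have G: "Gamma (x + real k) = pochhammer x k * Gamma x" if "x > 0" for x :: real and k
    using pochhammer_Gamma[of x k] that by (simp add: nonpos_Ints_def Gamma_eq_zero_iff)
  have "Beta (\<mu> + 1 + real i) (\<sigma> + real j) = (pochhammer (\<mu> + 1) i * Gamma (\<mu> + 1)) * (pochhammer \<sigma> j * Gamma \<sigma>)
      / (pochhammer (\<mu> + \<sigma> + 1) (i + j) * Gamma (\<mu> + \<sigma> + 1))"
    using G[of "\<mu> + 1" i] G[of \<sigma> j] G[of "\<mu> + \<sigma> + 1" "i + j"] \<mu> \<sigma>
    by (simp add: Beta_def algebra_simps)
  moreover have "Beta (\<mu> + 1) \<sigma> = Gamma (\<mu> + 1) * Gamma \<sigma> / Gamma (\<mu> + \<sigma> + 1)"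
    by (simp add: Beta_def algebra_simps)
  moreover have "Gamma (\<mu> + 1) > 0" "Gamma \<sigma> > 0" "Gamma (\<mu> + \<sigma> + 1) > 0"
    using \<mu> \<sigma> by (auto intro: Gamma_real_pos)
  ultimately show ?thesis by simp
qed

lemma measure_JG: "measure (jac_measure \<Otimes>\<^sub>M geg_measure \<sigma>) UNIV
    = 2 powr (\<mu> + \<sigma>) * Beta (\<mu> + 1) \<sigma> * measure (geg_measure \<sigma>) UNIV"
    (is ?eq)
  and measure_JG_pos: "measure (jac_measure \<Otimes>\<^sub>M geg_measure \<sigma>) UNIV > 0"
proof -
  let ?M = "jac_measure \<Otimes>\<^sub>M geg_measure \<sigma>"
  have sM: "space ?M = UNIV" "space (geg_measure \<sigma>) = UNIV"
    using space_JG sets_eq_imp_space_eq[OF sets_geg_measure, of \<sigma>] by auto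
  have "measure ?M UNIV = (\<integral>z. 1 \<partial>?M)" by (simp add: sM)
  also have "\<dots> = (\<integral>z2. \<integral>z1. 1 \<partial>jac_measure \<partial>geg_measure \<sigma>)"
    by (rule integral_JG_iterated[symmetric]) simp
  also have "\<dots> = 2 powr (\<mu> + \<sigma>) * Beta (\<mu> + 1) \<sigma> * measure (geg_measure \<sigma>) UNIV"
    using jacobi_integral[of 0 0] by (simp add: sM mult.commute)
  finally show eq: ?eq .
  have "Beta (\<mu> + 1) \<sigma> > 0"
    unfolding Beta_def using \<mu> \<sigma> by (intro divide_pos_pos mult_pos_pos Gamma_real_pos) auto
  then show "measure ?M UNIV > 0" unfolding eq using G.measure_N_T_pos by simp
qed

text \<open>Binomial expansion separates the variables: \<open>z1\<close> contributes a Beta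
  integral and \<open>z2\<close> a Gegenbauer moment.\<close>

lemma JG_power_mean:
  "mean (jac_measure \<Otimes>\<^sub>M geg_measure \<sigma>)
     (\<lambda>(z1, z2). ((1 - z1) / 2 * v + (1 + z1) / 2 * z2) ^ k) = geg_trans \<mu> \<sigma> k v"
proof -
  let ?M = "jac_measure \<Otimes>\<^sub>M geg_measure \<sigma>" and ?g = "measure (geg_measure \<sigma>) UNIV"
  let ?C = "2 powr (\<mu> + \<sigma>)"
  define c where "c l = real (k choose l) * v ^ l" for l
  have gm: "(\<integral>z2. z2 ^ j \<partial>geg_measure \<sigma>) = gmoment \<sigma> 0 j * ?g" for j
    using geg_measure_moments[of \<sigma> j] \<sigma> G.measure_N_T_pos by (simp add: field_simps)
  have "(\<integral>z. (case z of (z1, z2) \<Rightarrow> ((1 - z1) / 2 * v + (1 + z1) / 2 * z2) ^ k) \<partial>?M)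
      = (\<integral>z. (\<Sum>l\<le>k. c l * (((1 - fst z) / 2) ^ l * ((1 + fst z) / 2) ^ (k - l) * snd z ^ (k - l))) \<partial>?M)"
    by (simp only: case_prod_beta binomial_ring power_mult_distrib c_def mult_ac)
  also have "\<dots> = (\<Sum>l\<le>k. c l * (\<integral>z. ((1 - fst z) / 2) ^ l * ((1 + fst z) / 2) ^ (k - l) * snd z ^ (k - l) \<partial>?M))"
    by (subst Bochner_Integration.integral_sum) (auto intro!: integrable_JG continuous_intros)
  also have "\<dots> = (\<Sum>l\<le>k. c l * (?C * Beta (\<mu> + 1 + real l) (\<sigma> + real (k - l)) * (gmoment \<sigma> 0 (k - l) * ?g)))"
  proof (intro sum.cong refl arg_cong[of _ _ "(*) _"])
    fix l
    have "(\<integral>z. ((1 - fst z) / 2) ^ l * ((1 + fst z) / 2) ^ (k - l) * snd z ^ (k - l) \<partial>?M)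
        = (\<integral>z2. \<integral>z1. ((1 - z1) / 2) ^ l * ((1 + z1) / 2) ^ (k - l) * z2 ^ (k - l) \<partial>jac_measure \<partial>geg_measure \<sigma>)"
      by (subst integral_JG_iterated[symmetric]) (auto intro!: continuous_intros)
    also have "\<dots> = ?C * Beta (\<mu> + 1 + real l) (\<sigma> + real (k - l)) * (gmoment \<sigma> 0 (k - l) * ?g)"
      by (simp add: jacobi_integral gm)
    finally show "(\<integral>z. ((1 - fst z) / 2) ^ l * ((1 + fst z) / 2) ^ (k - l) * snd z ^ (k - l) \<partial>?M)
        = ?C * Beta (\<mu> + 1 + real l) (\<sigma> + real (k - l)) * (gmoment \<sigma> 0 (k - l) * ?g)" .
  qed
  finally have "mean ?M (\<lambda>(z1, z2). ((1 - z1) / 2 * v + (1 + z1) / 2 * z2) ^ k)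
      = (\<Sum>l\<le>k. c l * (?C * Beta (\<mu> + 1 + real l) (\<sigma> + real (k - l)) * (gmoment \<sigma> 0 (k - l) * ?g))
          / (?C * Beta (\<mu> + 1) \<sigma> * ?g))"
    by (simp add: mean_def measure_JG sum_divide_distrib)
  also have "\<dots> = (\<Sum>l\<le>k. c l * (Beta (\<mu> + 1 + real l) (\<sigma> + real (k - l)) / Beta (\<mu> + 1) \<sigma>) * gmoment \<sigma> 0 (k - l))"
    using G.measure_N_T_pos by (intro sum.cong) auto
  also have "\<dots> = geg_trans \<mu> \<sigma> k v"
    unfolding Beta_ratio geg_trans_def c_def by (intro sum.cong) auto
  finally show ?thesis .
qed

end

text \<open>Makes the kernel continuous in its second argument, so that the double integral of the
  theorem can be read as one over the product measure.\<close>

lemma U_kernel_polys_upto: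
  assumes "b > -1/2" "\<gamma> > -1"
  shows "U_kernel n \<gamma> b q \<in> polys_upto n"
proof -
  interpret poly_inner UNIV "U_inner \<gamma> b" by (rule poly_inner_U[OF assms])
  define B where "B = (SOME B. orthonormal_basis (U_inner \<gamma> b) (ortho_polys (U_inner \<gamma> b) n) B)"
  have "restr UNIV = (\<lambda>f::real \<times> real \<Rightarrow> real. f)" by (simp add: fun_eq_iff restr_def)
  then have "orthonormal_basis (U_inner \<gamma> b) (ortho_polys (U_inner \<gamma> b) n) B"
    unfolding B_def using someI_ex[OF ex_orthonormal_basis[of n]] by simp
  then have "Q \<in> polys_upto n" if "Q \<in> B" for Q
    using that by (auto simp: orthonormal_basis_def ortho_polys_def)
  then show ?thesis
    unfolding U_kernel_def reproducing_kernel_def[abs_def] B_def[symmetric] by (intro polys_upto_sum)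
qed

theorem theorem3p3:
  fixes \<gamma> t s :: real and \<xi> \<eta> x y :: "real ^ 'd" and n :: nat
  assumes "CARD('d) \<ge> 2" and "\<gamma> > -1"
    and "norm \<xi> = 1" and "norm \<eta> = 1"
    and "x = sqrt t *\<^sub>R \<xi>" and "(x, t) \<in> V0"
    and "y = sqrt s *\<^sub>R \<eta>" and "(y, s) \<in> V0"
  shows "(\<forall>\<beta>>-1/2. \<exists>A>0.
            A * (LINT z2:{-1..1}|lborel. LINT z1:{-1..1}|lborel. z_weight CARD('d) \<beta> z1 z2) = 1 \<and>
            V0_kernel n \<beta> \<gamma> (x, t) (y, s) =
              A * (LINT z2:{-1..1}|lborel. LINT z1:{-1..1}|lborel.
                     U_kernel n \<gamma> (\<beta> + (real CARD('d) - 1) / 2)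
                       (sqrt t, t)
                       (sqrt s * ((1 - z1) / 2 * (\<xi> \<bullet> \<eta>) + (1 + z1) / 2 * z2), s)
                     * z_weight CARD('d) \<beta> z1 z2)) \<and>
         V0_kernel n (-1/2) \<gamma> (x, t) (y, s) =
           U_kernel n \<gamma> ((real CARD('d) - 2) / 2) (sqrt t, t) (\<xi> \<bullet> y, s)"
proof -
  define \<mu> where "\<mu> = (real CARD('d) - 2) / 2"
  have \<mu>0: "\<mu> \<ge> 0" using assms(1) by (simp add: \<mu>_def)
  note \<mu>_card = \<mu>_def
  have t: "t \<in> {0..1}" and s: "s \<in> {0..1}" using assms(6,8) by (auto simp: V0_def)
  show ?thesis
  proof (intro conjI allI impI)
    fix \<beta> :: real assume \<beta>: "\<beta> > -1/2"
    define \<sigma> where "\<sigma> = \<beta> + 1/2"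
    have \<sigma>0: "\<sigma> > 0" using \<beta> by (simp add: \<sigma>_def)
    interpret zonal \<xi> \<sigma> \<mu>
      by standard (use assms \<sigma>0 \<mu>_card in auto)
    let ?M = "jac_measure \<mu> \<sigma> \<Otimes>\<^sub>M geg_measure \<sigma>"
    define b where "b = \<mu> + \<sigma>"
    have b: "b = \<beta> + (real CARD('d) - 1) / 2" by (simp add: b_def \<mu>_card \<sigma>_def diff_divide_distrib)
    \<comment> \<open>Written through \<open>\<xi> \<bullet> fst p\<close> and
      \<open>sqrt (snd p)\<close>, so that no direction has to be chosen for p, which would be
      ambiguous at the apex. For \<open>p = (y, s)\<close> it is the point in the theorem.\<close>
    define w where "w p z = ((1 - fst z) / 2 * (\<xi> \<bullet> fst p) + (1 + fst z) / 2 * (sqrt (snd p) * snd z), snd p)"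
      for p :: "(real ^ 'd) \<times> real" and z :: "real \<times> real"
    define T where "T f p = mean ?M (\<lambda>z. f (w p z))" for f :: "real \<times> real \<Rightarrow> real" and p
    have w_cont: "continuous_on UNIV (w p)" for p unfolding w_def by (intro continuous_intros) auto
    have fw: "continuous_on UNIV (\<lambda>z. f (w p z))" if "f \<in> polys_upto m" for f m p
      by (rule continuous_on_compose2[OF cont_polys_upto[OF that, of UNIV] w_cont]) auto
    have ident: "V0_kernel n \<beta> \<gamma> (sqrt t *\<^sub>R \<xi>, t) p = T (U_kernel n \<gamma> b (sqrt t, t)) p" if "p \<in> V0" for p
    proof (rule kernel_identity[OF \<sigma>_def assms(2) b_def _ _ t that])
      show "T (\<lambda>q. a * f q + c * g q) p = a * T f p + c * T g p"
        if "f \<in> polys_upto m" "g \<in> polys_upto m" for f g m a c and p :: "(real ^ 'd) \<times> real"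
        unfolding T_def
        by (rule mean_lincomb; rule integrable_JG[OF \<mu>0 \<sigma>0]; rule fw, rule that)
      show "T (\<lambda>p. fst p ^ i * snd p ^ j) (sqrt s *\<^sub>R \<eta>, s) = s ^ j * sqrt s ^ i * geg_trans \<mu> \<sigma> i (\<xi> \<bullet> \<eta>)"
        if "s \<in> {0..1}" for i j s and \<eta> :: "real ^ 'd"
      proof -
        have "fst (w (sqrt s *\<^sub>R \<eta>, s) z) ^ i * snd (w (sqrt s *\<^sub>R \<eta>, s) z) ^ j = (s ^ j * sqrt s ^ i) *
            (case z of (z1, z2) \<Rightarrow> ((1 - z1) / 2 * (\<xi> \<bullet> \<eta>) + (1 + z1) / 2 * z2) ^ i)" for z
        proof -
          have "(1 - fst z) / 2 * (\<xi> \<bullet> (sqrt s *\<^sub>R \<eta>)) + (1 + fst z) / 2 * (sqrt s * snd z)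
              = sqrt s * ((1 - fst z) / 2 * (\<xi> \<bullet> \<eta>) + (1 + fst z) / 2 * snd z)"
            by (simp add: distrib_left mult_ac)
          then show ?thesis by (simp only: w_def fst_conv snd_conv case_prod_beta power_mult_distrib mult_ac)
        qed
        then have "T (\<lambda>p. fst p ^ i * snd p ^ j) (sqrt s *\<^sub>R \<eta>, s) = (s ^ j * sqrt s ^ i) *
            mean ?M (\<lambda>(z1, z2). ((1 - z1) / 2 * (\<xi> \<bullet> \<eta>) + (1 + z1) / 2 * z2) ^ i)"
          by (simp add: T_def mean_def)
        then show ?thesis by (simp only: JG_power_mean[OF \<mu>0 \<sigma>0])
      qed
    qed
    have U_poly: "U_kernel n \<gamma> b (sqrt t, t) \<in> polys_upto n"
      by (rule U_kernel_polys_upto) (use \<mu>0 \<sigma>0 assms(2) in \<open>auto simp: b_def\<close>)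
    \<comment> \<open>T is a mean, so the constant is the reciprocal of the total mass of the
      product measure.\<close>
    define A where "A = 1 / measure ?M UNIV"
    have "measure ?M UNIV > 0" by (rule measure_JG_pos[OF \<mu>0 \<sigma>0])
    then have A: "A > 0" by (simp add: A_def)
    have "(LINT z2:{-1..1}|lborel. LINT z1:{-1..1}|lborel. z_weight CARD('d) \<beta> z1 z2) = measure ?M UNIV"
      using z_weight_integral[OF \<mu>0 \<sigma>0 _ \<mu>_card \<sigma>_def, of "\<lambda>_. 1"]
      by (simp add: space_JG \<mu>0 \<sigma>0)
    then have "A * (LINT z2:{-1..1}|lborel. LINT z1:{-1..1}|lborel. z_weight CARD('d) \<beta> z1 z2) = 1"
      using \<open>measure ?M UNIV > 0\<close> by (simp add: A_def)
    moreover have "V0_kernel n \<beta> \<gamma> (x, t) (y, s) =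
              A * (LINT z2:{-1..1}|lborel. LINT z1:{-1..1}|lborel.
                     U_kernel n \<gamma> (\<beta> + (real CARD('d) - 1) / 2) (sqrt t, t)
                       (sqrt s * ((1 - z1) / 2 * (\<xi> \<bullet> \<eta>) + (1 + z1) / 2 * z2), s)
                     * z_weight CARD('d) \<beta> z1 z2)"
    proof -
      have "w (y, s) (z1, z2) = (sqrt s * ((1 - z1) / 2 * (\<xi> \<bullet> \<eta>) + (1 + z1) / 2 * z2), s)" for z1 z2
        by (simp add: w_def assms(7) distrib_left mult_ac)
      then show ?thesis
        using ident[OF assms(8)] z_weight_integral[OF \<mu>0 \<sigma>0 fw[OF U_poly] \<mu>_card \<sigma>_def, of "(y, s)"]
        by (simp add: T_def mean_def A_def assms(5) b)
    qed
    ultimately show "\<exists>A>0. A * (LINT z2:{-1..1}|lborel. LINT z1:{-1..1}|lborel. z_weight CARD('d) \<beta> z1 z2) = 1 \<and>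
            V0_kernel n \<beta> \<gamma> (x, t) (y, s) =
              A * (LINT z2:{-1..1}|lborel. LINT z1:{-1..1}|lborel.
                     U_kernel n \<gamma> (\<beta> + (real CARD('d) - 1) / 2) (sqrt t, t)
                       (sqrt s * ((1 - z1) / 2 * (\<xi> \<bullet> \<eta>) + (1 + z1) / 2 * z2), s)
                     * z_weight CARD('d) \<beta> z1 z2)"
      using A by blast
  next
    interpret zonal \<xi> 0 \<mu>
      by standard (use assms \<mu>_card in auto)
    \<comment> \<open>\<open>pochhammer 0 (i - l)\<close> is 0 unless l = i, so only the top power
      survives and averaging becomes evaluation.\<close>
    have trans0: "geg_trans \<mu> 0 i v = v ^ i" for i v
    proof -
      have "geg_trans \<mu> 0 i v = (\<Sum>l\<le>i. if l = i then v ^ i else 0)"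
        unfolding geg_trans_def
        by (intro sum.cong refl) (use \<mu>0 pochhammer_pos[of "\<mu> + 1" i] in \<open>auto simp: pochhammer_0_left gmoment_def\<close>)
      then show ?thesis by simp
    qed
    have "V0_kernel n (-1/2) \<gamma> (sqrt t *\<^sub>R \<xi>, t) p = (\<lambda>f p. f (\<xi> \<bullet> fst p, snd p)) (U_kernel n \<gamma> \<mu> (sqrt t, t)) p"
      if "p \<in> V0" for p
      by (rule kernel_identity[OF _ assms(2) _ _ _ t that]) (auto simp: trans0 power_mult_distrib mult_ac)
    from this[OF assms(8)]
    show "V0_kernel n (-1/2) \<gamma> (x, t) (y, s) = U_kernel n \<gamma> ((real CARD('d) - 2) / 2) (sqrt t, t) (\<xi> \<bullet> y, s)"
      by (simp add: assms(5) \<mu>_card)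
  qed
qed

end
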